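(* There exist a countable group $G$ that does not have Kazhdan's property (T) and a generating probability measure $\mu$ on $G$ such that the set of ergodic actions is not dense in $A_\mu(G,X,\nu)$ endowed with the weak topology.
   Context: A probability measure $\mu$ on $G$ is generating if its support generates $G$ as a semigroup. $(X,\nu)$ is a standard nonatomic Lebesgue probability space. $\mathrm{Aut}^*(X,\nu)$ is the group of invertible nonsingular transformations of $(X,\nu)$ modulo equality a.e. For $T\in\mathrm{Aut}^*(X,\nu)$ let $U_{T,1}f=\frac{dT_*\nu}{d\nu}\cdot f\circ T^{-1}$. The weak topology on $\mathrm{Aut}^*(X,\nu)$: $T_n\to T$ iff $\|U_{T_n,1}\mathbf 1_A-U_{T,1}\mathbf 1_A\|_1\to0$ for every measurable $A$. $A_\mu(G,X,\nu)$ is the set of homomorphisms $a:G\to\mathrm{Aut}^*(X,\nu)$ satisfying $\sum_g\mu(g)a(g)_*\nu=\nu$, with the topology of pointwise convergence. An action is ergodic if every invariant measurable set is null or conull. *)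

theory Defs
  imports "HOL-Probability.Probability" "HOL-Algebra.Group"
begin

inductive_set semigroup_generated :: "('g, 'b) monoid_scheme \<Rightarrow> 'g set \<Rightarrow> 'g set"
  for G S where
  gen: "s \<in> S \<Longrightarrow> s \<in> semigroup_generated G S"
| mult: "x \<in> semigroup_generated G S \<Longrightarrow> y \<in> semigroup_generated G S
          \<Longrightarrow> x \<otimes>\<^bsub>G\<^esub> y \<in> semigroup_generated G S"

definition generating :: "('g, 'b) monoid_scheme \<Rightarrow> 'g pmf \<Rightarrow> bool" where
  "generating G \<mu> \<longleftrightarrow> set_pmf \<mu> \<subseteq> carrier G \<and> semigroup_generated G (set_pmf \<mu>) = carrier G"

section \<open>Kazhdan's property (T) (via separable Hilbert spaces = closed subspaces of l2)\<close>

definition l2 :: "(nat \<Rightarrow> complex) set" where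
  "l2 = {f. summable (\<lambda>n. (cmod (f n))^2)}"

definition l2_norm :: "(nat \<Rightarrow> complex) \<Rightarrow> real" where
  "l2_norm f = sqrt (\<Sum>n. (cmod (f n))^2)"

definition l2_inner :: "(nat \<Rightarrow> complex) \<Rightarrow> (nat \<Rightarrow> complex) \<Rightarrow> complex" where
  "l2_inner f g = (\<Sum>n. f n * cnj (g n))"

definition closed_subspace_l2 :: "(nat \<Rightarrow> complex) set \<Rightarrow> bool" where
  "closed_subspace_l2 H \<longleftrightarrow> H \<subseteq> l2 \<and> (\<lambda>n. 0) \<in> H
     \<and> (\<forall>f\<in>H. \<forall>g\<in>H. (\<lambda>n. f n + g n) \<in> H)
     \<and> (\<forall>c::complex. \<forall>f\<in>H. (\<lambda>n. c * f n) \<in> H)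
     \<and> (\<forall>u f. (\<forall>k. u k \<in> H) \<longrightarrow> f \<in> l2
            \<longrightarrow> (\<lambda>k. l2_norm (\<lambda>n. u k n - f n)) \<longlonglongrightarrow> 0 \<longrightarrow> f \<in> H)"

definition unitary_rep ::
  "('g, 'b) monoid_scheme \<Rightarrow> (nat \<Rightarrow> complex) set
     \<Rightarrow> ('g \<Rightarrow> (nat \<Rightarrow> complex) \<Rightarrow> (nat \<Rightarrow> complex)) \<Rightarrow> bool" where
  "unitary_rep G H \<pi> \<longleftrightarrow>
     (\<forall>g\<in>carrier G. bij_betw (\<pi> g) H H
        \<and> (\<forall>f\<in>H. \<forall>h\<in>H. \<forall>c d::complex.
              \<pi> g (\<lambda>n. c * f n + d * h n) = (\<lambda>n. c * \<pi> g f n + d * \<pi> g h n))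
        \<and> (\<forall>f\<in>H. \<forall>h\<in>H. l2_inner (\<pi> g f) (\<pi> g h) = l2_inner f h))
   \<and> (\<forall>g\<in>carrier G. \<forall>h\<in>carrier G. \<forall>f\<in>H. \<pi> (g \<otimes>\<^bsub>G\<^esub> h) f = \<pi> g (\<pi> h f))
   \<and> (\<forall>f\<in>H. \<pi> \<one>\<^bsub>G\<^esub> f = f)"

definition has_almost_invariant_vectors ::
  "('g, 'b) monoid_scheme \<Rightarrow> (nat \<Rightarrow> complex) set
     \<Rightarrow> ('g \<Rightarrow> (nat \<Rightarrow> complex) \<Rightarrow> (nat \<Rightarrow> complex)) \<Rightarrow> bool" where
  "has_almost_invariant_vectors G H \<pi> \<longleftrightarrow>
     (\<forall>Q \<epsilon>. finite Q \<longrightarrow> Q \<subseteq> carrier G \<longrightarrow> \<epsilon> > 0 \<longrightarrow>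
        (\<exists>v\<in>H. l2_norm v = 1 \<and> (\<forall>g\<in>Q. l2_norm (\<lambda>n. \<pi> g v n - v n) < \<epsilon>)))"

definition has_nonzero_invariant_vector ::
  "('g, 'b) monoid_scheme \<Rightarrow> (nat \<Rightarrow> complex) set
     \<Rightarrow> ('g \<Rightarrow> (nat \<Rightarrow> complex) \<Rightarrow> (nat \<Rightarrow> complex)) \<Rightarrow> bool" where
  "has_nonzero_invariant_vector G H \<pi> \<longleftrightarrow>
     (\<exists>v\<in>H. v \<noteq> (\<lambda>n. 0) \<and> (\<forall>g\<in>carrier G. \<pi> g v = v))"

definition kazhdan_T :: "('g, 'b) monoid_scheme \<Rightarrow> bool" where
  "kazhdan_T G \<longleftrightarrow>
     (\<forall>H \<pi>. closed_subspace_l2 H \<longrightarrow> unitary_rep G H \<pi>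
        \<longrightarrow> has_almost_invariant_vectors G H \<pi> \<longrightarrow> has_nonzero_invariant_vector G H \<pi>)"

definition atomless :: "'x measure \<Rightarrow> bool" where
  "atomless M \<longleftrightarrow> (\<forall>A\<in>sets M. emeasure M A > 0 \<longrightarrow>
     (\<exists>B\<in>sets M. B \<subseteq> A \<and> 0 < emeasure M B \<and> emeasure M B < emeasure M A))"

text \<open>Representatives of elements of Aut*(X,nu): measurable, invertible mod null sets,
  nonsingular (T_* nu and nu have the same null sets).\<close>
definition ae_inverse :: "'x measure \<Rightarrow> ('x \<Rightarrow> 'x) \<Rightarrow> ('x \<Rightarrow> 'x) \<Rightarrow> bool" where
  "ae_inverse M T S \<longleftrightarrow> S \<in> measurable M M
     \<and> (AE x in M. S (T x) = x) \<and> (AE x in M. T (S x) = x)"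

definition nonsingular_aut :: "'x measure \<Rightarrow> ('x \<Rightarrow> 'x) \<Rightarrow> bool" where
  "nonsingular_aut M T \<longleftrightarrow> T \<in> measurable M M \<and> (\<exists>S. ae_inverse M T S)
     \<and> (\<forall>A\<in>sets M. emeasure M (T -` A \<inter> space M) = 0 \<longleftrightarrow> emeasure M A = 0)"

definition aut_inv :: "'x measure \<Rightarrow> ('x \<Rightarrow> 'x) \<Rightarrow> ('x \<Rightarrow> 'x)" where
  "aut_inv M T = (SOME S. ae_inverse M T S)"

definition U_ind :: "'x measure \<Rightarrow> ('x \<Rightarrow> 'x) \<Rightarrow> 'x set \<Rightarrow> 'x \<Rightarrow> real" where
  "U_ind M T A x = enn2real (RN_deriv M (distr M M T) x) * indicator A (aut_inv M T x)"

definition weak_dist :: "'x measure \<Rightarrow> ('x \<Rightarrow> 'x) \<Rightarrow> ('x \<Rightarrow> 'x) \<Rightarrow> 'x set \<Rightarrow> ennreal" where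
  "weak_dist M T T' A = (\<integral>\<^sup>+ x. ennreal \<bar>U_ind M T A x - U_ind M T' A x\<bar> \<partial>M)"

definition nonsingular_action :: "('g, 'b) monoid_scheme \<Rightarrow> 'x measure \<Rightarrow> ('g \<Rightarrow> 'x \<Rightarrow> 'x) \<Rightarrow> bool" where
  "nonsingular_action G M a \<longleftrightarrow> (\<forall>g\<in>carrier G. nonsingular_aut M (a g))
     \<and> (\<forall>g\<in>carrier G. \<forall>h\<in>carrier G. AE x in M. a (g \<otimes>\<^bsub>G\<^esub> h) x = a g (a h x))"

definition A_mu :: "('g, 'b) monoid_scheme \<Rightarrow> 'g pmf \<Rightarrow> 'x measure \<Rightarrow> ('g \<Rightarrow> 'x \<Rightarrow> 'x) set" where
  "A_mu G \<mu> M = {a. nonsingular_action G M a \<and>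
     (\<forall>A\<in>sets M. (\<integral>\<^sup>+ g. emeasure (distr M M (a g)) A \<partial>measure_pmf \<mu>) = emeasure M A)}"

definition ergodic_action :: "('g, 'b) monoid_scheme \<Rightarrow> 'x measure \<Rightarrow> ('g \<Rightarrow> 'x \<Rightarrow> 'x) \<Rightarrow> bool" where
  "ergodic_action G M a \<longleftrightarrow> (\<forall>A\<in>sets M.
     (\<forall>g\<in>carrier G. emeasure M (((a g -` A \<inter> space M) - A) \<union> (A - (a g -` A \<inter> space M))) = 0)
       \<longrightarrow> emeasure M A = 0 \<or> emeasure M (space M - A) = 0)"

text \<open>Density of the ergodic actions in A_mu, for the topology of pointwise convergence
  with the weak topology on Aut*: every basic neighbourhood of every a in A_mu contains
  an ergodic b in A_mu.\<close>
definition ergodic_dense :: "('g, 'b) monoid_scheme \<Rightarrow> 'g pmf \<Rightarrow> 'x measure \<Rightarrow> bool" where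
  "ergodic_dense G \<mu> M \<longleftrightarrow> (\<forall>a\<in>A_mu G \<mu> M. \<forall>F \<A> (\<epsilon>::real).
     finite F \<longrightarrow> F \<subseteq> carrier G \<longrightarrow> finite \<A> \<longrightarrow> \<A> \<subseteq> sets M \<longrightarrow> \<epsilon> > 0 \<longrightarrow>
     (\<exists>b\<in>A_mu G \<mu> M. ergodic_action G M b \<and>
        (\<forall>g\<in>F. \<forall>A\<in>\<A>. weak_dist M (b g) (a g) A < ennreal \<epsilon>)))"

end

theory Submission
  imports Defs "HOL-Library.Function_Algebras" "HOL-Computational_Algebra.Primes"
begin

text \<open>The group is \<open>L \<times> \<int>\<close>, where \<open>L\<close> is generated by five elementary subgroups of order 101 acting on
  triples of Laurent series over the field with 101 elements; the factor \<open>\<int>\<close> rules out property (T).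
  Any two of the five subgroups commute or generate a Heisenberg group, so the defects from their invariant
  vectors are almost orthogonal. This gives every representation of \<open>L\<close> a spectral gap, uniformly.
  The measure on \<open>L\<close> is the convolution of the uniform measures on two conjugate copies of the finite group \<open>SL\<^sub>3\<close>, and it has
  a stationary but not invariant measure, namely the uniform one on primitive vectors modulo powers of \<open>t\<close>.

  Let \<open>L \<times> \<int>\<close> act through \<open>L\<close> on two halves of the space, trivially on the first and by this projective action
  on the second, and suppose that an ergodic action is close to it. The indicator of the first half is almost
  invariant under the Koopman representation of \<open>L\<close>, so by the spectral gap there is a nonzero invariant vector \<open>f\<close>,
  and \<open>f\<^sup>2 \<nu>\<close> is an \<open>L\<close>-invariant measure. Comparing it with the stationary measure \<open>\<nu>\<close> shows that \<open>L\<close> preserves \<open>\<nu>\<close>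
  on the support of \<open>f\<close>. Since \<open>L\<close> is complemented by a central subgroup, the set of points at which all of \<open>L\<close> preserves \<open>\<nu>\<close>
  is invariant under the whole group and by ergodicity it is conull. But then \<open>L\<close> almost preserves the measure of every set
  in the original action, which fails on the second half.\<close>

section \<open>Almost orthogonal invariant projections\<close>

text \<open>The number 101 is the least prime above 100. In a Heisenberg pair the two fixed spaces,
  away from the vectors fixed by the centre, have cosine at most 1 / sqrt q <= 1/10. This yields the
  constant 1/8 of \<open>ip_defect_heis\<close>, and five subgroups give 2 * 4 * 1/8 = 1, exactly
  the threshold of \<open>ip_laplace\<close>. The five come from the cyclic triple e12, e23, e31,
  which generates SL_3, and from its conjugate under d = diag(t, 1, 1); e23 commutes with d and is
  shared.

  Stationarity is a cancellation. Let K and dKd^-1 be the two copies. The densities of d nu and d^-1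
  nu depend on the leading digits only, and K is transitive on these. So averaging over dKd^-1 turns
  nu into d nu, and averaging over K turns d nu back into nu, although d nu and nu differ.

  The obstacle is the factor Z: it acts trivially in the model but arbitrarily in a nearby ergodic
  action, so stationarity under the whole group says nothing about L at first. Ergodicity repairs
  this, since it forces central elements to preserve nu (\<open>rho_central\<close>).\<close>

context group
begin

definition one_param :: "('f::{finite,comm_ring_1} \<Rightarrow> 'a) \<Rightarrow> bool" where
  "one_param k \<longleftrightarrow> (\<forall>c. k c \<in> carrier G) \<and> (\<forall>c d. k (c + d) = k c \<otimes> k d)"

lemma one_paramD:
  assumes "one_param k"
  shows "k c \<in> carrier G" "k (c + d) = k c \<otimes> k d" "k 0 = \<one>" "k (- c) = inv (k c)"
proof -
  have k: "k c \<in> carrier G" for c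
    using assms by (auto simp: one_param_def)
  then show "k c \<in> carrier G" .
  show "k (c + d) = k c \<otimes> k d"
    using assms by (auto simp: one_param_def)
  have "k (0 + 0) = k 0 \<otimes> k 0"
    using assms unfolding one_param_def by blast
  then show k0: "k 0 = \<one>"
    using k[of 0] by simp
  have "k (- c + c) = k (- c) \<otimes> k c"
    using assms unfolding one_param_def by blast
  then show "k (- c) = inv (k c)"
    using k k0 by (metis add.left_inverse inv_equality)
qed

definition heis :: "('f::{finite,comm_ring_1} \<Rightarrow> 'a) \<Rightarrow> ('f \<Rightarrow> 'a) \<Rightarrow> ('f \<Rightarrow> 'a) \<Rightarrow> bool" where
  "heis k k' z \<longleftrightarrow> one_param k \<and> one_param k' \<and> one_param z
     \<and> (\<forall>c d. k c \<otimes> z d = z d \<otimes> k c) \<and> (\<forall>c d. k' c \<otimes> z d = z d \<otimes> k' c)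
     \<and> (\<forall>c d. k c \<otimes> k' d = z (c * d) \<otimes> k' d \<otimes> k c)"

end

text \<open>Only semi-definite, because the vectors will be functions and not classes modulo null
  sets; \<open>V\<close> carves the square-integrable ones out of the type of all functions. The
  action laws hold exactly and not up to norm zero, which is why strict actions are constructed
  later.\<close>

locale semi_inner_rep = group G for G :: "('g, 'b) monoid_scheme" (structure) +
  fixes V :: "'v::real_vector set" and ip :: "'v \<Rightarrow> 'v \<Rightarrow> real" and T :: "'g \<Rightarrow> 'v \<Rightarrow> 'v"
  assumes V: "subspace V"
    and ip_sym: "x \<in> V \<Longrightarrow> y \<in> V \<Longrightarrow> ip x y = ip y x"
    and ip_add: "x \<in> V \<Longrightarrow> y \<in> V \<Longrightarrow> z \<in> V \<Longrightarrow> ip (x + y) z = ip x z + ip y z"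
    and ip_scale: "x \<in> V \<Longrightarrow> z \<in> V \<Longrightarrow> ip (c *\<^sub>R x) z = c * ip x z"
    and ip_nonneg: "x \<in> V \<Longrightarrow> 0 \<le> ip x x"
    and T_linear: "g \<in> carrier G \<Longrightarrow> linear (T g)"
    and T_V: "g \<in> carrier G \<Longrightarrow> x \<in> V \<Longrightarrow> T g x \<in> V"
    and T_mult: "g \<in> carrier G \<Longrightarrow> h \<in> carrier G \<Longrightarrow> T (g \<otimes> h) x = T g (T h x)"
    and T_one: "T \<one> x = x"
    and T_ip: "g \<in> carrier G \<Longrightarrow> x \<in> V \<Longrightarrow> y \<in> V \<Longrightarrow> ip (T g x) (T g y) = ip x y"
begin

lemma V_add [simp]: "x \<in> V \<Longrightarrow> y \<in> V \<Longrightarrow> x + y \<in> V"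
  and V_diff [simp]: "x \<in> V \<Longrightarrow> y \<in> V \<Longrightarrow> x - y \<in> V"
  and V_scale [simp]: "x \<in> V \<Longrightarrow> c *\<^sub>R x \<in> V"
  and V_sum [simp]: "(\<And>i. i \<in> I \<Longrightarrow> f i \<in> V) \<Longrightarrow> sum f I \<in> V"
  and V_zero [simp]: "0 \<in> V"
  using V by (auto intro: subspace_add subspace_diff subspace_scale subspace_sum subspace_0)

lemma ip_add_right: "x \<in> V \<Longrightarrow> y \<in> V \<Longrightarrow> z \<in> V \<Longrightarrow> ip z (x + y) = ip z x + ip z y"
  by (metis V_add ip_add ip_sym)

lemma ip_scale_right: "x \<in> V \<Longrightarrow> z \<in> V \<Longrightarrow> ip z (c *\<^sub>R x) = c * ip z x"
  by (metis V_scale ip_scale ip_sym)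

lemma ip_diff: "x \<in> V \<Longrightarrow> y \<in> V \<Longrightarrow> z \<in> V \<Longrightarrow> ip (x - y) z = ip x z - ip y z"
  by (metis V_diff add_diff_cancel_right' diff_add_cancel ip_add)

lemma ip_diff_right: "x \<in> V \<Longrightarrow> y \<in> V \<Longrightarrow> z \<in> V \<Longrightarrow> ip z (x - y) = ip z x - ip z y"
  by (metis V_diff ip_diff ip_sym)

lemma ip_zero [simp]: "x \<in> V \<Longrightarrow> ip 0 x = 0" "x \<in> V \<Longrightarrow> ip x 0 = 0"
  using ip_scale[of 0 x 0] ip_sym[of 0 x] by auto

lemma ip_sum: "(\<And>i. i \<in> I \<Longrightarrow> f i \<in> V) \<Longrightarrow> z \<in> V \<Longrightarrow> ip (sum f I) z = (\<Sum>i\<in>I. ip (f i) z)"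
  by (induction I rule: infinite_finite_induct) (auto simp: ip_add)

lemma ip_sum_right: "(\<And>i. i \<in> I \<Longrightarrow> f i \<in> V) \<Longrightarrow> z \<in> V \<Longrightarrow> ip z (sum f I) = (\<Sum>i\<in>I. ip z (f i))"
  by (induction I rule: infinite_finite_induct) (auto simp: ip_add_right)

lemmas ip_lin = ip_add ip_add_right ip_diff ip_diff_right ip_scale ip_scale_right

lemma ip_weighted_AM_GM:
  assumes "x \<in> V" "y \<in> V" "e > 0"
  shows "2 * ip x y \<le> e * ip x x + ip y y / e"
proof -
  have "0 \<le> ip (e *\<^sub>R x - y) (e *\<^sub>R x - y)"
    using assms by (intro ip_nonneg) auto
  also have "\<dots> = e * (e * ip x x - 2 * ip x y) + ip y y"
    using assms ip_sym[of y x] by (simp add: ip_lin algebra_simps)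
  also have "\<dots> = e * (e * ip x x - 2 * ip x y + ip y y / e)"
    using assms by (simp add: field_simps)
  finally show ?thesis
    using assms by (simp add: zero_le_mult_iff)
qed

lemma T_adjoint:
  assumes "g \<in> carrier G" "x \<in> V" "y \<in> V"
  shows "ip (T g x) y = ip x (T (inv g) y)"
proof -
  have "T g (T (inv g) y) = y"
    using assms by (simp add: T_mult[symmetric] T_one)
  then show ?thesis
    using T_ip[of g x "T (inv g) y"] assms by (auto simp: T_V)
qed

text \<open>For a one-parameter subgroup this is the orthogonal projection onto its fixed vectors
  (\<open>T_avg_absorb\<close>, \<open>avg_idem\<close>, \<open>avg_adjoint\<close>), and
  \<open>defect\<close> is the complementary projection.\<close>

definition avg :: "('f::{finite,comm_ring_1} \<Rightarrow> 'g) \<Rightarrow> 'v \<Rightarrow> 'v" where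
  "avg k x = (1 / CARD('f)) *\<^sub>R (\<Sum>c\<in>UNIV. T (k c) x)"

lemma T_commute:
  assumes "g \<in> carrier G" "h \<in> carrier G" "g \<otimes> h = h \<otimes> g"
  shows "T g (T h x) = T h (T g x)"
  using assms T_mult by metis

definition defect :: "('f::{finite,comm_ring_1} \<Rightarrow> 'g) \<Rightarrow> 'v \<Rightarrow> 'v" where
  "defect k x = x - avg k x"

context
  fixes k :: "'f::{finite,comm_ring_1} \<Rightarrow> 'g"
  assumes k: "one_param k"
begin

lemma avg_linear: "linear (avg k)"
proof -
  have "linear (\<lambda>x. (\<Sum>c\<in>UNIV. T (k c) x))"
    by (intro linear_compose_sum ballI T_linear one_paramD(1)[OF k])
  then show ?thesis
    unfolding avg_def[abs_def] by (rule linear_compose_scale_right)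
qed

lemma avg_V [simp]: "x \<in> V \<Longrightarrow> avg k x \<in> V"
  unfolding avg_def by (intro V_scale V_sum T_V one_paramD(1)[OF k])

lemma T_avg: "g \<in> carrier G \<Longrightarrow> T g (avg k x) = (1 / CARD('f)) *\<^sub>R (\<Sum>c\<in>UNIV. T g (T (k c) x))"
  unfolding avg_def by (simp add: T_linear linear_scale linear_sum)

lemma T_avg_absorb: "T (k d) (avg k x) = avg k x"
proof -
  have "(\<Sum>c\<in>UNIV. T (k d) (T (k c) x)) = (\<Sum>c\<in>UNIV. T (k (d + c)) x)"
    by (intro sum.cong refl) (simp add: one_paramD[OF k] T_mult)
  also have "\<dots> = (\<Sum>c\<in>UNIV. T (k c) x)"
    by (rule sum.reindex_bij_witness[of _ "\<lambda>c. c - d" "\<lambda>c. d + c"]) auto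
  finally show ?thesis
    unfolding T_avg[OF one_paramD(1)[OF k]] by (simp only: avg_def)
qed

lemma avg_idem: "avg k (avg k x) = avg k x"
proof -
  have "avg k (avg k x) = (1 / CARD('f)) *\<^sub>R (\<Sum>c\<in>(UNIV::'f set). avg k x)"
    unfolding avg_def[of k "avg k x"] by (simp only: T_avg_absorb)
  then show ?thesis
    by (simp add: sum_constant_scaleR)
qed

lemma avg_adjoint:
  assumes "x \<in> V" "y \<in> V"
  shows "ip (avg k x) y = ip x (avg k y)"
proof -
  have "(\<Sum>c\<in>UNIV. ip (T (k c) x) y) = (\<Sum>c\<in>UNIV. ip x (T (k (- c)) y))"
    using assms by (simp add: T_adjoint one_paramD[OF k])
  also have "\<dots> = (\<Sum>c\<in>UNIV. ip x (T (k c) y))"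
    by (rule sum.reindex_bij_witness[of _ "\<lambda>c. - c" "\<lambda>c. - c"]) auto
  finally show ?thesis
    using assms by (simp add: avg_def ip_lin ip_sum ip_sum_right T_V one_paramD[OF k])
qed

lemma ip_avg_avg: "x \<in> V \<Longrightarrow> ip (avg k x) (avg k x) = ip x (avg k x)"
  by (simp add: avg_adjoint avg_idem)

lemma T_avg_comm:
  assumes "g \<in> carrier G" "\<And>c. g \<otimes> k c = k c \<otimes> g"
  shows "T g (avg k x) = avg k (T g x)"
proof -
  have "T g (T (k c) x) = T (k c) (T g x)" for c
    using assms by (intro T_commute) (auto simp: one_paramD[OF k])
  then show ?thesis
    unfolding T_avg[OF assms(1)] by (simp only: avg_def)
qed

lemma defect_linear: "linear (defect k)"
  unfolding defect_def[abs_def] by (intro linear_compose_sub avg_linear linear_ident)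

lemma defect_V [simp]: "x \<in> V \<Longrightarrow> defect k x \<in> V"
  by (simp add: defect_def)

lemma defect_adjoint: "x \<in> V \<Longrightarrow> y \<in> V \<Longrightarrow> ip (defect k x) y = ip x (defect k y)"
  by (simp add: defect_def ip_lin avg_adjoint)

lemma defect_idem: "defect k (defect k x) = defect k x"
  by (simp add: defect_def linear_diff[OF avg_linear] avg_idem)

lemma ip_defect: "x \<in> V \<Longrightarrow> ip x (defect k x) = ip (defect k x) (defect k x)"
  by (simp add: defect_adjoint defect_idem)

lemma ip_defect_le: "x \<in> V \<Longrightarrow> ip (defect k x) (defect k x) \<le> ip x x"
  using ip_nonneg[of "avg k x"] ip_defect[of x]
  by (simp add: defect_def ip_lin ip_avg_avg avg_adjoint)

end

lemma avg_avg_comm: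
  fixes k :: "'f::{finite,comm_ring_1} \<Rightarrow> 'g" and k' :: "'f' ::{finite,comm_ring_1} \<Rightarrow> 'g"
  assumes k: "one_param k" and k': "one_param k'" and "\<And>c d. k c \<otimes> k' d = k' d \<otimes> k c"
  shows "avg k (avg k' x) = avg k' (avg k x)"
proof -
  have "avg k (avg k' x) = (1 / CARD('f)) *\<^sub>R (\<Sum>c\<in>UNIV. avg k' (T (k c) x))"
    unfolding avg_def[of k] using T_avg_comm[OF k'] assms(3) by (simp add: one_paramD[OF k])
  also have "\<dots> = avg k' (avg k x)"
    by (simp add: avg_def[of k] linear_scale[OF avg_linear[OF k']] linear_sum[OF avg_linear[OF k']])
  finally show ?thesis .
qed

text \<open>For commuting orthogonal projections P and Q, <Pv, Qv> = <QPv, PQv> is the squared norm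
  of PQv.\<close>

lemma ip_defect_commuting:
  assumes k: "one_param k" and k': "one_param k'" and "avg k (avg k' v) = avg k' (avg k v)"
    and v: "v \<in> V"
  shows "0 \<le> ip (defect k v) (defect k' v)"
proof -
  have c: "defect k (defect k' v) = defect k' (defect k v)"
    using assms(3) by (simp add: defect_def linear_diff[OF avg_linear[OF k]]
        linear_diff[OF avg_linear[OF k']])
  have "ip (defect k v) (defect k' v) = ip (defect k (defect k v)) (defect k' (defect k' v))"
    by (simp add: defect_idem k k')
  also have "\<dots> = ip (defect k' (defect k v)) (defect k (defect k' v))"
    using v k k' by (metis defect_adjoint c defect_V defect_idem)
  finally show ?thesis
    using v k k' by (simp add: c ip_nonneg)
qed

text \<open>On the vectors without \<open>z\<close>-invariant part, the average of \<open>z (c * d)\<close> over \<open>c\<close> vanishes,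
  so conjugating by \<open>k' d\<close> makes the projection onto the \<open>k\<close>-invariants orthogonal to itself.\<close>

lemma heis_compress:
  fixes k k' z :: "'f::{finite,field} \<Rightarrow> 'g"
  assumes h: "heis k k' z" and u: "avg z u = 0"
  shows "avg k (avg k' (avg k u)) = (1 / CARD('f)) *\<^sub>R avg k u"
proof -
  have k: "one_param k" and k': "one_param k'" and z: "one_param z"
    and kz: "k c \<otimes> z d = z d \<otimes> k c" and k'z: "k' c \<otimes> z d = z d \<otimes> k' c"
    and kk': "k c \<otimes> k' d = z (c * d) \<otimes> k' d \<otimes> k c" for c d
    using h by (auto simp: heis_def)
  note car = one_paramD(1)[OF k] one_paramD(1)[OF k'] one_paramD(1)[OF z]
  have vanish: "avg k (T (k' d) (avg k u)) = 0" if d: "d \<noteq> 0" for d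
  proof -
    have "(\<Sum>c\<in>UNIV. T (k c) (T (k' d) (avg k u))) = (\<Sum>c\<in>UNIV. T (z (c * d)) (T (k' d) (avg k u)))"
    proof (intro sum.cong refl)
      fix c
      have "T (k c) (T (k' d) (avg k u)) = T (z (c * d)) (T (k' d) (T (k c) (avg k u)))"
        using car kk' by (metis T_mult m_closed)
      then show "T (k c) (T (k' d) (avg k u)) = T (z (c * d)) (T (k' d) (avg k u))"
        by (simp add: T_avg_absorb[OF k])
    qed
    also have "\<dots> = (\<Sum>c\<in>UNIV. T (z c) (T (k' d) (avg k u)))"
      by (rule sum.reindex_bij_witness[of _ "\<lambda>c. c / d" "\<lambda>c. c * d"]) (use d in auto)
    finally have "avg k (T (k' d) (avg k u)) = avg z (T (k' d) (avg k u))"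
      by (simp add: avg_def)
    also have "\<dots> = T (k' d) (avg z (avg k u))"
      using T_avg_comm[OF z, of "k' d"] k'z car by simp
    also have "avg z (avg k u) = avg k (avg z u)"
      using avg_avg_comm[OF z k] kz by simp
    also have "T (k' d) (avg k (avg z u)) = 0"
      using u car by (simp add: linear_0[OF avg_linear[OF k]] linear_0[OF T_linear])
    finally show ?thesis .
  qed
  have "avg k (avg k' (avg k u)) = (1 / CARD('f)) *\<^sub>R (\<Sum>d\<in>UNIV. avg k (T (k' d) (avg k u)))"
    unfolding avg_def[of k'] by (simp add: linear_scale[OF avg_linear[OF k]] linear_sum[OF avg_linear[OF k]])
  also have "(\<Sum>d\<in>UNIV. avg k (T (k' d) (avg k u))) = (\<Sum>d\<in>{0}. avg k (T (k' d) (avg k u)))"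
    by (intro sum.mono_neutral_right) (auto simp: vanish)
  also have "\<dots> = avg k u"
    by (simp add: one_paramD[OF k'] T_one avg_idem[OF k])
  finally show ?thesis .
qed

text \<open>The central projection splits \<open>v\<close> into \<open>w = avg z v\<close> and
  \<open>u = v - w\<close>. On \<open>w\<close> the two subgroups commute, so that part contributes
  a nonnegative term; on \<open>u\<close>, \<open>heis_compress\<close> bounds the cosine between
  the two fixed spaces by 1 / sqrt q, hence by 1/10. Cross terms vanish because both defects respect
  the splitting.\<close>

lemma ip_defect_heis:
  fixes k k' z :: "'f::{finite,field} \<Rightarrow> 'g"
  assumes h: "heis k k' z" and q: "CARD('f) \<ge> 100" and v: "v \<in> V"
  shows "2 * ip (defect k v) (defect k' v)
    \<ge> - (1/8) * (ip (defect k v) (defect k v) + ip (defect k' v) (defect k' v))"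
proof -
  have k: "one_param k" and k': "one_param k'" and z: "one_param z"
    and kz: "k c \<otimes> z d = z d \<otimes> k c" and k'z: "k' c \<otimes> z d = z d \<otimes> k' c"
    and kk': "k c \<otimes> k' d = z (c * d) \<otimes> k' d \<otimes> k c" for c d
    using h by (auto simp: heis_def)
  note car = one_paramD(1)[OF k] one_paramD(1)[OF k'] one_paramD(1)[OF z]
  define w where "w = avg z v"
  define u where "u = v - w"
  have V: "w \<in> V" "u \<in> V" and vwu: "v = w + u"
    using v z by (auto simp: w_def u_def)
  have zw: "avg z w = w" and zu: "avg z u = 0"
    by (simp_all add: w_def u_def linear_diff[OF avg_linear[OF z]] avg_idem[OF z])
  have comm: "avg z (avg k x) = avg k (avg z x)" "avg z (avg k' x) = avg k' (avg z x)" for x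
    using avg_avg_comm[OF z k] kz avg_avg_comm[OF z k'] k'z by simp_all
  note D = defect_def
  have "T (k c) (T (k' d) w) = T (k' d) (T (k c) w)" for c d
  proof -
    have "T (k c) (T (k' d) w) = T (z (c * d)) (T (k' d) (T (k c) w))"
      using car kk' by (metis T_mult m_closed)
    also have "\<dots> = T (k' d) (T (k c) (T (z (c * d)) w))"
      using car k'z kz T_commute by metis
    also have "T (z (c * d)) w = w"
      unfolding w_def by (rule T_avg_absorb[OF z])
    finally show ?thesis .
  qed
  note Tc = this
  have "avg k (avg k' w) = (1 / CARD('f)) *\<^sub>R (\<Sum>c\<in>UNIV. avg k' (T (k c) w))"
    unfolding avg_def[of k] by (simp only: T_avg[OF k'] car Tc) (simp only: avg_def[of k'])
  also have "\<dots> = avg k' (avg k w)"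
    by (simp add: avg_def[of k] linear_scale[OF avg_linear[OF k']] linear_sum[OF avg_linear[OF k']])
  finally have w_pos: "0 \<le> ip (defect k w) (defect k' w)"
    by (intro ip_defect_commuting k k' V)
  have orth: "ip x y = 0" if "x \<in> V" "y \<in> V" "avg z x = x" "avg z y = 0" for x y
    using avg_adjoint[OF z that(1,2)] that by simp
  then have orth': "ip y x = 0" if "x \<in> V" "y \<in> V" "avg z x = x" "avg z y = 0" for x y
    using that ip_sym by metis
  have fix_w: "avg z (defect k w) = defect k w" "avg z (defect k' w) = defect k' w"
    and kill_u: "avg z (defect k u) = 0" "avg z (defect k' u) = 0"
    by (simp_all add: D linear_diff[OF avg_linear[OF z]] comm zw zu
        linear_0[OF avg_linear[OF k]] linear_0[OF avg_linear[OF k']])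
  have split: "defect k v = defect k w + defect k u" "defect k' v = defect k' w + defect k' u"
    by (simp_all add: vwu linear_add[OF defect_linear[OF k]] linear_add[OF defect_linear[OF k']])
  have VD: "defect k w \<in> V" "defect k' w \<in> V" "defect k u \<in> V" "defect k' u \<in> V"
    using V k k' by auto
  have s12: "ip (defect k v) (defect k' v) = ip (defect k w) (defect k' w) + ip (defect k u) (defect k' u)"
    unfolding split using VD orth orth' fix_w kill_u by (simp add: ip_lin)
  have s11: "ip (defect k v) (defect k v) = ip (defect k w) (defect k w) + ip (defect k u) (defect k u)"
    unfolding split using VD orth orth' fix_w kill_u by (simp add: ip_lin)
  have s22: "ip (defect k' v) (defect k' v) = ip (defect k' w) (defect k' w) + ip (defect k' u) (defect k' u)"
    unfolding split using VD orth orth' fix_w kill_u by (simp add: ip_lin)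
  define p where "p = avg k u"
  define p' where "p' = avg k' u"
  have pV: "p \<in> V" "p' \<in> V"
    using V k k' by (auto simp: p_def p'_def)
  define n x y c where "n = ip u u" and "x = ip p p" and "y = ip p' p'" and "c = ip p p'"
  have xy: "ip u p = x" "ip u p' = y" "ip p u = x" "ip p' u = y" "ip p' p = c"
    using V pV ip_avg_avg[OF k V(2)] ip_avg_avg[OF k' V(2)] ip_sym
    by (auto simp: p_def p'_def x_def y_def c_def)
  have pos: "0 \<le> x" "0 \<le> y"
    using ip_nonneg pV by (auto simp: x_def y_def)
  \<comment> \<open>With P and P' for the two projections, the squared norm of P'p is <p, PP'p>, and
    PP'p = p / q by \<open>heis_compress\<close>.\<close>
  have pp': "ip (avg k' p) (avg k' p) = x / CARD('f)"
  proof -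
    have "ip (avg k' p) (avg k' p) = ip p (avg k' p)"
      using ip_avg_avg[OF k'] pV by simp
    also have "\<dots> = ip (avg k p) (avg k' p)"
      by (simp add: p_def avg_idem[OF k])
    also have "\<dots> = ip p (avg k (avg k' p))"
      using avg_adjoint[OF k] pV k' by simp
    also have "avg k (avg k' p) = (1 / CARD('f)) *\<^sub>R p"
      unfolding p_def by (rule heis_compress[OF h zu])
    finally show ?thesis
      using pV by (simp add: ip_lin x_def)
  qed
  \<comment> \<open>The weight 1/10 balances the two terms y / 10 and 10 x / q, the latter being at
    most x / 10 because q is at least 100.\<close>
  have "2 * c \<le> (x + y) / 10"
  proof -
    have "c = ip p' (avg k' p)"
      using avg_adjoint[OF k' pV(2,1)] by (simp add: p'_def avg_idem[OF k'] c_def xy(5)[unfolded p'_def c_def])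
    then have "2 * c \<le> (1/10) * y + (x / CARD('f)) / (1/10)"
      using ip_weighted_AM_GM[of p' "avg k' p" "1/10"] pV k' by (simp add: pp' y_def)
    also have "x / CARD('f) \<le> x / 100"
      using pos q by (intro divide_left_mono) auto
    finally show ?thesis
      by simp
  qed
  \<comment> \<open>The second constraint. With s = x + y, both together give 9n/4 - 17s/8 + 2c >=
    s/8 - 5c/2 >= 0, which is the claim for \<open>u\<close>; the constant 1/8 is exactly what the
    bound s / 10 on 2c yields.\<close>
  moreover have "0 \<le> n - (x + y) + 2 * c"
  proof -
    have "0 \<le> ip (u - p - p') (u - p - p')"
      using V pV by (intro ip_nonneg) auto
    also have "\<dots> = n - (x + y) + 2 * c"
      using V pV by (simp add: ip_lin xy n_def) (simp add: x_def y_def c_def)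
    finally show ?thesis .
  qed
  moreover have "ip (defect k u) (defect k' u) = n - (x + y) + c"
      "ip (defect k u) (defect k u) = n - x" "ip (defect k' u) (defect k' u) = n - y"
    unfolding D p_def[symmetric] p'_def[symmetric]
    using V pV by (simp_all add: ip_lin xy n_def) (simp_all add: x_def y_def c_def)
  moreover have "0 \<le> ip (defect k w) (defect k w)" "0 \<le> ip (defect k' w) (defect k' w)"
    using VD by (auto intro: ip_nonneg)
  ultimately show ?thesis
    unfolding s12 s11 s22 using w_pos pos by argo
qed

section \<open>The Laplacian of several subgroups and its spectral gap\<close>

definition laplace :: "'i set \<Rightarrow> ('i \<Rightarrow> 'f::{finite,comm_ring_1} \<Rightarrow> 'g) \<Rightarrow> 'v \<Rightarrow> 'v" where
  "laplace I k v = (\<Sum>i\<in>I. defect (k i) v)"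

definition energy :: "'i set \<Rightarrow> ('i \<Rightarrow> 'f::{finite,comm_ring_1} \<Rightarrow> 'g) \<Rightarrow> 'v \<Rightarrow> real" where
  "energy I k v = (\<Sum>i\<in>I. ip (defect (k i) v) (defect (k i) v))"

text \<open>For finite nonempty \<open>I\<close> this is the mean of the projections
  \<open>avg (k i)\<close>: one step of the random walk that picks a subgroup and averages over
  it.\<close>

definition walk_step :: "'i set \<Rightarrow> ('i \<Rightarrow> 'f::{finite,comm_ring_1} \<Rightarrow> 'g) \<Rightarrow> 'v \<Rightarrow> 'v" where
  "walk_step I k v = v - (1 / card I) *\<^sub>R laplace I k v"

context
  fixes I :: "'i set" and k :: "'i \<Rightarrow> 'f::{finite,comm_ring_1} \<Rightarrow> 'g" and \<delta> :: real
  assumes I: "finite I" "I \<noteq> {}"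
    and k: "i \<in> I \<Longrightarrow> one_param (k i)"
    and pair: "i \<in> I \<Longrightarrow> j \<in> I \<Longrightarrow> i \<noteq> j \<Longrightarrow> v \<in> V \<Longrightarrow>
      2 * ip (defect (k i) v) (defect (k j) v)
        \<ge> - \<delta> * (ip (defect (k i) v) (defect (k i) v) + ip (defect (k j) v) (defect (k j) v))"
    and \<delta>: "0 \<le> \<delta>" "2 * real (card I - 1) * \<delta> \<le> 1"
begin

lemma laplace_linear: "linear (laplace I k)"
  unfolding laplace_def[abs_def] by (intro linear_compose_sum ballI defect_linear k)

lemma laplace_V [simp]: "v \<in> V \<Longrightarrow> laplace I k v \<in> V"
  unfolding laplace_def by (intro V_sum defect_V k)

lemma walk_step_V [simp]: "v \<in> V \<Longrightarrow> walk_step I k v \<in> V"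
  by (simp add: walk_step_def)

lemma laplace_adjoint: "x \<in> V \<Longrightarrow> y \<in> V \<Longrightarrow> ip (laplace I k x) y = ip x (laplace I k y)"
  using k by (simp add: laplace_def ip_sum ip_sum_right defect_adjoint)

lemma energy_eq: "v \<in> V \<Longrightarrow> energy I k v = ip v (laplace I k v)"
  using k by (simp add: laplace_def energy_def ip_sum_right ip_defect)

lemma energy_nonneg: "v \<in> V \<Longrightarrow> 0 \<le> energy I k v"
  unfolding energy_def using k by (intro sum_nonneg ip_nonneg) auto

lemma energy_le: "v \<in> V \<Longrightarrow> energy I k v \<le> card I * ip v v"
  unfolding energy_def using k by (intro sum_bounded_above) (simp add: ip_defect_le)

text \<open>Expand the squared norm of \<open>laplace I k v\<close> into inner products of defects:
  the diagonal contributes the energy, and by \<open>pair\<close> the other terms lose at most (card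
  I - 1) \<open>\<delta>\<close> <= 1/2 of it. In spectral terms, the Laplacian has no spectrum
  strictly between 0 and 1/2.\<close>

lemma ip_laplace:
  assumes v: "v \<in> V"
  shows "energy I k v / 2 \<le> ip (laplace I k v) (laplace I k v)" "ip (laplace I k v) (laplace I k v) \<le> card I * energy I k v"
proof -
  define a where "a i = ip (defect (k i) v) (defect (k i) v)" for i
  define c where "c i j = ip (defect (k i) v) (defect (k j) v)" for i j
  have dV: "i \<in> I \<Longrightarrow> defect (k i) v \<in> V" for i
    using v k by simp
  have L: "ip (laplace I k v) (laplace I k v) = (\<Sum>i\<in>I. \<Sum>j\<in>I. c i j)"
    using dV by (simp add: laplace_def ip_sum ip_sum_right c_def) (rule sum.swap)
  have a: "0 \<le> a i" if "i \<in> I" for i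
    using dV[OF that] by (simp add: a_def ip_nonneg)
  have cc: "c i i = a i" for i
    by (simp add: c_def a_def)
  have sum_a: "(\<Sum>i\<in>I. \<Sum>j\<in>I. (a i + a j) / 2) = card I * energy I k v"
    by (simp add: sum.distrib sum_divide_distrib[symmetric] energy_def a_def sum_distrib_left[symmetric])
  have "c i j \<le> (a i + a j) / 2" if "i \<in> I" "j \<in> I" for i j
    using ip_weighted_AM_GM[of "defect (k i) v" "defect (k j) v" 1] dV that by (simp add: a_def c_def)
  then have "(\<Sum>i\<in>I. \<Sum>j\<in>I. c i j) \<le> (\<Sum>i\<in>I. \<Sum>j\<in>I. (a i + a j) / 2)"
    by (intro sum_mono)
  then show "ip (laplace I k v) (laplace I k v) \<le> card I * energy I k v"
    unfolding L sum_a .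
  \<comment> \<open>On the diagonal the right-hand side equals \<open>a i\<close>, so one formula
    covers all pairs and the double sum reduces to \<open>sum_a\<close>.\<close>
  have "c i j \<ge> (if i = j then (1 + \<delta>) * a i else 0) - \<delta> * ((a i + a j) / 2)" if "i \<in> I" "j \<in> I" for i j
  proof (cases "i = j")
    case False
    then show ?thesis
      using pair[OF that False v] by (simp add: a_def c_def)
  qed (simp add: cc algebra_simps)
  then have "(\<Sum>i\<in>I. \<Sum>j\<in>I. (if i = j then (1 + \<delta>) * a i else 0) - \<delta> * ((a i + a j) / 2))
      \<le> (\<Sum>i\<in>I. \<Sum>j\<in>I. c i j)"
    by (intro sum_mono)
  moreover have "(\<Sum>i\<in>I. \<Sum>j\<in>I. (if i = j then (1 + \<delta>) * a i else 0) - \<delta> * ((a i + a j) / 2))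
      = (1 + \<delta>) * energy I k v - \<delta> * (card I * energy I k v)"
    unfolding sum_subtractf sum_distrib_left[symmetric] sum_a
    using I by (simp add: sum.delta energy_def a_def sum_distrib_left)
  moreover have "(1 + \<delta>) * energy I k v - \<delta> * (card I * energy I k v) = (1 - (card I - 1) * \<delta>) * energy I k v"
    using I by (simp add: algebra_simps of_nat_diff card_gt_0_iff Suc_le_eq)
  moreover have "(1 - (card I - 1) * \<delta>) * energy I k v \<ge> (1/2) * energy I k v"
    using \<delta> energy_nonneg[OF v] by (intro mult_right_mono) auto
  ultimately show "energy I k v / 2 \<le> ip (laplace I k v) (laplace I k v)"
    unfolding L by linarith
qed

text \<open>Replaces the spectral theorem. With D for the Laplacian and n = card I, the energy of v
  - Dv/n is <v, Dv> - (2/n) |Dv|^2 + (1/n^2) <Dv, DDv>. By \<open>energy_le\<close> the last term is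
  at most |Dv|^2 / n, and the gap |Dv|^2 >= <v, Dv> / 2 bounds what remains.\<close>

lemma walk_step_energy:
  assumes v: "v \<in> V"
  shows "energy I k (walk_step I k v) \<le> (1 - 1 / (2 * card I)) * energy I k v"
proof -
  let ?d = "laplace I k v" and ?n = "real (card I)"
  have n: "?n > 0"
    using I by (simp add: card_gt_0_iff)
  have "laplace I k (walk_step I k v) = ?d - (1 / ?n) *\<^sub>R laplace I k ?d"
    by (simp add: walk_step_def linear_diff[OF laplace_linear] linear_scale[OF laplace_linear])
  then have "energy I k (walk_step I k v) = ip (v - (1 / ?n) *\<^sub>R ?d) (?d - (1 / ?n) *\<^sub>R laplace I k ?d)"
    using v by (subst energy_eq) (simp_all add: walk_step_def)
  also have "\<dots> = energy I k v - (2 / ?n) * ip ?d ?d + (1 / ?n) * ((1 / ?n) * energy I k ?d)"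
    using v laplace_adjoint[of v ?d] by (simp add: ip_lin energy_eq algebra_simps)
  also have "(1 / ?n) * energy I k ?d \<le> ip ?d ?d"
    using energy_le[of ?d] v n by (simp add: field_simps)
  finally have "energy I k (walk_step I k v) \<le> energy I k v - (1 / ?n) * ip ?d ?d"
    using n by (simp add: algebra_simps divide_right_mono)
  also have "\<dots> \<le> energy I k v - (1 / ?n) * (energy I k v / 2)"
    using ip_laplace[OF v] n by (intro diff_left_mono mult_left_mono) auto
  finally show ?thesis
    by (simp add: algebra_simps)
qed

text \<open>Together with the geometric decay of the energy, this makes the steps of the iteration
  summable.\<close>

lemma walk_step_dist: "v \<in> V \<Longrightarrow> ip (walk_step I k v - v) (walk_step I k v - v) \<le> energy I k v / card I"
proof -
  assume v: "v \<in> V"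
  let ?n = "real (card I)"
  have n: "?n > 0"
    using I by (simp add: card_gt_0_iff)
  have "walk_step I k v - v = (- (1 / ?n)) *\<^sub>R laplace I k v"
    by (simp add: walk_step_def)
  then have "ip (walk_step I k v - v) (walk_step I k v - v) = (1 / ?n) * (1 / ?n) * ip (laplace I k v) (laplace I k v)"
    using v by (simp only: ip_lin V_scale laplace_V)
  also have "\<dots> \<le> (1 / ?n) * (1 / ?n) * (?n * energy I k v)"
    using ip_laplace[OF v] by (intro mult_left_mono) auto
  finally show ?thesis
    using n by simp
qed

text \<open>Keeps the iterates bounded, so that their limit will be square-integrable.\<close>

lemma walk_step_norm: "v \<in> V \<Longrightarrow> ip (walk_step I k v) (walk_step I k v) \<le> ip v v"
proof -
  assume v: "v \<in> V"
  let ?n = "real (card I)"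
  have n: "?n > 0"
    using I by (simp add: card_gt_0_iff)
  have "ip (walk_step I k v) (walk_step I k v)
      = ip v v - (2 / ?n) * energy I k v + (1 / ?n) * (1 / ?n) * ip (laplace I k v) (laplace I k v)"
    using v ip_sym[of "laplace I k v" v] by (simp add: walk_step_def ip_lin energy_eq algebra_simps)
  also have "(1 / ?n) * (1 / ?n) * ip (laplace I k v) (laplace I k v) \<le> (1 / ?n) * (1 / ?n) * (?n * energy I k v)"
    using ip_laplace[OF v] by (intro mult_left_mono) auto
  also have "(1 / ?n) * (1 / ?n) * (?n * energy I k v) = (1 / ?n) * energy I k v"
    using n by simp
  finally show ?thesis
    using divide_nonneg_pos[OF energy_nonneg[OF v] n] by (simp add: algebra_simps)
qed

lemma walk_iterate:
  assumes v: "v \<in> V"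
  shows "(walk_step I k ^^ m) v \<in> V"
    and "energy I k ((walk_step I k ^^ m) v) \<le> (1 - 1 / (2 * card I)) ^ m * energy I k v"
    and "ip ((walk_step I k ^^ m) v) ((walk_step I k ^^ m) v) \<le> ip v v"
proof -
  show V: "(walk_step I k ^^ m) v \<in> V" for m
    using v by (induction m) auto
  have "card I > 0"
    using I by (simp add: card_gt_0_iff)
  then have q: "0 \<le> 1 - 1 / (2 * real (card I))"
    by (simp add: field_simps)
  show "energy I k ((walk_step I k ^^ m) v) \<le> (1 - 1 / (2 * card I)) ^ m * energy I k v"
  proof (induction m)
    case (Suc m)
    have "energy I k ((walk_step I k ^^ Suc m) v) \<le> (1 - 1 / (2 * card I)) * energy I k ((walk_step I k ^^ m) v)"
      using walk_step_energy[OF V] by simp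
    also have "\<dots> \<le> (1 - 1 / (2 * card I)) * ((1 - 1 / (2 * card I)) ^ m * energy I k v)"
      using Suc q by (intro mult_left_mono) auto
    finally show ?case
      by (simp add: mult.assoc)
  qed simp
  show "ip ((walk_step I k ^^ m) v) ((walk_step I k ^^ m) v) \<le> ip v v"
    by (induction m) (auto intro: order_trans[OF walk_step_norm[OF V]])
qed

end

end

section \<open>Koopman representations\<close>

text \<open>Lets plain functions serve as the vectors of \<open>semi_inner_rep\<close>.\<close>

instantiation "fun" :: (type, real_vector) real_vector
begin

definition scaleR_fun :: "real \<Rightarrow> ('a \<Rightarrow> 'b) \<Rightarrow> 'a \<Rightarrow> 'b" where
  "scaleR_fun c f = (\<lambda>x. c *\<^sub>R f x)"

instance
  by standard (simp_all add: scaleR_fun_def fun_eq_iff algebra_simps)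

end

lemma scaleR_fun_apply [simp]: "(c *\<^sub>R f) x = c *\<^sub>R f x"
  by (simp add: scaleR_fun_def)

lemma sum_fun_apply: "(\<Sum>i\<in>I. f i) x = (\<Sum>i\<in>I. f i x)"
  by (induction I rule: infinite_finite_induct) auto

context prob_space
begin

definition L2 :: "('a \<Rightarrow> real) set" where
  "L2 = {f \<in> borel_measurable M. integrable M (\<lambda>x. (f x)\<^sup>2)}"

definition ip2 :: "('a \<Rightarrow> real) \<Rightarrow> ('a \<Rightarrow> real) \<Rightarrow> real" where
  "ip2 f h = (\<integral>x. f x * h x \<partial>M)"

lemma L2_measurable: "f \<in> L2 \<Longrightarrow> f \<in> borel_measurable M"
  by (simp add: L2_def)

lemma L2_square_integrable: "f \<in> L2 \<Longrightarrow> integrable M (\<lambda>x. (f x)\<^sup>2)"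
  by (simp add: L2_def)

lemma L2_mult_integrable:
  assumes "f \<in> L2" "h \<in> L2"
  shows "integrable M (\<lambda>x. f x * h x)"
proof (rule Bochner_Integration.integrable_bound)
  show "integrable M (\<lambda>x. (f x)\<^sup>2 + (h x)\<^sup>2)"
    using assms by (intro Bochner_Integration.integrable_add L2_square_integrable)
  show "(\<lambda>x. f x * h x) \<in> borel_measurable M"
    using assms by (intro borel_measurable_times L2_measurable)
  have le: "\<bar>a * b\<bar> \<le> \<bar>a\<^sup>2 + b\<^sup>2\<bar>" for a b :: real
  proof -
    have "2 * \<bar>a * b\<bar> \<le> a\<^sup>2 + b\<^sup>2"
      using sum_squares_bound[of "\<bar>a\<bar>" "\<bar>b\<bar>"] by (simp add: abs_mult)
    then show ?thesis
      using abs_ge_zero[of "a * b"] by linarith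
  qed
  show "AE x in M. norm (f x * h x) \<le> norm ((f x)\<^sup>2 + (h x)\<^sup>2)"
    unfolding real_norm_def by (rule AE_I2) (rule le)
qed

lemma L2_subspace: "subspace L2"
proof (rule subspaceI)
  show "0 \<in> L2"
    by (simp add: L2_def zero_fun_def)
  show "f + h \<in> L2" if "f \<in> L2" "h \<in> L2" for f h
  proof -
    have "integrable M (\<lambda>x. (f x)\<^sup>2 + (h x)\<^sup>2 + 2 * (f x * h x))"
      using that L2_mult_integrable[OF that]
      by (intro Bochner_Integration.integrable_add integrable_mult_right L2_square_integrable)
    moreover have "(\<lambda>x. f x + h x) \<in> borel_measurable M"
      using that by (intro borel_measurable_add L2_measurable)
    ultimately show ?thesis
      by (simp add: L2_def power2_sum plus_fun_def algebra_simps)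
  qed
  show "c *\<^sub>R f \<in> L2" if "f \<in> L2" for c f
  proof -
    have "(\<lambda>x. c * f x) \<in> borel_measurable M"
      using that by (intro borel_measurable_times borel_measurable_const L2_measurable)
    then show ?thesis
      using that by (simp add: L2_def power_mult_distrib scaleR_fun_def)
  qed
qed

text \<open>The variance of |f| is nonnegative.\<close>

lemma integral_abs_le_sqrt_ip2:
  assumes "f \<in> L2"
  shows "integrable M f" "(\<integral>x. \<bar>f x\<bar> \<partial>M) \<le> sqrt (ip2 f f)"
proof -
  have f2: "integrable M (\<lambda>x. (f x)\<^sup>2)" and [measurable]: "f \<in> borel_measurable M"
    using assms by (auto simp: L2_def)
  show f: "integrable M f"
    using f2 by (rule square_integrable_imp_integrable[rotated]) simp
  define a where "a = (\<integral>x. \<bar>f x\<bar> \<partial>M)"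
  have "0 \<le> (\<integral>x. (\<bar>f x\<bar> - a)\<^sup>2 \<partial>M)"
    by (intro integral_nonneg_AE) auto
  also have "\<dots> = (\<integral>x. (f x)\<^sup>2 - 2 * a * \<bar>f x\<bar> + a\<^sup>2 \<partial>M)"
    by (simp add: power2_diff algebra_simps)
  also have "\<dots> = ip2 f f - a\<^sup>2"
    using f f2 by (simp add: a_def[symmetric] ip2_def power2_eq_square prob_space)
  finally show "(\<integral>x. \<bar>f x\<bar> \<partial>M) \<le> sqrt (ip2 f f)"
    using real_le_rsqrt by (simp add: a_def)
qed

text \<open>Stands in for completeness of L2: geometric decay of the L1 norms gives convergence
  almost everywhere by monotone convergence, and the same sum controls the distance to the
  limit.\<close>

lemma AE_summable_of_geometric:
  fixes h :: "nat \<Rightarrow> 'a \<Rightarrow> real"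
  assumes int: "\<And>m. integrable M (h m)" and le: "\<And>m. (\<integral>x. \<bar>h m x\<bar> \<partial>M) \<le> C * r ^ m"
    and r: "0 \<le> r" "r < 1"
  shows "AE x in M. summable (\<lambda>m. \<bar>h m x\<bar>)"
    and "(\<integral>\<^sup>+x. (\<Sum>m. ennreal \<bar>h m x\<bar>) \<partial>M) \<le> ennreal (C / (1 - r))"
proof -
  have [measurable]: "h m \<in> borel_measurable M" for m
    using int by auto
  have "0 \<le> (\<integral>x. \<bar>h 0 x\<bar> \<partial>M)"
    by (rule Bochner_Integration.integral_nonneg) simp
  also have "\<dots> \<le> C"
    using le[of 0] by simp
  finally have C: "0 \<le> C" .
  have "(\<integral>\<^sup>+x. (\<Sum>m. ennreal \<bar>h m x\<bar>) \<partial>M) = (\<Sum>m. \<integral>\<^sup>+x. ennreal \<bar>h m x\<bar> \<partial>M)"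
    by (rule nn_integral_suminf) simp
  also have "\<dots> \<le> (\<Sum>m. ennreal (C * r ^ m))"
  proof (intro suminf_le)
    show "(\<integral>\<^sup>+x. ennreal \<bar>h m x\<bar> \<partial>M) \<le> ennreal (C * r ^ m)" for m
      using int[of m] le[of m] by (subst nn_integral_eq_integral) (auto intro: ennreal_leI)
  qed auto
  also have "\<dots> = ennreal (\<Sum>m. C * r ^ m)"
    using r C by (intro suminf_ennreal2) (auto intro!: summable_mult summable_geometric)
  also have "(\<Sum>m. C * r ^ m) = C / (1 - r)"
    using r by (simp add: suminf_mult suminf_geometric summable_geometric)
  finally show le: "(\<integral>\<^sup>+x. (\<Sum>m. ennreal \<bar>h m x\<bar>) \<partial>M) \<le> ennreal (C / (1 - r))" .
  have "(\<integral>\<^sup>+x. (\<Sum>m. ennreal \<bar>h m x\<bar>) \<partial>M) \<noteq> \<infinity>"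
    using le_less_trans[OF le ennreal_less_top] by (simp add: less_top)
  then have "AE x in M. (\<Sum>m. ennreal \<bar>h m x\<bar>) \<noteq> \<infinity>"
    by (intro nn_integral_PInf_AE) auto
  then show "AE x in M. summable (\<lambda>m. \<bar>h m x\<bar>)"
    by eventually_elim (auto intro: summable_suminf_not_top)
qed

end

text \<open>The action laws and the cocycle identity hold at every point, so \<open>koopman\<close>
  is a representation on functions without exceptional sets. Here \<open>rho g\<close> is a strictly
  positive version of the density of the image of \<open>M\<close> under \<open>g\<close>.\<close>

locale nonsingular_system = group G + prob_space M
  for G :: "('g, 'b) monoid_scheme" (structure) and M :: "'x measure" +
  fixes act :: "'g \<Rightarrow> 'x \<Rightarrow> 'x" and rho :: "'g \<Rightarrow> 'x \<Rightarrow> real"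
  assumes space_M [simp]: "space M = UNIV"
    and act_measurable [measurable]: "g \<in> carrier G \<Longrightarrow> act g \<in> M \<rightarrow>\<^sub>M M"
    and act_one: "act \<one> x = x"
    and act_mult: "g \<in> carrier G \<Longrightarrow> h \<in> carrier G \<Longrightarrow> act (g \<otimes> h) x = act g (act h x)"
    and rho_measurable [measurable]: "g \<in> carrier G \<Longrightarrow> rho g \<in> borel_measurable M"
    and rho_mult: "g \<in> carrier G \<Longrightarrow> h \<in> carrier G \<Longrightarrow> rho (g \<otimes> h) x = rho g x * rho h (act (inv g) x)"
    and rho_pos: "g \<in> carrier G \<Longrightarrow> 0 < rho g x"
    and distr_act: "g \<in> carrier G \<Longrightarrow> distr M M (act g) = density M (\<lambda>x. ennreal (rho g x))"
begin

lemma act_inv [simp]: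
  "g \<in> carrier G \<Longrightarrow> act (inv g) (act g x) = x" "g \<in> carrier G \<Longrightarrow> act g (act (inv g) x) = x"
  using act_mult[of g "inv g" x] act_mult[of "inv g" g x] by (simp_all add: act_one)

lemma rho_one: "rho \<one> x = 1"
proof -
  have "rho \<one> x * rho \<one> x = rho \<one> x"
    using rho_mult[of \<one> \<one> x] by (simp add: act_one)
  then show ?thesis
    using rho_pos[of \<one> x] by simp
qed

lemma integral_act:
  assumes g: "g \<in> carrier G" and f: "integrable M (f :: 'x \<Rightarrow> real)"
  shows "integrable M (\<lambda>x. rho g x * f (act (inv g) x))"
    and "(\<integral>x. rho g x * f (act (inv g) x) \<partial>M) = (\<integral>x. f x \<partial>M)"
proof -
  have [measurable]: "act (inv g) \<in> M \<rightarrow>\<^sub>M M" "act g \<in> M \<rightarrow>\<^sub>M M" "rho g \<in> borel_measurable M"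
      "f \<in> borel_measurable M"
    using g f by simp_all
  have pos: "AE x in M. 0 \<le> rho g x"
    using rho_pos[OF g] by (auto intro: less_imp_le)
  have "integrable (distr M M (act g)) (\<lambda>x. f (act (inv g) x))"
    using g f by (subst integrable_distr_eq) simp_all
  then show "integrable M (\<lambda>x. rho g x * f (act (inv g) x))"
    using pos by (simp add: distr_act[OF g] integrable_density)
  have "(\<integral>x. rho g x * f (act (inv g) x) \<partial>M) = (\<integral>x. f (act (inv g) x) \<partial>distr M M (act g))"
    using pos by (simp add: distr_act[OF g] integral_density)
  also have "\<dots> = (\<integral>x. f x \<partial>M)"
    using g by (simp add: integral_distr)
  finally show "(\<integral>x. rho g x * f (act (inv g) x) \<partial>M) = (\<integral>x. f x \<partial>M)" .
qed

lemma AE_act: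
  assumes g: "g \<in> carrier G" and P: "AE x in M. P x"
  shows "AE x in M. P (act g x)"
proof -
  have "AE x in distr M M (act g). P x"
    unfolding distr_act[OF g] using P g by (subst AE_density) auto
  then show ?thesis
    by (rule AE_distrD[OF act_measurable[OF g]])
qed

definition koopman :: "'g \<Rightarrow> ('x \<Rightarrow> real) \<Rightarrow> 'x \<Rightarrow> real" where
  "koopman g f = (\<lambda>x. sqrt (rho g x) * f (act (inv g) x))"

sublocale kp: semi_inner_rep G L2 ip2 koopman
proof (rule semi_inner_rep.intro[OF group_axioms], rule semi_inner_rep_axioms.intro)
  have sq: "sqrt (rho g x) * a * (sqrt (rho g x) * b) = rho g x * (a * b)"
    if "g \<in> carrier G" for g x and a b :: real
    using rho_pos[OF that, of x] by (simp add: algebra_simps)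
  show "subspace L2"
    by (rule L2_subspace)
  show "ip2 f h = ip2 h f" for f h
    by (simp add: ip2_def mult.commute)
  show "ip2 (f + h) k = ip2 f k + ip2 h k" if "f \<in> L2" "h \<in> L2" "k \<in> L2" for f h k
    using that by (simp add: ip2_def plus_fun_def distrib_right L2_mult_integrable)
  show "ip2 (c *\<^sub>R f) k = c * ip2 f k" for c f k
    by (simp add: ip2_def mult.assoc)
  show "0 \<le> ip2 f f" for f
    by (simp add: ip2_def)
  show "linear (koopman g)" for g
    by (rule linearI) (auto simp: koopman_def fun_eq_iff algebra_simps)
  show "koopman g f \<in> L2" if g: "g \<in> carrier G" and f: "f \<in> L2" for g f
  proof -
    have [measurable]: "act (inv g) \<in> M \<rightarrow>\<^sub>M M" "rho g \<in> borel_measurable M" "f \<in> borel_measurable M"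
      using g f by (simp_all add: L2_def)
    have "integrable M (\<lambda>x. rho g x * (f (act (inv g) x))\<^sup>2)"
      using f by (intro integral_act g) (simp add: L2_def)
    then show ?thesis
      using rho_pos[OF g] by (simp add: L2_def koopman_def power_mult_distrib less_imp_le)
  qed
  show "koopman (g \<otimes> h) f = koopman g (koopman h f)" if "g \<in> carrier G" "h \<in> carrier G" for g h f
    using that by (simp add: koopman_def fun_eq_iff rho_mult inv_mult_group act_mult real_sqrt_mult)
  show "koopman \<one> f = f" for f
    by (simp add: koopman_def fun_eq_iff rho_one act_one)
  show "ip2 (koopman g f) (koopman g h) = ip2 f h" if g: "g \<in> carrier G" and "f \<in> L2" "h \<in> L2" for g f h
    using integral_act(2)[OF g L2_mult_integrable[of f h]] that
    by (simp add: ip2_def koopman_def sq)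
qed

end

section \<open>Invariant densities\<close>

context nonsingular_system
begin

lemma koopman_AE_cong:
  assumes g: "g \<in> carrier G" and "AE x in M. f x = h x"
  shows "AE x in M. koopman g f x = koopman g h x"
  using AE_act[of "inv g", OF _ assms(2)] g by (auto simp: koopman_def elim: eventually_mono)

text \<open>Iterate \<open>walk_step\<close> from \<open>v\<close>. The energies decay like q^m with
  q = 1 - 1 / (2 card I), so steps and defects have L1 norms of order (sqrt q)^m and are summable
  almost everywhere; the bound on \<open>f - v\<close> is the resulting geometric series.\<close>

lemma almost_invariant_limit:
  fixes I :: "'i set" and k :: "'i \<Rightarrow> 'f::{finite,comm_ring_1} \<Rightarrow> 'g" and \<delta> :: real
  assumes I: "finite I" "I \<noteq> {}"
    and k: "\<And>i. i \<in> I \<Longrightarrow> one_param (k i)"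
    and pair: "\<And>i j v. i \<in> I \<Longrightarrow> j \<in> I \<Longrightarrow> i \<noteq> j \<Longrightarrow> v \<in> L2 \<Longrightarrow>
      2 * ip2 (kp.defect (k i) v) (kp.defect (k j) v)
        \<ge> - \<delta> * (ip2 (kp.defect (k i) v) (kp.defect (k i) v) + ip2 (kp.defect (k j) v) (kp.defect (k j) v))"
    and \<delta>: "0 \<le> \<delta>" "2 * real (card I - 1) * \<delta> \<le> 1"
    and v: "v \<in> L2"
  obtains f where "f \<in> L2" "\<And>i c. i \<in> I \<Longrightarrow> AE x in M. koopman (k i c) f x = f x"
    "(\<integral>\<^sup>+x. ennreal \<bar>f x - v x\<bar> \<partial>M)
       \<le> ennreal (sqrt (kp.energy I k v / card I) / (1 - sqrt (1 - 1 / (2 * card I))))"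
proof -
  let ?W = "kp.walk_step I k" and ?n = "real (card I)"
  define vs where "vs m = (?W ^^ m) v" for m
  define E where "E = kp.energy I k v"
  define q where "q = 1 - 1 / (2 * ?n)"
  have n: "card I > 0"
    using I by (simp add: card_gt_0_iff)
  then have q: "0 \<le> q" "q < 1"
    by (simp_all add: q_def field_simps)
  note it = kp.walk_iterate[of I k \<delta>, OF I k pair \<delta> v]
  have vs_L2: "vs m \<in> L2" for m
    unfolding vs_def by (rule it(1))
  have vs_energy: "kp.energy I k (vs m) \<le> q ^ m * E" for m
    using it(2)[of m] by (simp add: vs_def q_def E_def)
  have vs_norm: "ip2 (vs m) (vs m) \<le> ip2 v v" for m
    unfolding vs_def by (rule it(3))
  have [measurable]: "vs m \<in> borel_measurable M" for m
    by (rule L2_measurable[OF vs_L2])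
  have E: "0 \<le> E"
    unfolding E_def by (rule kp.energy_nonneg[of I k \<delta>, OF I k pair \<delta> v])
  define h where "h m = vs (Suc m) - vs m" for m
  have h_L2: "h m \<in> L2" for m
    unfolding h_def by (intro kp.V_diff vs_L2)
  have h_int: "integrable M (h m)" for m
    by (rule integral_abs_le_sqrt_ip2(1)[OF h_L2])
  have h_le: "(\<integral>x. \<bar>h m x\<bar> \<partial>M) \<le> sqrt (E / ?n) * sqrt q ^ m" for m
  proof -
    have "(\<integral>x. \<bar>h m x\<bar> \<partial>M) \<le> sqrt (ip2 (h m) (h m))"
      by (rule integral_abs_le_sqrt_ip2(2)[OF h_L2])
    also have "ip2 (h m) (h m) \<le> kp.energy I k (vs m) / ?n"
      unfolding h_def vs_def funpow.simps o_apply
      by (rule kp.walk_step_dist[of I k \<delta>, OF I k pair \<delta> it(1)])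
    also have "\<dots> \<le> q ^ m * E / ?n"
      by (intro divide_right_mono vs_energy) simp
    finally show ?thesis
      by (simp add: real_sqrt_mult real_sqrt_divide real_sqrt_power mult.commute)
  qed
  have d_L2: "kp.defect (k i) (vs m) \<in> L2" if "i \<in> I" for i m
    by (intro kp.defect_V k that vs_L2)
  have d_le: "(\<integral>x. \<bar>kp.defect (k i) (vs m) x\<bar> \<partial>M) \<le> sqrt E * sqrt q ^ m" if i: "i \<in> I" for i m
  proof -
    have "(\<integral>x. \<bar>kp.defect (k i) (vs m) x\<bar> \<partial>M) \<le> sqrt (ip2 (kp.defect (k i) (vs m)) (kp.defect (k i) (vs m)))"
      by (rule integral_abs_le_sqrt_ip2(2)[OF d_L2[OF i]])
    also have "ip2 (kp.defect (k i) (vs m)) (kp.defect (k i) (vs m)) \<le> kp.energy I k (vs m)"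
      unfolding kp.energy_def
      by (rule member_le_sum[OF i _ I(1)]) (auto intro!: kp.ip_nonneg d_L2)
    also have "\<dots> \<le> q ^ m * E"
      by (rule vs_energy)
    finally show ?thesis
      by (simp add: real_sqrt_mult real_sqrt_power mult.commute)
  qed
  have r: "0 \<le> sqrt q" "sqrt q < 1"
    using q by auto
  have conv_h: "AE x in M. summable (\<lambda>m. \<bar>h m x\<bar>)"
    by (rule AE_summable_of_geometric(1)[OF h_int h_le r])
  have conv_d: "AE x in M. (\<lambda>m. kp.defect (k i) (vs m) x) \<longlonglongrightarrow> 0" if i: "i \<in> I" for i
    using AE_summable_of_geometric(1)[OF integral_abs_le_sqrt_ip2(1)[OF d_L2[OF i]] d_le[OF i] r]
    by eventually_elim (auto dest: summable_LIMSEQ_zero simp: tendsto_rabs_zero_iff)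
  define f where "f x = lim (\<lambda>m. vs m x)" for x
  have vs_sum: "vs m x = v x + (\<Sum>j<m. h j x)" for m x
    by (induction m) (auto simp: h_def vs_def)
  have lim: "AE x in M. (\<lambda>m. vs m x) \<longlonglongrightarrow> f x \<and> ennreal \<bar>f x - v x\<bar> \<le> (\<Sum>m. ennreal \<bar>h m x\<bar>)"
    using conv_h
  proof eventually_elim
    case (elim x)
    have s: "summable (\<lambda>m. h m x)"
      using elim by (rule summable_rabs_cancel)
    have L: "(\<lambda>m. vs m x) \<longlonglongrightarrow> v x + (\<Sum>m. h m x)"
      unfolding vs_sum by (intro tendsto_intros summable_LIMSEQ s)
    then have f: "f x = v x + (\<Sum>m. h m x)"
      unfolding f_def by (rule limI)
    have "\<bar>f x - v x\<bar> \<le> (\<Sum>m. \<bar>h m x\<bar>)"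
      unfolding f using summable_rabs[OF elim] by simp
    then have "ennreal \<bar>f x - v x\<bar> \<le> ennreal (\<Sum>m. \<bar>h m x\<bar>)"
      by (rule ennreal_leI)
    also have "\<dots> = (\<Sum>m. ennreal \<bar>h m x\<bar>)"
      using elim by (intro suminf_ennreal2[symmetric]) auto
    finally show ?case
      using L f by simp
  qed
  have f_meas [measurable]: "f \<in> borel_measurable M"
    unfolding f_def by measurable
  \<comment> \<open>Fatou's lemma, as the norms of the iterates are bounded by that of
    \<open>v\<close>.\<close>
  have f_L2: "f \<in> L2"
  proof -
    have "(\<integral>\<^sup>+x. ennreal ((f x)\<^sup>2) \<partial>M) = (\<integral>\<^sup>+x. liminf (\<lambda>m. ennreal ((vs m x)\<^sup>2)) \<partial>M)"
    proof (intro nn_integral_cong_AE)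
      show "AE x in M. ennreal ((f x)\<^sup>2) = liminf (\<lambda>m. ennreal ((vs m x)\<^sup>2))"
        using lim
      proof eventually_elim
        case (elim x)
        then have "(\<lambda>m. ennreal ((vs m x)\<^sup>2)) \<longlonglongrightarrow> ennreal ((f x)\<^sup>2)"
          by (intro tendsto_intros) auto
        then show ?case
          by (intro lim_imp_Liminf[symmetric]) auto
      qed
    qed
    also have "\<dots> \<le> liminf (\<lambda>m. \<integral>\<^sup>+x. ennreal ((vs m x)\<^sup>2) \<partial>M)"
      by (intro nn_integral_liminf) measurable
    also have "\<dots> \<le> liminf (\<lambda>m. ennreal (ip2 v v))"
    proof (intro Liminf_mono always_eventually allI)
      fix m
      have "(\<integral>\<^sup>+x. ennreal ((vs m x)\<^sup>2) \<partial>M) = ennreal (\<integral>x. (vs m x)\<^sup>2 \<partial>M)"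
        using vs_L2[of m] by (intro nn_integral_eq_integral) (auto simp: L2_def)
      also have "\<dots> \<le> ennreal (ip2 v v)"
        using vs_norm[of m] by (intro ennreal_leI) (simp add: ip2_def power2_eq_square)
      finally show "(\<integral>\<^sup>+x. ennreal ((vs m x)\<^sup>2) \<partial>M) \<le> ennreal (ip2 v v)" .
    qed
    also have "\<dots> < \<infinity>"
      by (simp add: Liminf_const)
    finally have "integrable M (\<lambda>x. (f x)\<^sup>2)"
      by (intro integrableI_bounded) auto
    then show ?thesis
      by (simp add: L2_def)
  qed
  \<comment> \<open>An average is a finite combination of translates, so it passes to the almost
    everywhere limit once convergence is known at all translated points simultaneously; the defects
    tend to 0.\<close>
  have avg_f: "AE x in M. kp.avg (k i) f x = f x" if i: "i \<in> I" for i
  proof -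
    have car: "k i c \<in> carrier G" for c
      using one_paramD(1)[OF k[OF i]] .
    have "AE x in M. \<forall>c. (\<lambda>m. vs m (act (inv (k i c)) x)) \<longlonglongrightarrow> f (act (inv (k i c)) x)"
    proof (subst AE_all_countable, intro allI)
      fix c
      have "AE x in M. (\<lambda>m. vs m x) \<longlonglongrightarrow> f x"
        using lim by eventually_elim simp
      then show "AE x in M. (\<lambda>m. vs m (act (inv (k i c)) x)) \<longlonglongrightarrow> f (act (inv (k i c)) x)"
        using car by (intro AE_act) auto
    qed
    then show ?thesis
      using lim conv_d[OF i]
    proof eventually_elim
      case (elim x)
      have "(\<lambda>m. kp.avg (k i) (vs m) x) \<longlonglongrightarrow> kp.avg (k i) f x"
        unfolding kp.avg_def scaleR_fun_apply sum_fun_apply koopman_def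
        using elim(1) by (intro tendsto_intros) auto
      moreover have "(\<lambda>m. vs m x - kp.defect (k i) (vs m) x) \<longlonglongrightarrow> f x - 0"
        using elim by (intro tendsto_intros) auto
      moreover have "vs m x - kp.defect (k i) (vs m) x = kp.avg (k i) (vs m) x" for m
        by (simp add: kp.defect_def)
      ultimately show ?case
        using LIMSEQ_unique by simp blast
    qed
  qed
  show ?thesis
  proof (rule that[OF f_L2])
    show "AE x in M. koopman (k i c) f x = f x" if i: "i \<in> I" for i c
    proof -
      have car: "k i c \<in> carrier G"
        using one_paramD(1)[OF k[OF i]] .
      have "AE x in M. koopman (k i c) (kp.avg (k i) f) x = koopman (k i c) f x"
        by (rule koopman_AE_cong[OF car avg_f[OF i]])
      then show ?thesis
        unfolding kp.T_avg_absorb[OF k[OF i]] using avg_f[OF i] by eventually_elim simp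
    qed
    have "(\<integral>\<^sup>+x. ennreal \<bar>f x - v x\<bar> \<partial>M) \<le> (\<integral>\<^sup>+x. (\<Sum>m. ennreal \<bar>h m x\<bar>) \<partial>M)"
      using lim by (intro nn_integral_mono_AE) auto
    also have "\<dots> \<le> ennreal (sqrt (E / ?n) / (1 - sqrt q))"
      by (rule AE_summable_of_geometric(2)[OF h_int h_le r])
    finally show "(\<integral>\<^sup>+x. ennreal \<bar>f x - v x\<bar> \<partial>M)
       \<le> ennreal (sqrt (kp.energy I k v / card I) / (1 - sqrt (1 - 1 / (2 * card I))))"
      by (simp add: E_def q_def)
  qed
qed

text \<open>If \<open>\<nu>\<close> and \<open>u \<nu>\<close> are both stationary, then so is the positive part of \<open>(u - c) \<nu>\<close>:
  averaging can only increase it, and it preserves the total mass. The support of a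
  stationary measure is invariant.\<close>

lemma stationary_density_invariant:
  fixes \<mu> :: "'g pmf" and u :: "'x \<Rightarrow> real"
  assumes fin: "finite (set_pmf \<mu>)" and gen: "generating G \<mu>"
    and st: "AE x in M. (\<Sum>g\<in>set_pmf \<mu>. pmf \<mu> g * rho g x) = 1"
    and u: "integrable M u" "\<And>x. 0 \<le> u x"
    and stu: "AE x in M. (\<Sum>g\<in>set_pmf \<mu>. pmf \<mu> g * (rho g x * u (act (inv g) x))) = u x"
    and g: "g \<in> carrier G"
  shows "AE x in M. u (act g x) = u x"
proof -
  have S: "set_pmf \<mu> \<subseteq> carrier G" and gen: "semigroup_generated G (set_pmf \<mu>) = carrier G"
    using gen by (auto simp: generating_def)
  have [measurable]: "u \<in> borel_measurable M"
    using u by auto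
  have supp: "AE x in M. u x \<le> c \<longrightarrow> u (act (inv g) x) \<le> c" if c: "0 \<le> c" and g: "g \<in> set_pmf \<mu>" for c g
  proof -
    define w where "w x = max 0 (u x - c)" for x
    define w' where "w' x = (\<Sum>g\<in>set_pmf \<mu>. pmf \<mu> g * (rho g x * w (act (inv g) x)))" for x
    have [measurable]: "w \<in> borel_measurable M"
      unfolding w_def by measurable
    have w0: "0 \<le> w x" for x
      by (simp add: w_def)
    have term0: "0 \<le> pmf \<mu> g * (rho g x * w (act (inv g) x))" if "g \<in> set_pmf \<mu>" for g x
    proof -
      have "0 \<le> rho g x"
        using rho_pos[of g x] S that by auto
      then show ?thesis
        using w0 by simp
    qed
    have w'0: "0 \<le> w' x" for x
      unfolding w'_def by (intro sum_nonneg term0)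
    have [measurable]: "(\<lambda>x. w (act (inv g) x)) \<in> borel_measurable M" "rho g \<in> borel_measurable M"
      if "g \<in> set_pmf \<mu>" for g
      using that S measurable_compose[OF act_measurable[of "inv g"]] by auto
    have [measurable]: "w' \<in> borel_measurable M"
      unfolding w'_def by measurable
    have w_int: "integrable M w"
      unfolding w_def using u by auto
    have int: "integrable M (\<lambda>x. rho g x * w (act (inv g) x))"
        "(\<integral>x. rho g x * w (act (inv g) x) \<partial>M) = (\<integral>x. w x \<partial>M)" if "g \<in> set_pmf \<mu>" for g
      using that S integral_act[OF _ w_int] by auto
    have w'_int: "integrable M w'"
      unfolding w'_def by (intro Bochner_Integration.integrable_sum integrable_mult_right int)
    have "(\<integral>x. w' x \<partial>M) = (\<Sum>g\<in>set_pmf \<mu>. pmf \<mu> g * (\<integral>x. w x \<partial>M))"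
      unfolding w'_def using int by (subst Bochner_Integration.integral_sum) auto
    also have "\<dots> = (\<integral>x. w x \<partial>M)"
      using sum_pmf_eq_1[OF fin order_refl] by (simp add: sum_distrib_right[symmetric])
    finally have mass: "(\<integral>x. w' x - w x \<partial>M) = 0"
      using w_int w'_int by simp
    have le: "AE x in M. 0 \<le> w' x - w x"
      using st stu
    proof eventually_elim
      case (elim x)
      have "u x = (\<Sum>g\<in>set_pmf \<mu>. pmf \<mu> g * (rho g x * u (act (inv g) x)))"
        using elim by simp
      also have "\<dots> \<le> (\<Sum>g\<in>set_pmf \<mu>. pmf \<mu> g * (rho g x * (w (act (inv g) x) + c)))"
      proof (intro sum_mono mult_left_mono)
        fix g assume "g \<in> set_pmf \<mu>"
        then show "0 \<le> rho g x"
          using S rho_pos[of g x] by (auto intro: less_imp_le)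
      qed (auto simp: w_def)
      also have "\<dots> = w' x + c * (\<Sum>g\<in>set_pmf \<mu>. pmf \<mu> g * rho g x)"
        by (simp add: w'_def sum.distrib sum_distrib_left algebra_simps)
      finally have "u x \<le> w' x + c"
        using elim by simp
      then show ?case
        using w'0[of x] by (simp add: w_def)
    qed
    \<comment> \<open>A nonnegative function of integral zero. Where \<open>w\<close> vanishes,
      every summand of \<open>w'\<close> then vanishes too, and the positive weights and densities
      force \<open>w\<close> to vanish at the translates.\<close>
    have "AE x in M. w' x - w x = 0"
      using mass le w_int w'_int by (subst integral_nonneg_eq_0_iff_AE[symmetric]) auto
    then show ?thesis
    proof eventually_elim
      case (elim x)
      show ?case
      proof
        assume "u x \<le> c"
        then have "w' x = 0"
          using elim by (simp add: w_def)
        then have "(\<Sum>g\<in>set_pmf \<mu>. pmf \<mu> g * (rho g x * w (act (inv g) x))) = 0"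
          by (simp add: w'_def)
        then have "\<forall>g\<in>set_pmf \<mu>. pmf \<mu> g * (rho g x * w (act (inv g) x)) = 0"
          by (subst (asm) sum_nonneg_eq_0_iff[OF fin]) (simp_all add: term0)
        then have "pmf \<mu> g * (rho g x * w (act (inv g) x)) = 0"
          using g by blast
        then show "u (act (inv g) x) \<le> c"
          using g S rho_pos[of g x] by (auto simp: w_def set_pmf_iff)
      qed
    qed
  qed
  \<comment> \<open>One-sided implications compose, so generation as a semigroup suffices.\<close>
  have all: "AE x in M. u x \<le> c \<longrightarrow> u (act (inv g) x) \<le> c" if c: "0 \<le> c" and "g \<in> carrier G" for c g
  proof -
    have "g \<in> semigroup_generated G (set_pmf \<mu>)"
      using that gen by simp
    then show ?thesis
    proof induction
      case (gen s)
      then show ?case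
        using supp[OF c] by simp
    next
      case (mult x y)
      then have xy: "x \<in> carrier G" "y \<in> carrier G"
        using \<open>semigroup_generated G (set_pmf \<mu>) = carrier G\<close> by auto
      have "AE z in M. u (act (inv x) z) \<le> c \<longrightarrow> u (act (inv y) (act (inv x) z)) \<le> c"
        using xy by (intro AE_act[OF _ mult.IH(2)]) auto
      then show ?case
        using mult.IH(1) by eventually_elim (use xy in \<open>simp add: inv_mult_group act_mult\<close>)
    qed
  qed
  \<comment> \<open>Rational thresholds separate distinct values, so the implications between
    sublevel sets become a pointwise inequality. Using it for \<open>g\<close> and for its inverse
    gives the equality.\<close>
  have decr: "AE x in M. u (act (inv g) x) \<le> u x" if g: "g \<in> carrier G" for g
  proof -
    have "AE x in M. \<forall>c::rat. 0 \<le> c \<longrightarrow> u x \<le> of_rat c \<longrightarrow> u (act (inv g) x) \<le> of_rat c"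
    proof (subst AE_all_countable, intro allI)
      fix c :: rat
      show "AE x in M. 0 \<le> c \<longrightarrow> u x \<le> of_rat c \<longrightarrow> u (act (inv g) x) \<le> of_rat c"
        using all[of "of_rat c", OF _ g] by (cases "0 \<le> c") auto
    qed
    then show ?thesis
    proof eventually_elim
      case (elim x)
      show ?case
      proof (rule ccontr)
        assume "\<not> u (act (inv g) x) \<le> u x"
        then obtain c where c: "u x < of_rat c" "of_rat c < u (act (inv g) x)"
          using of_rat_dense[of "u x" "u (act (inv g) x)"] by auto
        then have "0 \<le> c"
          using u(2)[of x] by (metis less_eq_real_def less_le_trans not_le of_rat_less_0_iff order_less_le_trans)
        then show False
          using elim c by (meson less_imp_le not_less)
      qed
    qed
  qed
  have "AE x in M. u (act (inv (inv g)) x) \<le> u x"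
    using g by (intro decr) auto
  moreover have "AE x in M. u (act (inv g) (act g x)) \<le> u (act g x)"
    by (rule AE_act[OF g decr[OF g]])
  ultimately show ?thesis
    by eventually_elim (use g in auto)
qed

definition stationary :: "'g pmf \<Rightarrow> bool" where
  "stationary \<mu> \<longleftrightarrow> (AE x in M. (\<Sum>g\<in>set_pmf \<mu>. pmf \<mu> g * rho g x) = 1)"

definition ergodic :: bool where
  "ergodic \<longleftrightarrow> (\<forall>A\<in>sets M. (\<forall>g\<in>carrier G. AE x in M. act g x \<in> A \<longleftrightarrow> x \<in> A)
     \<longrightarrow> (AE x in M. x \<notin> A) \<or> (AE x in M. x \<in> A))"

definition central :: "'g \<Rightarrow> bool" where
  "central z \<longleftrightarrow> z \<in> carrier G \<and> (\<forall>g\<in>carrier G. g \<otimes> z = z \<otimes> g)"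

lemma prob_UNIV [simp]: "prob UNIV = 1"
  using prob_space by simp

lemma integral_rho:
  assumes "g \<in> carrier G"
  shows "integrable M (rho g)" "(\<integral>x. rho g x \<partial>M) = 1"
  using integral_act[OF assms, of "\<lambda>_. 1"] by (simp_all add: prob_space)

lemma ergodicD:
  assumes ergodic "A \<in> sets M" "\<And>g. g \<in> carrier G \<Longrightarrow> AE x in M. act g x \<in> A \<longleftrightarrow> x \<in> A"
  obtains "AE x in M. x \<notin> A" | "AE x in M. x \<in> A"
  using assms unfolding ergodic_def by metis

text \<open>A central \<open>z\<close> commutes with the walk, so the image of the measure under
  \<open>z\<close> is again stationary and its density \<open>rho z\<close> is an invariant
  function. By ergodicity it is essentially constant, and its integral is 1.\<close>

lemma rho_central:
  assumes fin: "finite (set_pmf \<mu>)" and gen: "generating G \<mu>" and st: "stationary \<mu>"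
    and erg: ergodic and z: "central z"
  shows "AE x in M. rho z x = 1"
proof -
  have zG: "z \<in> carrier G" and comm: "g \<otimes> z = z \<otimes> g" if "g \<in> carrier G" for g
    using z that by (auto simp: central_def)
  then have zG: "z \<in> carrier G"
    using one_closed by blast
  have S: "set_pmf \<mu> \<subseteq> carrier G"
    using gen by (simp add: generating_def)
  have [measurable]: "rho z \<in> borel_measurable M"
    using zG by simp
  have "AE x in M. (\<Sum>g\<in>set_pmf \<mu>. pmf \<mu> g * rho g (act (inv z) x)) = 1"
    using st zG unfolding stationary_def by (intro AE_act) auto
  then have "AE x in M. (\<Sum>g\<in>set_pmf \<mu>. pmf \<mu> g * (rho g x * rho z (act (inv g) x))) = rho z x"
  proof eventually_elim
    case (elim x)
    have "(\<Sum>g\<in>set_pmf \<mu>. pmf \<mu> g * (rho g x * rho z (act (inv g) x)))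
        = (\<Sum>g\<in>set_pmf \<mu>. rho z x * (pmf \<mu> g * rho g (act (inv z) x)))"
    proof (intro sum.cong refl)
      fix g assume "g \<in> set_pmf \<mu>"
      then have "g \<in> carrier G"
        using S by auto
      then have "rho g x * rho z (act (inv g) x) = rho z x * rho g (act (inv z) x)"
        using rho_mult[of g z x] rho_mult[of z g x] zG comm by simp
      then show "pmf \<mu> g * (rho g x * rho z (act (inv g) x)) = rho z x * (pmf \<mu> g * rho g (act (inv z) x))"
        by simp
    qed
    also have "\<dots> = rho z x"
      unfolding sum_distrib_left[symmetric] elim by simp
    finally show ?case .
  qed
  then have inv: "AE x in M. rho z (act g x) = rho z x" if "g \<in> carrier G" for g
    using st integral_rho[OF zG] rho_pos[OF zG] that unfolding stationary_def
    by (intro stationary_density_invariant[OF fin gen]) (auto intro: less_imp_le)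
  \<comment> \<open>One threshold is enough: in either alternative \<open>rho z - 1\<close> has
    constant sign and integral zero.\<close>
  define A where "A = {x \<in> space M. rho z x \<le> 1}"
  have [measurable]: "A \<in> sets M"
    unfolding A_def by measurable
  have A_inv: "AE x in M. act g x \<in> A \<longleftrightarrow> x \<in> A" if "g \<in> carrier G" for g
    using inv[OF that] by eventually_elim (simp add: A_def)
  consider "AE x in M. x \<notin> A" | "AE x in M. x \<in> A"
    by (rule ergodicD[OF erg \<open>A \<in> sets M\<close> A_inv])
  then show ?thesis
  proof cases
    case 1
    then have "AE x in M. 0 \<le> rho z x - 1"
      by eventually_elim (simp add: A_def)
    then have "AE x in M. rho z x - 1 = 0"
      using integral_rho[OF zG]
      by (subst integral_nonneg_eq_0_iff_AE[symmetric]) (auto simp: prob_space)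
    then show ?thesis
      by eventually_elim simp
  next
    case 2
    then have "AE x in M. 0 \<le> 1 - rho z x"
      by eventually_elim (simp add: A_def)
    then have "AE x in M. 1 - rho z x = 0"
      using integral_rho[OF zG]
      by (subst integral_nonneg_eq_0_iff_AE[symmetric]) (auto simp: prob_space)
    then show ?thesis
      by eventually_elim simp
  qed
qed

text \<open>The map \<open>pr\<close> abstracts the projection of L x Z onto L: an idempotent
  endomorphism with \<open>g\<close> and \<open>pr g\<close> differing by a central element. Central
  elements preserve the measure, so \<open>g\<close> and \<open>pr g\<close> have the same density;
  hence stationarity passes to the action through \<open>pr\<close>, for which f^2 is another
  stationary density.\<close>

lemma measure_preserving_of_invariant_vector:
  assumes fin: "finite (set_pmf \<mu>)" and gen: "generating G \<mu>" and st: "stationary \<mu>"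
    and erg: ergodic and count: "countable (carrier G)"
    and pr: "\<And>g. g \<in> carrier G \<Longrightarrow> pr g \<in> carrier G"
      "\<And>g h. g \<in> carrier G \<Longrightarrow> h \<in> carrier G \<Longrightarrow> pr (g \<otimes> h) = pr g \<otimes> pr h"
      "\<And>g. g \<in> carrier G \<Longrightarrow> pr (pr g) = pr g"
      "\<And>g. g \<in> carrier G \<Longrightarrow> central (inv (pr g) \<otimes> g)"
    and f: "f \<in> L2" and f0: "\<not> (AE x in M. f x = 0)"
    and f_inv: "\<And>g. g \<in> carrier G \<Longrightarrow> AE x in M. koopman (pr g) f x = f x"
    and g: "g \<in> carrier G"
  shows "AE x in M. rho (pr g) x = 1"
proof -
  have S: "set_pmf \<mu> \<subseteq> carrier G"
    using gen by (simp add: generating_def)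
  have pr_one: "pr \<one> = \<one>"
    using pr(1)[of \<one>] pr(2)[of \<one> \<one>] by simp
  have pr_inv: "pr (inv g) = inv (pr g)" if "g \<in> carrier G" for g
  proof -
    have "pr (inv g) \<otimes> pr g = \<one>"
      using pr(2)[of "inv g" g] that by (simp add: pr_one)
    then show ?thesis
      using pr(1) that by (metis inv_equality inv_closed)
  qed
  \<comment> \<open>The same group acting through \<open>pr\<close>, so that
    \<open>stationary_density_invariant\<close> applies to L although \<open>\<mu>\<close> lives on
    the whole group.\<close>
  interpret L: nonsingular_system G M "\<lambda>g. act (pr g)" "\<lambda>g. rho (pr g)"
  proof (rule nonsingular_system.intro[OF group_axioms prob_space_axioms], rule nonsingular_system_axioms.intro)
    show "rho (pr (g \<otimes> h)) x = rho (pr g) x * rho (pr h) (act (pr (inv g)) x)"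
      if "g \<in> carrier G" "h \<in> carrier G" for g h x
      using that pr by (simp add: rho_mult pr_inv)
  qed (use pr in \<open>auto simp: pr_one act_one act_mult rho_pos distr_act\<close>)
  have split: "g = pr g \<otimes> (inv (pr g) \<otimes> g)" if "g \<in> carrier G" for g
    using that pr(1)[OF that] by (simp add: m_assoc[symmetric])
  have "AE x in M. \<forall>g\<in>carrier G. rho g x = rho (pr g) x"
  proof (subst AE_ball_countable[OF count], intro ballI)
    fix g assume g: "g \<in> carrier G"
    let ?z = "inv (pr g) \<otimes> g"
    have "AE x in M. rho ?z (act (inv (pr g)) x) = 1"
      using g pr by (intro AE_act rho_central[OF fin gen st erg]) auto
    then show "AE x in M. rho g x = rho (pr g) x"
    proof eventually_elim
      case (elim x)
      have "rho g x = rho (pr g \<otimes> ?z) x"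
        using split[OF g] by simp
      then show ?case
        using g pr(1)[OF g] elim by (simp add: rho_mult)
    qed
  qed
  note rho_pr = this
  have st_L: "AE x in M. (\<Sum>g\<in>set_pmf \<mu>. pmf \<mu> g * rho (pr g) x) = 1"
    using st rho_pr unfolding stationary_def
  proof eventually_elim
    case (elim x)
    have "(\<Sum>g\<in>set_pmf \<mu>. pmf \<mu> g * rho (pr g) x) = (\<Sum>g\<in>set_pmf \<mu>. pmf \<mu> g * rho g x)"
      using S elim(2) by (intro sum.cong refl) auto
    then show ?case
      using elim by simp
  qed
  have sq: "rho (pr g) x * (f (act (inv (pr g)) x))\<^sup>2 = (f x)\<^sup>2"
    if "koopman (pr g) f x = f x" "g \<in> carrier G" for g x
  proof -
    have "(f x)\<^sup>2 = (sqrt (rho (pr g) x) * f (act (inv (pr g)) x))\<^sup>2"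
      using that by (simp add: koopman_def)
    then show ?thesis
      using rho_pos[of "pr g" x] that pr by (simp add: power_mult_distrib less_imp_le)
  qed
  have f2: "AE x in M. (f (act (pr g) x))\<^sup>2 = (f x)\<^sup>2" if g: "g \<in> carrier G" for g
  proof (rule L.stationary_density_invariant[OF fin gen st_L _ _ _ g])
    show "integrable M (\<lambda>x. (f x)\<^sup>2)"
      by (rule L2_square_integrable[OF f])
    have "AE x in M. \<forall>g\<in>set_pmf \<mu>. koopman (pr g) f x = f x"
      using f_inv S by (subst AE_ball_countable) (auto intro: countable_finite fin)
    then show "AE x in M. (\<Sum>g\<in>set_pmf \<mu>. pmf \<mu> g * (rho (pr g) x * (f (act (pr (inv g)) x))\<^sup>2)) = (f x)\<^sup>2"
    proof eventually_elim
      case (elim x)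
      have "(\<Sum>g\<in>set_pmf \<mu>. pmf \<mu> g * (rho (pr g) x * (f (act (pr (inv g)) x))\<^sup>2))
          = (\<Sum>g\<in>set_pmf \<mu>. pmf \<mu> g * (f x)\<^sup>2)"
      proof (intro sum.cong refl)
        fix g assume "g \<in> set_pmf \<mu>"
        then show "pmf \<mu> g * (rho (pr g) x * (f (act (pr (inv g)) x))\<^sup>2) = pmf \<mu> g * (f x)\<^sup>2"
          using elim S sq[of g x] by (auto simp: pr_inv)
      qed
      then show ?case
        using sum_pmf_eq_1[OF fin order_refl] by (simp add: sum_distrib_right[symmetric])
    qed
  qed simp
  \<comment> \<open>The points at which all of L preserves the measure. Invariance under L comes
    from the cocycle identity; invariance under the complement holds because its elements commute
    with L and have density 1.\<close>
  define A where "A = {x \<in> space M. \<forall>g\<in>carrier G. rho (pr g) x = 1}"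
  have [measurable]: "A \<in> sets M"
  proof -
    have "{x \<in> space M. rho (pr g) x = 1} \<in> sets M" if "g \<in> carrier G" for g
      using pr(1)[OF that] by measurable
    then have "(\<Inter>g\<in>carrier G. {x \<in> space M. rho (pr g) x = 1}) \<in> sets M"
      using count by (intro sets.countable_INT') auto
    also have "(\<Inter>g\<in>carrier G. {x \<in> space M. rho (pr g) x = 1}) = A"
      by (auto simp: A_def)
    finally show ?thesis .
  qed
  have A_pr: "act (pr h) x \<in> A" if h: "h \<in> carrier G" and x: "x \<in> A" for h x
  proof -
    have "rho (pr g) (act (pr h) x) = 1" if g: "g \<in> carrier G" for g
    proof -
      have "rho (pr (inv h \<otimes> g)) x = rho (pr (inv h)) x * rho (pr g) (act (inv (pr (inv h))) x)"
        using g h pr by (simp add: rho_mult)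
      moreover have "rho (pr (inv h \<otimes> g)) x = 1" "rho (pr (inv h)) x = 1"
        using x g h by (auto simp: A_def)
      ultimately show ?thesis
        using h pr by (simp add: pr_inv)
    qed
    then show ?thesis
      by (simp add: A_def)
  qed
  have A_pr_iff: "act (pr h) x \<in> A \<longleftrightarrow> x \<in> A" if h: "h \<in> carrier G" for h x
    using A_pr[OF h, of x] A_pr[of "inv h" "act (pr h) x"] h pr by (auto simp: pr_inv)
  have A_inv: "AE x in M. act g x \<in> A \<longleftrightarrow> x \<in> A" if g: "g \<in> carrier G" for g
  proof -
    define z where "z = inv (pr g) \<otimes> g"
    have z: "central z" and zG: "z \<in> carrier G"
      using pr(4)[OF g] by (auto simp: z_def central_def)
    have iz: "central (inv z)"
      using z unfolding central_def by (auto simp: inv_comm) (metis inv_closed inv_inv inv_mult_group)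
    have one: "AE x in M. rho (inv z) x = 1"
      by (rule rho_central[OF fin gen st erg iz])
    have "AE x in M. \<forall>g\<in>carrier G. rho (inv z) (act (inv (pr g)) x) = 1"
    proof (subst AE_ball_countable[OF count], intro ballI)
      fix h assume "h \<in> carrier G"
      then show "AE x in M. rho (inv z) (act (inv (pr h)) x) = 1"
        using pr(1) by (intro AE_act[OF _ one]) auto
    qed
    then show ?thesis
      using one
    proof eventually_elim
      case (elim x)
      have "rho (pr h) (act z x) = rho (pr h) x" if h: "h \<in> carrier G" for h
      proof -
        have "rho (inv z \<otimes> pr h) x = rho (pr h \<otimes> inv z) x"
          using iz pr(1)[OF h] by (simp add: central_def)
        then show ?thesis
          using elim h zG pr(1)[OF h] by (simp add: rho_mult)
      qed
      then have "act z x \<in> A \<longleftrightarrow> x \<in> A"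
        by (auto simp: A_def)
      moreover have "act g x = act (pr g) (act z x)"
        using split[OF g] act_mult[OF pr(1)[OF g] zG, of x] by (simp add: z_def)
      ultimately show ?case
        using A_pr_iff[OF g] by simp
    qed
  qed
  \<comment> \<open>Invariance of the vector reads rho(x) f(g^-1 x)^2 = f(x)^2, and invariance of
    the function f^2 cancels the squares wherever \<open>f\<close> is nonzero.\<close>
  have sub: "AE x in M. f x \<noteq> 0 \<longrightarrow> x \<in> A"
  proof -
    have "AE x in M. \<forall>g\<in>carrier G. f x \<noteq> 0 \<longrightarrow> rho (pr g) x = 1"
    proof (subst AE_ball_countable[OF count], intro ballI)
      fix g assume g: "g \<in> carrier G"
      have "AE x in M. (f (act (pr (inv g)) x))\<^sup>2 = (f x)\<^sup>2"
        using g by (intro f2) simp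
      then show "AE x in M. f x \<noteq> 0 \<longrightarrow> rho (pr g) x = 1"
        using f_inv[OF g]
      proof eventually_elim
        case (elim x)
        then show ?case
          using sq[OF elim(2) g] g by (auto simp: pr_inv)
      qed
    qed
    then show ?thesis
      by eventually_elim (auto simp: A_def)
  qed
  consider "AE x in M. x \<notin> A" | "AE x in M. x \<in> A"
    by (rule ergodicD[OF erg \<open>A \<in> sets M\<close> A_inv])
  then show ?thesis
  proof cases
    case 1
    then have "AE x in M. f x = 0"
      using sub by eventually_elim auto
    then show ?thesis
      using f0 by simp
  next
    case 2
    then show ?thesis
      by eventually_elim (use g in \<open>simp add: A_def\<close>)
  qed
qed

text \<open>The gap is applied to the indicator of \<open>A\<close>. By (sqrt a - sqrt b)^2 <= |a -
  b|, the L1 bound \<open>near\<close> becomes an L2 bound on its \<open>koopman\<close>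
  displacement, so the energy is at most card I times \<open>\<epsilon>\<close> / 2. The condition
  on \<open>\<epsilon>\<close> keeps the invariant limit closer than \<open>prob A\<close> to the
  indicator in L1, hence nonzero.\<close>

lemma measure_preserving_of_almost_invariant_set:
  fixes I :: "'i set" and k :: "'i \<Rightarrow> 'f::{finite,comm_ring_1} \<Rightarrow> 'g" and \<delta> \<epsilon> :: real
  assumes fin: "finite (set_pmf \<mu>)" and gen: "generating G \<mu>" and st: "stationary \<mu>"
    and erg: ergodic and count: "countable (carrier G)"
    and pr: "\<And>g. g \<in> carrier G \<Longrightarrow> pr g \<in> carrier G"
      "\<And>g h. g \<in> carrier G \<Longrightarrow> h \<in> carrier G \<Longrightarrow> pr (g \<otimes> h) = pr g \<otimes> pr h"
      "\<And>g. g \<in> carrier G \<Longrightarrow> pr (pr g) = pr g"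
      "\<And>g. g \<in> carrier G \<Longrightarrow> central (inv (pr g) \<otimes> g)"
    and I: "finite I" "I \<noteq> {}"
    and k: "\<And>i. i \<in> I \<Longrightarrow> one_param (k i)"
    and pair: "\<And>i j v. i \<in> I \<Longrightarrow> j \<in> I \<Longrightarrow> i \<noteq> j \<Longrightarrow> v \<in> L2 \<Longrightarrow>
      2 * ip2 (kp.defect (k i) v) (kp.defect (k j) v)
        \<ge> - \<delta> * (ip2 (kp.defect (k i) v) (kp.defect (k i) v) + ip2 (kp.defect (k j) v) (kp.defect (k j) v))"
    and \<delta>: "0 \<le> \<delta>" "2 * real (card I - 1) * \<delta> \<le> 1"
    and pr_gen: "pr ` carrier G \<subseteq> semigroup_generated G (\<Union>i\<in>I. range (k i))"
    and A: "A \<in> sets M"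
    and near: "\<And>i c. i \<in> I \<Longrightarrow>
      (\<integral>\<^sup>+x. ennreal \<bar>rho (k i c) x * indicator A (act (inv (k i c)) x) - indicator A x\<bar> \<partial>M) \<le> ennreal \<epsilon>"
    and \<epsilon>: "0 \<le> \<epsilon>" "sqrt (\<epsilon> / 2) < prob A * (1 - sqrt (1 - 1 / (2 * card I)))"
    and g: "g \<in> carrier G"
  shows "AE x in M. rho (pr g) x = 1"
proof -
  define v :: "'x \<Rightarrow> real" where "v = indicator A"
  have [measurable]: "v \<in> borel_measurable M"
    using A by (simp add: v_def)
  have vv: "v x * v x = v x" for x
    by (simp add: v_def indicator_def)
  have v_int: "integrable M v"
    unfolding v_def by (rule integrable_real_indicator) (use A in \<open>auto simp: less_top[symmetric]\<close>)
  have v: "v \<in> L2"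
    using v_int by (simp add: L2_def power2_eq_square vv)
  have sqrt_le: "(sqrt a - sqrt b)\<^sup>2 \<le> \<bar>a - b\<bar>" if "0 \<le> a" "0 \<le> b" for a b :: real
  proof -
    have "(sqrt a - sqrt b)\<^sup>2 = \<bar>sqrt a - sqrt b\<bar> * \<bar>sqrt a - sqrt b\<bar>"
      by (simp add: power2_eq_square)
    also have "\<dots> \<le> \<bar>sqrt a - sqrt b\<bar> * \<bar>sqrt a + sqrt b\<bar>"
    proof (intro mult_left_mono)
      have "0 \<le> sqrt a" "0 \<le> sqrt b"
        using that by auto
      then show "\<bar>sqrt a - sqrt b\<bar> \<le> \<bar>sqrt a + sqrt b\<bar>"
        by arith
    qed simp
    also have "\<dots> = \<bar>a - b\<bar>"
    proof -
      have "(sqrt a - sqrt b) * (sqrt a + sqrt b) = a - b"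
        using that by (simp add: algebra_simps)
      then show ?thesis
        by (simp only: abs_mult[symmetric])
    qed
    finally show ?thesis .
  qed
  \<comment> \<open>For the isometry T = \<open>koopman (k i c)\<close> the squared displacement is
    2 (<v, v> - <v, Tv>), whence the factor 1/2; the mean over \<open>c\<close> of these differences
    is the squared norm of the defect.\<close>
  have ip_near: "ip2 v v - ip2 v (koopman (k i c) v) \<le> \<epsilon> / 2" if i: "i \<in> I" for i c
  proof -
    let ?g = "k i c"
    have g: "?g \<in> carrier G"
      using one_paramD(1)[OF k[OF i]] .
    have Tv: "koopman ?g v \<in> L2"
      by (rule kp.T_V[OF g v])
    have [measurable]: "act (inv ?g) \<in> M \<rightarrow>\<^sub>M M" "rho ?g \<in> borel_measurable M"
      using g by simp_all
    have d: "koopman ?g v - v \<in> L2"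
      by (intro kp.V_diff Tv v)
    have "(\<integral>\<^sup>+x. ennreal ((koopman ?g v x - v x)\<^sup>2) \<partial>M)
        \<le> (\<integral>\<^sup>+x. ennreal \<bar>rho ?g x * indicator A (act (inv ?g) x) - indicator A x\<bar> \<partial>M)"
    proof (intro nn_integral_mono ennreal_leI)
      fix x
      have "koopman ?g v x - v x = sqrt (rho ?g x * indicator A (act (inv ?g) x)) - sqrt (indicator A x)"
        by (simp add: koopman_def v_def indicator_def)
      then show "(koopman ?g v x - v x)\<^sup>2 \<le> \<bar>rho ?g x * indicator A (act (inv ?g) x) - indicator A x\<bar>"
        using rho_pos[OF g, of x] by (simp only:) (intro sqrt_le, auto)
    qed
    also have "\<dots> \<le> ennreal \<epsilon>"
      by (rule near[OF i])
    finally have "ennreal (\<integral>x. (koopman ?g v x - v x)\<^sup>2 \<partial>M) \<le> ennreal \<epsilon>"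
      using L2_square_integrable[OF d] by (subst (asm) nn_integral_eq_integral) auto
    then have "ip2 (koopman ?g v - v) (koopman ?g v - v) \<le> \<epsilon>"
      using \<epsilon> by (simp add: ip2_def power2_eq_square)
    moreover have "ip2 (koopman ?g v - v) (koopman ?g v - v) = 2 * (ip2 v v - ip2 v (koopman ?g v))"
      using v Tv kp.T_ip[OF g v v] kp.ip_sym[OF Tv v] by (simp add: kp.ip_lin)
    ultimately show ?thesis
      by simp
  qed
  have "ip2 (kp.defect (k i) v) (kp.defect (k i) v) \<le> \<epsilon> / 2" if i: "i \<in> I" for i
  proof -
    have car: "k i c \<in> carrier G" for c
      using one_paramD(1)[OF k[OF i]] .
    have "ip2 (kp.defect (k i) v) (kp.defect (k i) v) = ip2 v (kp.defect (k i) v)"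
      by (rule kp.ip_defect[OF k[OF i] v, symmetric])
    also have "\<dots> = ip2 v v - (1 / CARD('f)) * (\<Sum>c\<in>UNIV. ip2 v (koopman (k i c) v))"
      using v car by (simp add: kp.defect_def kp.avg_def kp.ip_lin kp.ip_sum_right kp.T_V)
    also have "\<dots> = (1 / CARD('f)) * (\<Sum>c\<in>(UNIV::'f set). ip2 v v - ip2 v (koopman (k i c) v))"
      by (simp add: sum_subtractf right_diff_distrib)
    also have "\<dots> \<le> (1 / CARD('f)) * (\<Sum>c\<in>(UNIV::'f set). \<epsilon> / 2)"
      by (intro mult_left_mono sum_mono ip_near i) auto
    also have "\<dots> = \<epsilon> / 2"
      by simp
    finally show ?thesis .
  qed
  then have E: "kp.energy I k v \<le> card I * (\<epsilon> / 2)"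
    unfolding kp.energy_def by (intro sum_bounded_above)
  let ?s = "1 - sqrt (1 - 1 / (2 * real (card I)))"
  have n: "card I > 0"
    using I by (simp add: card_gt_0_iff)
  have s: "?s > 0"
    using n by simp
  obtain f where f: "f \<in> L2" "\<And>i c. i \<in> I \<Longrightarrow> AE x in M. koopman (k i c) f x = f x"
    and close: "(\<integral>\<^sup>+x. ennreal \<bar>f x - v x\<bar> \<partial>M) \<le> ennreal (sqrt (kp.energy I k v / card I) / ?s)"
    using almost_invariant_limit[of I k \<delta> v, OF I k pair \<delta> v] by auto
  have "sqrt (kp.energy I k v / card I) / ?s \<le> sqrt (\<epsilon> / 2) / ?s"
    using E n s by (intro divide_right_mono real_sqrt_le_mono) (auto simp: field_simps)
  also have "\<dots> < prob A"
    using \<epsilon> s by (simp add: field_simps)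
  finally have lt: "sqrt (kp.energy I k v / card I) / ?s < prob A" .
  have f0: "\<not> (AE x in M. f x = 0)"
  proof
    assume "AE x in M. f x = 0"
    then have "AE x in M. ennreal \<bar>f x - v x\<bar> = indicator A x"
      by eventually_elim (simp add: v_def indicator_def)
    then have "(\<integral>\<^sup>+x. ennreal \<bar>f x - v x\<bar> \<partial>M) = emeasure M A"
      using A by (simp add: nn_integral_cong_AE)
    then have "ennreal (prob A) \<le> ennreal (sqrt (kp.energy I k v / card I) / ?s)"
      using close by (simp add: emeasure_eq_measure)
    moreover have "0 \<le> sqrt (kp.energy I k v / card I) / ?s"
      using s by (auto simp: kp.energy_def ip2_def intro!: divide_nonneg_pos sum_nonneg)
    ultimately show False
      using lt by (auto simp: ennreal_le_iff2)
  qed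
  have car: "k i c \<in> carrier G" if "i \<in> I" for i c
    using one_paramD(1)[OF k[OF that]] .
  have gen_inv: "h \<in> carrier G \<and> (AE x in M. koopman h f x = f x)"
    if "h \<in> semigroup_generated G (\<Union>i\<in>I. range (k i))" for h
    using that
  proof induction
    case (gen s)
    then show ?case
      using f car by auto
  next
    case (mult a b)
    have "AE x in M. koopman a (koopman b f) x = koopman a f x"
      using mult by (intro koopman_AE_cong) auto
    moreover have "AE x in M. koopman a f x = f x"
      using mult by simp
    ultimately have "AE x in M. koopman a (koopman b f) x = f x"
      by eventually_elim simp
    then show ?case
      using mult by (simp add: kp.T_mult)
  qed
  show ?thesis
    by (rule measure_preserving_of_invariant_vector[OF fin gen st erg count pr f(1) f0 _ g])
      (use gen_inv pr_gen in auto)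
qed

end

section \<open>Strict models of nonsingular actions\<close>

lemma nonsingular_autD:
  assumes "nonsingular_aut M T"
  shows "T \<in> M \<rightarrow>\<^sub>M M" "ae_inverse M T (aut_inv M T)" "aut_inv M T \<in> M \<rightarrow>\<^sub>M M"
    "AE x in M. aut_inv M T (T x) = x" "AE x in M. T (aut_inv M T x) = x"
proof -
  show "T \<in> M \<rightarrow>\<^sub>M M"
    using assms by (simp add: nonsingular_aut_def)
  show "ae_inverse M T (aut_inv M T)"
    using assms unfolding nonsingular_aut_def aut_inv_def by (metis someI_ex)
  then show "aut_inv M T \<in> M \<rightarrow>\<^sub>M M" "AE x in M. aut_inv M T (T x) = x" "AE x in M. T (aut_inv M T x) = x"
    by (auto simp: ae_inverse_def)
qed

lemma AE_nonsingular_aut: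
  assumes T: "nonsingular_aut M T" and P: "AE x in M. P x"
  shows "AE x in M. P (T x)"
proof -
  have [measurable]: "T \<in> M \<rightarrow>\<^sub>M M"
    by (rule nonsingular_autD(1)[OF T])
  obtain N where N: "{x \<in> space M. \<not> P x} \<subseteq> N" "N \<in> sets M" "emeasure M N = 0"
    using P by (auto elim: AE_E)
  have "T -` N \<inter> space M \<in> null_sets M"
    using T N by (auto simp: nonsingular_aut_def null_sets_def)
  moreover have "{x \<in> space M. \<not> P (T x)} \<subseteq> T -` N \<inter> space M"
    using N(1) measurable_space[OF nonsingular_autD(1)[OF T]] by auto
  ultimately show ?thesis
    by (rule AE_I')
qed

text \<open>Nonsingularity is given for \<open>T\<close>, not for \<open>S\<close>. Pulling a null
  set back along \<open>S\<close> and then along \<open>T\<close> returns it up to a null set, so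
  nonsingularity of \<open>T\<close> makes its preimage under \<open>S\<close> null.\<close>

lemma AE_aut_inv:
  assumes T: "nonsingular_aut M T" and S: "ae_inverse M T S" and P: "AE x in M. P x"
  shows "AE x in M. P (S x)"
proof -
  have [measurable]: "T \<in> M \<rightarrow>\<^sub>M M" "S \<in> M \<rightarrow>\<^sub>M M"
    using nonsingular_autD(1)[OF T] S by (auto simp: ae_inverse_def)
  obtain N where N: "{x \<in> space M. \<not> P x} \<subseteq> N" "N \<in> sets M" "emeasure M N = 0"
    using P by (auto elim: AE_E)
  have [measurable]: "N \<in> sets M"
    by fact
  have "AE x in M. x \<notin> N"
    using N by (intro AE_not_in) (auto simp: null_sets_def)
  then have "AE x in M. S (T x) \<notin> N"
    using S unfolding ae_inverse_def by (auto elim: eventually_elim2)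
  then have "emeasure M (T -` (S -` N \<inter> space M) \<inter> space M) = 0"
    by (subst (asm) AE_iff_measurable[of "T -` (S -` N \<inter> space M) \<inter> space M"])
      (auto intro: measurable_space[OF nonsingular_autD(1)[OF T]])
  then have "emeasure M (S -` N \<inter> space M) = 0"
    using T by (auto simp: nonsingular_aut_def)
  then have "S -` N \<inter> space M \<in> null_sets M"
    by (auto simp: null_sets_def)
  moreover have "{x \<in> space M. \<not> P (S x)} \<subseteq> S -` N \<inter> space M"
    using N(1) S measurable_space[of S M M] by (auto simp: ae_inverse_def)
  ultimately show ?thesis
    by (rule AE_I')
qed

text \<open>Compare \<open>S\<close> with the composite of \<open>S\<close>, \<open>T\<close> and
  \<open>S'\<close>. It is needed because \<open>aut_inv\<close> is an arbitrary choice among the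
  inverses.\<close>

lemma ae_inverse_unique:
  assumes T: "nonsingular_aut M T" and S: "ae_inverse M T S" "ae_inverse M T S'"
  shows "AE x in M. S x = S' x"
proof -
  have "AE x in M. S' (T (S x)) = S x"
    using S by (intro AE_aut_inv[OF T S(1)]) (auto simp: ae_inverse_def)
  then show ?thesis
    using S(1) unfolding ae_inverse_def by (auto elim: eventually_elim2)
qed

abbreviation rn_real :: "'x measure \<Rightarrow> ('x \<Rightarrow> 'x) \<Rightarrow> 'x \<Rightarrow> real" where
  "rn_real M T x \<equiv> enn2real (RN_deriv M (distr M M T) x)"

context prob_space
begin

text \<open>Positivity uses the second half of nonsingularity: the preimage of the zero set of the
  density is null, hence so is the zero set.\<close>

lemma distr_eq_density_rn:
  assumes T: "nonsingular_aut M T"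
  shows "distr M M T = density M (\<lambda>x. ennreal (rn_real M T x))" "AE x in M. 0 < rn_real M T x"
proof -
  have [measurable]: "T \<in> M \<rightarrow>\<^sub>M M"
    by (rule nonsingular_autD(1)[OF T])
  interpret D: prob_space "distr M M T"
    by (rule prob_space_distr) simp
  have ac: "absolutely_continuous M (distr M M T)"
    using T by (auto simp: absolutely_continuous_def null_sets_def emeasure_distr nonsingular_aut_def)
  have eq: "density M (RN_deriv M (distr M M T)) = distr M M T"
    by (rule density_RN_deriv[OF ac]) simp
  have fin: "AE x in M. RN_deriv M (distr M M T) x \<noteq> \<infinity>"
    by (rule RN_deriv_finite[OF D.sigma_finite_measure_axioms ac]) simp
  have "density M (RN_deriv M (distr M M T)) = density M (\<lambda>x. ennreal (rn_real M T x))"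
    using fin by (intro density_cong) (auto simp: less_top)
  then show eq': "distr M M T = density M (\<lambda>x. ennreal (rn_real M T x))"
    using eq by simp
  define A where "A = {x \<in> space M. rn_real M T x = 0}"
  have [measurable]: "A \<in> sets M"
    unfolding A_def by measurable
  have "emeasure (distr M M T) A = (\<integral>\<^sup>+x. ennreal (rn_real M T x) * indicator A x \<partial>M)"
    by (subst eq') (simp add: emeasure_density)
  also have "\<dots> = (\<integral>\<^sup>+x. 0 \<partial>M)"
    by (intro nn_integral_cong) (auto simp: A_def indicator_def)
  finally have "emeasure M A = 0"
    using T by (simp add: emeasure_distr nonsingular_aut_def)
  then have "AE x in M. x \<notin> A"
    by (intro AE_not_in) (auto simp: null_sets_def)
  then show "AE x in M. 0 < rn_real M T x"
    using AE_space by eventually_elim (auto simp: A_def less_le)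
qed

text \<open>Identifies \<open>U_ind M T A\<close> as the density of the image under \<open>T\<close>
  of the restriction of \<open>M\<close> to \<open>A\<close>.\<close>

lemma nn_integral_U_ind:
  assumes T: "nonsingular_aut M T" and [measurable]: "A \<in> sets M" "E \<in> sets M"
  shows "(\<integral>\<^sup>+x. ennreal (U_ind M T A x) * indicator E x \<partial>M) = emeasure M (A \<inter> (T -` E \<inter> space M))"
proof -
  note [measurable] = nonsingular_autD(1,3)[OF T]
  have "(\<integral>\<^sup>+x. ennreal (U_ind M T A x) * indicator E x \<partial>M)
      = (\<integral>\<^sup>+x. ennreal (rn_real M T x) * (indicator A (aut_inv M T x) * indicator E x) \<partial>M)"
    by (intro nn_integral_cong) (auto simp: U_ind_def indicator_def)
  also have "\<dots> = (\<integral>\<^sup>+x. indicator A (aut_inv M T x) * indicator E x \<partial>distr M M T)"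
    by (subst distr_eq_density_rn[OF T]) (simp add: nn_integral_density)
  also have "\<dots> = (\<integral>\<^sup>+x. indicator A (aut_inv M T (T x)) * indicator E (T x) \<partial>M)"
    by (simp add: nn_integral_distr)
  also have "\<dots> = (\<integral>\<^sup>+x. indicator (A \<inter> (T -` E \<inter> space M)) x \<partial>M)"
    using nonsingular_autD(4)[OF T] AE_space
    by (intro nn_integral_cong_AE, eventually_elim) (auto simp: indicator_def)
  finally show ?thesis
    by simp
qed

lemma U_ind_measurable:
  assumes T: "nonsingular_aut M T" and [measurable]: "A \<in> sets M"
  shows "U_ind M T A \<in> borel_measurable M"
proof -
  note [measurable] = nonsingular_autD(1,3)[OF T]
  show ?thesis
    unfolding U_ind_def[abs_def] by measurable
qed

lemma U_ind_trivial:
  assumes T: "nonsingular_aut M T" and [measurable]: "A \<in> sets M"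
    and triv: "AE x in M. x \<in> A \<longrightarrow> T x = x"
  shows "AE x in M. U_ind M T A x = indicator A x"
proof -
  note [measurable] = nonsingular_autD(1)[OF T] U_ind_measurable[OF T]
  have "density M (\<lambda>x. ennreal (U_ind M T A x)) = density M (\<lambda>x. ennreal (indicator A x))"
  proof (rule measure_eqI)
    fix E assume "E \<in> sets (density M (\<lambda>x. ennreal (U_ind M T A x)))"
    then have [measurable]: "E \<in> sets M"
      by simp
    have "emeasure M (A \<inter> (T -` E \<inter> space M)) = emeasure M (A \<inter> E)"
      using triv by (intro emeasure_eq_AE) auto
    also have "\<dots> = (\<integral>\<^sup>+x. ennreal (indicator A x) * indicator E x \<partial>M)"
      by (subst nn_integral_indicator[symmetric])
        (auto intro!: nn_integral_cong simp del: nn_integral_indicator split: split_indicator)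
    finally show "emeasure (density M (\<lambda>x. ennreal (U_ind M T A x))) E
        = emeasure (density M (\<lambda>x. ennreal (indicator A x))) E"
      by (simp add: emeasure_density nn_integral_U_ind[OF T])
  qed simp
  then have "AE x in M. ennreal (U_ind M T A x) = ennreal (indicator A x)"
    by (rule density_unique[rotated 2]) simp_all
  then show ?thesis
    by eventually_elim (auto simp: U_ind_def)
qed

text \<open>A nonsingular action is only an action up to null sets. As the group is countable, discarding an
  invariant null set makes it, together with its Radon-Nikodym cocycle, an action everywhere.\<close>

lemma strict_model:
  fixes G :: "('g, 'b) monoid_scheme" (structure)
  assumes G: "group G" "countable (carrier G)" and sp: "space M = UNIV" and compl: "complete_measure M"
    and a: "nonsingular_action G M a"
  obtains act rho where "nonsingular_system G M act rho"
    "\<And>g. g \<in> carrier G \<Longrightarrow> AE x in M. act g x = a g x"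
    "\<And>g. g \<in> carrier G \<Longrightarrow> AE x in M. rho g x = rn_real M (a g) x"
    "\<And>g. g \<in> carrier G \<Longrightarrow> AE x in M. act (inv g) x = aut_inv M (a g) x"
proof -
  interpret G: group G by fact
  interpret complete_measure M by fact
  have aut: "nonsingular_aut M (a g)" if "g \<in> carrier G" for g
    using a that by (simp add: nonsingular_action_def)
  have mult: "AE x in M. a (g \<otimes> h) x = a g (a h x)" if "g \<in> carrier G" "h \<in> carrier G" for g h
    using a that by (simp add: nonsingular_action_def)
  have am [measurable]: "g \<in> carrier G \<Longrightarrow> a g \<in> M \<rightarrow>\<^sub>M M" for g
    by (rule nonsingular_autD(1)[OF aut])
  define r where "r g = rn_real M (a g)" for g
  have [measurable]: "r g \<in> borel_measurable M" for g
    unfolding r_def by measurable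
  have r_distr: "distr M M (a g) = density M (\<lambda>x. ennreal (r g x))" and r_pos: "AE x in M. 0 < r g x"
    if "g \<in> carrier G" for g
    using distr_eq_density_rn[OF aut[OF that]] by (simp_all add: r_def)
  \<comment> \<open>The product law makes the action of the unit idempotent, and an invertible
    idempotent is the identity.\<close>
  have a_one: "AE x in M. a \<one> x = x"
  proof -
    let ?S = "aut_inv M (a \<one>)"
    note S = nonsingular_autD[OF aut[OF G.one_closed]]
    have "AE x in M. ?S (a \<one> (a \<one> x)) = a \<one> x"
      by (rule AE_nonsingular_aut[OF aut[OF G.one_closed] S(4)])
    moreover have "AE x in M. a \<one> x = a \<one> (a \<one> x)"
      using mult[of \<one> \<one>] by simp
    ultimately show ?thesis
      using S(4) by eventually_elim simp
  qed
  have inv_act: "AE x in M. a (inv g) (a g x) = x" if g: "g \<in> carrier G" for g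
    using mult[of "inv g" g] g a_one by (auto elim: eventually_elim2)
  \<comment> \<open>The chain rule, by uniqueness of the density of the image measure under a
    product.\<close>
  have coc: "AE x in M. r (g \<otimes> h) x = r g x * r h (a (inv g) x)"
    if g: "g \<in> carrier G" and h: "h \<in> carrier G" for g h
  proof -
    note [measurable] = am[OF g] am[OF h] am[OF G.inv_closed[OF g]] am[OF G.m_closed[OF g h]]
    have "distr M M (a (g \<otimes> h)) = distr M M (\<lambda>x. a g (a h x))"
      using mult[OF g h] by (intro distr_cong_AE) auto
    also have "\<dots> = distr (distr M M (a h)) M (a g)"
      by (simp add: distr_distr o_def)
    also have "\<dots> = density M (\<lambda>x. ennreal (r g x) * ennreal (r h (a (inv g) x)))"
    proof (rule measure_eqI)
      fix E assume "E \<in> sets (distr (distr M M (a h)) M (a g))"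
      then have [measurable]: "E \<in> sets M"
        by simp
      have "emeasure (distr (distr M M (a h)) M (a g)) E
          = (\<integral>\<^sup>+x. indicator E x \<partial>distr (distr M M (a h)) M (a g))"
        by (subst nn_integral_indicator) simp_all
      also have "\<dots> = (\<integral>\<^sup>+x. indicator E (a g x) \<partial>distr M M (a h))"
        by (subst nn_integral_distr) simp_all
      also have "\<dots> = (\<integral>\<^sup>+x. ennreal (r h x) * indicator E (a g x) \<partial>M)"
        by (subst r_distr[OF h]) (simp add: nn_integral_density)
      also have "\<dots> = (\<integral>\<^sup>+x. ennreal (r h (a (inv g) (a g x))) * indicator E (a g x) \<partial>M)"
        using inv_act[OF g] by (intro nn_integral_cong_AE, eventually_elim) simp
      also have "\<dots> = (\<integral>\<^sup>+x. ennreal (r h (a (inv g) x)) * indicator E x \<partial>distr M M (a g))"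
        by (simp add: nn_integral_distr)
      also have "\<dots> = (\<integral>\<^sup>+x. ennreal (r g x) * (ennreal (r h (a (inv g) x)) * indicator E x) \<partial>M)"
        by (subst r_distr[OF g]) (simp add: nn_integral_density)
      also have "\<dots> = emeasure (density M (\<lambda>x. ennreal (r g x) * ennreal (r h (a (inv g) x)))) E"
        by (simp add: emeasure_density mult.assoc)
      finally show "emeasure (distr (distr M M (a h)) M (a g)) E
        = emeasure (density M (\<lambda>x. ennreal (r g x) * ennreal (r h (a (inv g) x)))) E" .
    qed simp
    finally have "density M (\<lambda>x. ennreal (r (g \<otimes> h) x))
        = density M (\<lambda>x. ennreal (r g x) * ennreal (r h (a (inv g) x)))"
      using r_distr[OF G.m_closed[OF g h]] by simp
    then have "AE x in M. ennreal (r (g \<otimes> h) x) = ennreal (r g x) * ennreal (r h (a (inv g) x))"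
      by (rule density_unique[rotated 2]) simp_all
    then show ?thesis
      by eventually_elim (simp add: r_def ennreal_mult[symmetric])
  qed
  define good where "good x \<longleftrightarrow> a \<one> x = x \<and> (\<forall>g\<in>carrier G. 0 < r g x \<and> (\<forall>h\<in>carrier G.
      a (g \<otimes> h) x = a g (a h x) \<and> r (g \<otimes> h) x = r g x * r h (a (inv g) x)))" for x
  have good: "AE x in M. good x"
    unfolding good_def using a_one r_pos mult coc G(2)
    by (simp add: AE_conj_iff AE_ball_countable)
  define X where "X = {x. good x \<and> (\<forall>g\<in>carrier G. good (a g x))}"
  have AE_X: "AE x in M. x \<in> X"
    using good G(2) AE_nonsingular_aut[OF aut good] by (simp add: X_def AE_conj_iff AE_ball_countable)
  \<comment> \<open>The set on which two measurable maps into \<open>M\<close> agree need not be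
    measurable in general; completeness makes the conull set \<open>X\<close> measurable.\<close>
  have [measurable]: "X \<in> sets M"
  proof -
    obtain N where "{x \<in> space M. \<not> x \<in> X} \<subseteq> N" "N \<in> null_sets M"
      using AE_X by (auto elim!: AE_E simp: null_sets_def)
    then have "{x \<in> space M. \<not> x \<in> X} \<in> sets M"
      using complete2 by blast
    then have "space M - {x \<in> space M. \<not> x \<in> X} \<in> sets M"
      by (rule sets.compl_sets)
    then show ?thesis
      by (simp add: sp set_diff_eq)
  qed
  have X_inv: "a g x \<in> X" if g: "g \<in> carrier G" and x: "x \<in> X" for g x
  proof -
    have "good (a h (a g x))" if h: "h \<in> carrier G" for h
    proof -
      have "a (h \<otimes> g) x = a h (a g x)"
        using x g h by (auto simp: X_def good_def)
      moreover have "good (a (h \<otimes> g) x)"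
        using x g h by (auto simp: X_def)
      ultimately show ?thesis
        by simp
    qed
    then show ?thesis
      using x g by (auto simp: X_def)
  qed
  \<comment> \<open>Off the invariant conull set \<open>X\<close> everything is replaced by the
    trivial action with density 1.\<close>
  define act where "act g x = (if x \<in> X then a g x else x)" for g x
  define rho where "rho g x = (if x \<in> X then r g x else 1)" for g x
  have act_a: "AE x in M. act g x = a g x" for g
    using AE_X by eventually_elim (simp add: act_def)
  have rho_r: "AE x in M. rho g x = r g x" for g
    using AE_X by eventually_elim (simp add: rho_def)
  have act_meas [measurable]: "act g \<in> M \<rightarrow>\<^sub>M M" if "g \<in> carrier G" for g
    unfolding act_def[abs_def] using am[OF that] by (intro measurable_If_set) (auto simp: sp)
  have rho_meas [measurable]: "rho g \<in> borel_measurable M" for g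
    unfolding rho_def[abs_def] by measurable
  have goodX: "x \<in> X \<Longrightarrow> good x" for x
    by (simp add: X_def)
  have sys: "nonsingular_system G M act rho"
  proof (rule nonsingular_system.intro[OF G(1) prob_space_axioms], rule nonsingular_system_axioms.intro)
    show "act \<one> x = x" for x
      using goodX[of x] by (auto simp: act_def good_def)
    show "act (g \<otimes> h) x = act g (act h x)" if "g \<in> carrier G" "h \<in> carrier G" for g h x
      using goodX[of x] X_inv[of h x] that by (auto simp: act_def good_def)
    show "rho (g \<otimes> h) x = rho g x * rho h (act (inv g) x)" if "g \<in> carrier G" "h \<in> carrier G" for g h x
      using goodX[of x] X_inv[of "inv g" x] that by (auto simp: act_def rho_def good_def)
    show "0 < rho g x" if "g \<in> carrier G" for g x
      using goodX[of x] that by (auto simp: rho_def good_def)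
    show "distr M M (act g) = density M (\<lambda>x. ennreal (rho g x))" if g: "g \<in> carrier G" for g
    proof -
      have "distr M M (act g) = distr M M (a g)"
        using act_a g by (intro distr_cong_AE) auto
      also have "\<dots> = density M (\<lambda>x. ennreal (rho g x))"
        unfolding r_distr[OF g] using rho_r[of g] by (intro density_cong) auto
      finally show ?thesis .
    qed
  qed (use sp in auto)
  interpret S: nonsingular_system G M act rho
    by (rule sys)
  show ?thesis
  proof (rule that[OF sys act_a])
    show "AE x in M. rho g x = rn_real M (a g) x" for g
      using rho_r[of g] by (simp add: r_def)
    show "AE x in M. act (inv g) x = aut_inv M (a g) x" if g: "g \<in> carrier G" for g
    proof (rule ae_inverse_unique[OF aut[OF g] _ nonsingular_autD(2)[OF aut[OF g]]])
      have "AE x in M. act g (act (inv g) x) = a g (act (inv g) x)"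
        using g by (intro S.AE_act[OF _ act_a]) auto
      then have "AE x in M. a g (act (inv g) x) = x"
        by eventually_elim (use g in simp)
      moreover have "AE x in M. act (inv g) (a g x) = x"
        using act_a[of g] by eventually_elim (use g S.act_inv(1)[OF g] in metis)
      ultimately show "ae_inverse M (a g) (act (inv g))"
        using g by (simp add: ae_inverse_def act_meas)
    qed
  qed
qed

end

text \<open>The argument in abstract form: \<open>A\<close> is a part of the space on which the
  action is trivial, and \<open>E\<close> witnesses that the L-part \<open>pr g\<close> of some
  element does not preserve the measure.\<close>

lemma not_ergodic_dense:
  fixes G :: "('g, 'b) monoid_scheme" (structure) and M :: "'x measure" and I :: "'i set"
    and k :: "'i \<Rightarrow> 'f::{finite,field} \<Rightarrow> 'g"
  assumes G: "group G" "countable (carrier G)"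
    and M: "prob_space M" "space M = UNIV" "complete_measure M"
    and \<mu>: "finite (set_pmf \<mu>)" "generating G \<mu>"
    and pr: "\<And>g. g \<in> carrier G \<Longrightarrow> pr g \<in> carrier G"
      "\<And>g h. g \<in> carrier G \<Longrightarrow> h \<in> carrier G \<Longrightarrow> pr (g \<otimes> h) = pr g \<otimes> pr h"
      "\<And>g. g \<in> carrier G \<Longrightarrow> pr (pr g) = pr g"
      "\<And>g h. g \<in> carrier G \<Longrightarrow> h \<in> carrier G \<Longrightarrow> h \<otimes> (inv (pr g) \<otimes> g) = inv (pr g) \<otimes> g \<otimes> h"
    and I: "finite I" "I \<noteq> {}" "card I \<le> 5" and q: "CARD('f) \<ge> 100"
    and k: "\<And>i. i \<in> I \<Longrightarrow> group.one_param G (k i)"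
    and rel: "\<And>i j. i \<in> I \<Longrightarrow> j \<in> I \<Longrightarrow> i \<noteq> j \<Longrightarrow>
      (\<forall>c d. k i c \<otimes> k j d = k j d \<otimes> k i c) \<or> (\<exists>z. group.heis G (k i) (k j) z) \<or> (\<exists>z. group.heis G (k j) (k i) z)"
    and pr_gen: "pr ` carrier G \<subseteq> semigroup_generated G (\<Union>i\<in>I. range (k i))"
    and a: "a \<in> A_mu G \<mu> M"
    and A: "A \<in> sets M" "emeasure M A > 0" "\<And>g. g \<in> carrier G \<Longrightarrow> AE x in M. x \<in> A \<longrightarrow> a g x = x"
    and E: "E \<in> sets M" "g \<in> carrier G" "emeasure M (a (pr g) -` E) \<noteq> emeasure M E"
  shows "\<not> ergodic_dense G \<mu> M"
proof
  assume dense: "ergodic_dense G \<mu> M"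
  interpret G: group G by fact
  interpret prob_space M by fact
  have a_aut: "nonsingular_aut M (a h)" if "h \<in> carrier G" for h
    using a that by (auto simp: A_mu_def nonsingular_action_def)
  let ?s = "1 - sqrt (1 - 1 / (2 * real (card I)))"
  have n: "card I > 0"
    using I by (simp add: card_gt_0_iff)
  then have s: "0 < ?s"
    by simp
  have pA: "0 < prob A"
    using A(2) by (simp add: emeasure_eq_measure)
  \<comment> \<open>Chosen so that the square root of its half stays below
    \<open>prob A * ?s\<close>, as the lemma on almost invariant sets demands.\<close>
  define \<epsilon>1 where "\<epsilon>1 = (prob A * ?s)\<^sup>2"
  have \<epsilon>1: "0 < \<epsilon>1"
    using pA s by (simp add: \<epsilon>1_def)
  have "sqrt (\<epsilon>1 / 2) < sqrt \<epsilon>1"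
    using \<epsilon>1 by simp
  also have "\<dots> = prob A * ?s"
    using pA s by (simp add: \<epsilon>1_def)
  finally have \<epsilon>1_lt: "sqrt (\<epsilon>1 / 2) < prob A * ?s" .
  \<comment> \<open>The amount by which \<open>a (pr g)\<close> changes the measure of
    \<open>E\<close>; the nearby action will turn out not to change it at all.\<close>
  define \<epsilon>2 where "\<epsilon>2 = \<bar>prob (a (pr g) -` E) - prob E\<bar>"
  have \<epsilon>2: "0 < \<epsilon>2"
    using E(3) by (auto simp: \<epsilon>2_def emeasure_eq_measure)
  define F where "F = (\<Union>i\<in>I. range (k i)) \<union> {pr g}"
  have kG: "k i c \<in> carrier G" if "i \<in> I" for i c
    using G.one_paramD(1)[OF k[OF that]] .
  have F: "finite F" "F \<subseteq> carrier G"
    using I kG pr(1)[OF E(2)] by (auto simp: F_def)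
  have UN: "UNIV \<in> sets M"
    using sets.top[of M] M(2) by simp
  \<comment> \<open>Two test sets suffice: \<open>A\<close> makes its own indicator almost
    invariant, and \<open>UNIV\<close> controls the whole density, and with it the measure of the
    preimage of \<open>E\<close>.\<close>
  have *: "finite {A, UNIV}" "{A, UNIV} \<subseteq> sets M" "0 < min \<epsilon>1 \<epsilon>2"
    using A UN \<epsilon>1 \<epsilon>2 by auto
  obtain b where b: "b \<in> A_mu G \<mu> M" "ergodic_action G M b"
    and near: "\<And>h B. h \<in> F \<Longrightarrow> B \<in> {A, UNIV} \<Longrightarrow> weak_dist M (b h) (a h) B < ennreal (min \<epsilon>1 \<epsilon>2)"
    using dense[unfolded ergodic_dense_def, rule_format, OF a F *] by metis
  have b_act: "nonsingular_action G M b"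
    and b_st: "\<And>B. B \<in> sets M \<Longrightarrow> (\<integral>\<^sup>+h. emeasure (distr M M (b h)) B \<partial>measure_pmf \<mu>) = emeasure M B"
    using b by (auto simp: A_mu_def)
  have b_aut: "nonsingular_aut M (b h)" if "h \<in> carrier G" for h
    using b_act that by (auto simp: nonsingular_action_def)
  note bm [measurable] = nonsingular_autD(1)[OF b_aut]
  obtain act rho where sys: "nonsingular_system G M act rho"
    and act_b: "\<And>g. g \<in> carrier G \<Longrightarrow> AE x in M. act g x = b g x"
    and rho_b: "\<And>g. g \<in> carrier G \<Longrightarrow> AE x in M. rho g x = rn_real M (b g) x"
    and inv_b: "\<And>g. g \<in> carrier G \<Longrightarrow> AE x in M. act (inv g) x = aut_inv M (b g) x"
    by (rule strict_model[OF G M(2,3) b_act]) (rule that)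
  interpret S: nonsingular_system G M act rho
    by (rule sys)
  have distr_b: "distr M M (b h) = density M (\<lambda>x. ennreal (rho h x))" if "h \<in> carrier G" for h
  proof -
    have "distr M M (b h) = distr M M (act h)"
      using act_b[OF that] that by (intro distr_cong_AE) (auto simp: bm)
    then show ?thesis
      using S.distr_act[OF that] by simp
  qed
  have supp: "set_pmf \<mu> \<subseteq> carrier G"
    using \<mu>(2) by (simp add: generating_def)
  have st: "S.stationary \<mu>"
  proof -
    let ?w = "\<lambda>x. \<Sum>h\<in>set_pmf \<mu>. pmf \<mu> h * rho h x"
    have rm [measurable]: "rho h \<in> borel_measurable M" if "h \<in> set_pmf \<mu>" for h
      using that supp by auto
    have rho0: "0 \<le> rho h x" if "h \<in> set_pmf \<mu>" for h x
      using S.rho_pos[of h x] that supp by auto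
    have "density M (\<lambda>x. ennreal (?w x)) = density M (\<lambda>x. 1)"
    proof (rule measure_eqI)
      fix B assume "B \<in> sets (density M (\<lambda>x. ennreal (?w x)))"
      then have [measurable]: "B \<in> sets M"
        by simp
      have "emeasure (density M (\<lambda>x. ennreal (?w x))) B
          = (\<integral>\<^sup>+x. (\<Sum>h\<in>set_pmf \<mu>. ennreal (pmf \<mu> h) * (ennreal (rho h x) * indicator B x)) \<partial>M)"
      proof (subst emeasure_density)
        show "(\<lambda>x. ennreal (?w x)) \<in> borel_measurable M"
          by measurable
        show "(\<integral>\<^sup>+x. ennreal (?w x) * indicator B x \<partial>M)
          = (\<integral>\<^sup>+x. (\<Sum>h\<in>set_pmf \<mu>. ennreal (pmf \<mu> h) * (ennreal (rho h x) * indicator B x)) \<partial>M)"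
        proof (intro nn_integral_cong)
          fix x
          have "ennreal (?w x) = (\<Sum>h\<in>set_pmf \<mu>. ennreal (pmf \<mu> h * rho h x))"
            by (intro sum_ennreal[symmetric] mult_nonneg_nonneg rho0) auto
          also have "\<dots> = (\<Sum>h\<in>set_pmf \<mu>. ennreal (pmf \<mu> h) * ennreal (rho h x))"
            by (intro sum.cong refl ennreal_mult rho0) auto
          finally show "ennreal (?w x) * indicator B x
            = (\<Sum>h\<in>set_pmf \<mu>. ennreal (pmf \<mu> h) * (ennreal (rho h x) * indicator B x))"
            by (simp add: sum_distrib_right mult.assoc)
        qed
      qed simp
      also have "\<dots> = (\<Sum>h\<in>set_pmf \<mu>. ennreal (pmf \<mu> h) * (\<integral>\<^sup>+x. ennreal (rho h x) * indicator B x \<partial>M))"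
        by (subst nn_integral_sum) (auto intro!: sum.cong nn_integral_cmult)
      also have "\<dots> = (\<Sum>h\<in>set_pmf \<mu>. emeasure (distr M M (b h)) B * ennreal (pmf \<mu> h))"
      proof (intro sum.cong refl)
        fix h assume h: "h \<in> set_pmf \<mu>"
        then have "emeasure (distr M M (b h)) B = (\<integral>\<^sup>+x. ennreal (rho h x) * indicator B x \<partial>M)"
          using supp distr_b[of h] rm[OF h] by (auto simp: emeasure_density)
        then show "ennreal (pmf \<mu> h) * (\<integral>\<^sup>+x. ennreal (rho h x) * indicator B x \<partial>M)
            = emeasure (distr M M (b h)) B * ennreal (pmf \<mu> h)"
          by (simp add: mult.commute)
      qed
      also have "\<dots> = (\<integral>\<^sup>+h. emeasure (distr M M (b h)) B \<partial>measure_pmf \<mu>)"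
        by (simp add: nn_integral_measure_pmf_finite[OF \<mu>(1)])
      also have "\<dots> = emeasure M B"
        by (rule b_st) simp
      also have "\<dots> = emeasure (density M (\<lambda>x. 1)) B"
        by (simp add: emeasure_density)
      finally show "emeasure (density M (\<lambda>x. ennreal (?w x))) B = emeasure (density M (\<lambda>x. 1)) B" .
    qed simp
    then have "AE x in M. ennreal (?w x) = 1"
      by (rule density_unique[rotated 2]) simp_all
    then show ?thesis
      unfolding S.stationary_def by eventually_elim simp
  qed
  have erg: "S.ergodic"
    unfolding S.ergodic_def
  proof (intro ballI impI)
    fix B assume [measurable]: "B \<in> sets M" and inv: "\<forall>h\<in>carrier G. AE x in M. act h x \<in> B \<longleftrightarrow> x \<in> B"
    have "emeasure M (((b h -` B \<inter> space M) - B) \<union> (B - (b h -` B \<inter> space M))) = 0" if h: "h \<in> carrier G" for h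
    proof -
      define N where "N = ((b h -` B \<inter> space M) - B) \<union> (B - (b h -` B \<inter> space M))"
      have N: "N \<in> sets M"
        unfolding N_def by (intro sets.Un sets.Diff measurable_sets[OF bm[OF h]] \<open>B \<in> sets M\<close>)
      have "AE x in M. b h x \<in> B \<longleftrightarrow> x \<in> B"
        using inv[rule_format, OF h] act_b[OF h] by eventually_elim simp
      then have "AE x in M. x \<notin> N"
        by eventually_elim (auto simp: M(2) N_def)
      then have "emeasure M N = 0"
        using AE_iff_measurable[OF N, of "\<lambda>x. x \<notin> N"] by (simp add: M(2))
      then show ?thesis
        by (simp only: N_def)
    qed
    then have "emeasure M B = 0 \<or> emeasure M (space M - B) = 0"
      using b(2) by (auto simp: ergodic_action_def)
    then show "(AE x in M. x \<notin> B) \<or> (AE x in M. x \<in> B)"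
    proof
      assume "emeasure M B = 0"
      then show ?thesis
        by (intro disjI1 AE_not_in) (auto simp: null_sets_def)
    next
      assume "emeasure M (space M - B) = 0"
      moreover have "space M - B \<in> sets M"
        by (rule sets.compl_sets) fact
      ultimately have "AE x in M. x \<notin> space M - B"
        by (intro AE_not_in null_setsI)
      then show ?thesis
        by (auto simp: M(2))
    qed
  qed
  have U_b: "AE x in M. U_ind M (b h) B x = rho h x * indicator B (act (inv h) x)" if h: "h \<in> carrier G" for h B
    using rho_b[OF h] inv_b[OF h] by eventually_elim (simp add: U_ind_def)
  \<comment> \<open>The constant 1/8 serves for every pair, since commuting subgroups even give a
    nonnegative inner product.\<close>
  have pair: "2 * ip2 (S.kp.defect (k i) v) (S.kp.defect (k j) v)
      \<ge> - (1/8) * (ip2 (S.kp.defect (k i) v) (S.kp.defect (k i) v) + ip2 (S.kp.defect (k j) v) (S.kp.defect (k j) v))"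
    if ij: "i \<in> I" "j \<in> I" "i \<noteq> j" and v: "v \<in> L2" for i j v
  proof -
    have V: "S.kp.defect (k i) v \<in> L2" "S.kp.defect (k j) v \<in> L2"
      using S.kp.defect_V[OF k v] ij by auto
    consider "\<forall>c d. k i c \<otimes> k j d = k j d \<otimes> k i c" | z where "G.heis (k i) (k j) z" | z where "G.heis (k j) (k i) z"
      using rel[OF ij] by blast
    then show ?thesis
    proof cases
      case 1
      then have "0 \<le> ip2 (S.kp.defect (k i) v) (S.kp.defect (k j) v)"
        using ij v k by (intro S.kp.ip_defect_commuting S.kp.avg_avg_comm) auto
      moreover have "0 \<le> ip2 (S.kp.defect (k i) v) (S.kp.defect (k i) v)"
          "0 \<le> ip2 (S.kp.defect (k j) v) (S.kp.defect (k j) v)"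
        using V by (auto intro: S.kp.ip_nonneg)
      ultimately show ?thesis
        by argo
    next
      case 2
      then show ?thesis
        by (rule S.kp.ip_defect_heis[OF _ q v])
    next
      case 3
      then show ?thesis
        using S.kp.ip_defect_heis[OF 3 q v] S.kp.ip_sym[OF V] by (simp add: add.commute)
    qed
  qed
  have k_near: "(\<integral>\<^sup>+x. ennreal \<bar>rho (k i c) x * indicator A (act (inv (k i c)) x) - indicator A x\<bar> \<partial>M) \<le> ennreal \<epsilon>1"
    if i: "i \<in> I" for i c
  proof -
    have "AE x in M. U_ind M (a (k i c)) A x = indicator A x"
      using A kG[OF i] by (intro U_ind_trivial a_aut) auto
    then have "(\<integral>\<^sup>+x. ennreal \<bar>rho (k i c) x * indicator A (act (inv (k i c)) x) - indicator A x\<bar> \<partial>M)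
        = weak_dist M (b (k i c)) (a (k i c)) A"
      unfolding weak_dist_def using U_b[OF kG[OF i, of c], of A]
      by (intro nn_integral_cong_AE, eventually_elim) simp
    also have "\<dots> \<le> ennreal (min \<epsilon>1 \<epsilon>2)"
      using i by (intro less_imp_le near) (auto simp: F_def)
    also have "\<dots> \<le> ennreal \<epsilon>1"
      by (intro ennreal_leI) simp
    finally show ?thesis .
  qed
  have pr': "S.central (inv (pr h) \<otimes> h)" if "h \<in> carrier G" for h
    using that pr(1,4) by (auto simp: S.central_def)
  have "AE x in M. rho (pr g) x = 1"
  proof (rule S.measure_preserving_of_almost_invariant_set[OF \<mu> st erg G(2) pr(1,2,3) pr' I(1,2) k pair
        _ _ pr_gen A(1) k_near _ _ E(2)])
    show "2 * real (card I - 1) * (1/8) \<le> 1"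
      using I by simp
    show "sqrt (\<epsilon>1 / 2) < prob A * (1 - sqrt (1 - 1 / real (2 * card I)))"
      using \<epsilon>1_lt by simp
  qed (use \<epsilon>1 in simp_all)
  let ?h = "pr g"
  have hG: "?h \<in> carrier G"
    using pr(1) E by simp
  note [measurable] = bm[OF hG] nonsingular_autD(1)[OF a_aut[OF hG]] E(1)
    U_ind_measurable[OF a_aut[OF hG] UN] U_ind_measurable[OF b_aut[OF hG] UN]
  have "distr M M (b ?h) = density M (\<lambda>x. 1)"
    unfolding distr_b[OF hG] using \<open>AE x in M. rho (pr g) x = 1\<close> hG
    by (intro density_cong) (auto elim: eventually_mono)
  then have "emeasure (distr M M (b ?h)) E = emeasure M E"
    by (simp add: emeasure_density)
  then have mb: "emeasure M (b ?h -` E) = emeasure M E"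
    by (simp add: emeasure_distr M(2))
  have Ua: "(\<integral>\<^sup>+x. ennreal (U_ind M (a ?h) UNIV x) * indicator E x \<partial>M) = emeasure M (a ?h -` E)"
    using nn_integral_U_ind[OF a_aut[OF hG] UN E(1)] by (simp add: M(2))
  have Ub: "(\<integral>\<^sup>+x. ennreal (U_ind M (b ?h) UNIV x) * indicator E x \<partial>M) = emeasure M E"
    using nn_integral_U_ind[OF b_aut[OF hG] UN E(1)] by (simp add: M(2) mb)
  let ?d = "weak_dist M (b ?h) (a ?h) UNIV"
  have d: "?d < ennreal \<epsilon>2"
    by (rule order.strict_trans2[OF near ennreal_leI]) (auto simp: F_def)
  \<comment> \<open>The integral over \<open>E\<close> of the density for \<open>UNIV\<close> is the
    measure of the preimage of \<open>E\<close>, so an L1 bound between two such densities bounds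
    the difference of the two measures.\<close>
  have tri: "(\<integral>\<^sup>+x. ennreal (u x) * indicator E x \<partial>M)
      \<le> (\<integral>\<^sup>+x. ennreal (w x) * indicator E x \<partial>M) + (\<integral>\<^sup>+x. ennreal \<bar>u x - w x\<bar> \<partial>M)"
    if [measurable]: "u \<in> borel_measurable M" "w \<in> borel_measurable M" and w: "\<And>x. 0 \<le> w x" for u w :: "'x \<Rightarrow> real"
  proof -
    have "ennreal (u x) \<le> ennreal (w x) + ennreal \<bar>u x - w x\<bar>" for x
    proof -
      have "ennreal (u x) \<le> ennreal (w x + \<bar>u x - w x\<bar>)"
        by (rule ennreal_leI) simp
      then show ?thesis
        using w[of x] by simp
    qed
    then have "(\<integral>\<^sup>+x. ennreal (u x) * indicator E x \<partial>M)
        \<le> (\<integral>\<^sup>+x. ennreal (w x) * indicator E x + ennreal \<bar>u x - w x\<bar> \<partial>M)"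
      by (intro nn_integral_mono) (auto simp: indicator_def)
    then show ?thesis
      by (simp add: nn_integral_add)
  qed
  have U0: "0 \<le> U_ind M T UNIV x" for T x
    by (simp add: U_ind_def)
  have "emeasure M (a ?h -` E) \<le> emeasure M E + ?d"
    using tri[of "U_ind M (a ?h) UNIV" "U_ind M (b ?h) UNIV"]
    by (simp add: Ua Ub U0 weak_dist_def abs_minus_commute)
  moreover have "emeasure M E \<le> emeasure M (a ?h -` E) + ?d"
    using tri[of "U_ind M (b ?h) UNIV" "U_ind M (a ?h) UNIV"]
    by (simp add: Ua Ub U0 weak_dist_def)
  moreover obtain r where "?d = ennreal r" "0 \<le> r" "r < \<epsilon>2"
    using d by (cases ?d) (auto simp: ennreal_less_iff)
  ultimately show False
    by (simp add: emeasure_eq_measure ennreal_plus[symmetric] \<epsilon>2_def del: ennreal_plus)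
qed

section \<open>Isomorphisms modulo null sets\<close>

text \<open>Base 4 rather than base 2, so that the expansion of a bit sequence is unique.\<close>

definition real_of_bits :: "(nat \<Rightarrow> bool) \<Rightarrow> real" where
  "real_of_bits \<beta> = (\<Sum>j. of_bool (\<beta> j) / 4 ^ Suc j)"

text \<open>Parity reads off the digit: on a value of \<open>real_of_bits\<close> the floor is a
  multiple of 4 plus the digit 0 or 1.\<close>

definition bit_of_real :: "real \<Rightarrow> nat \<Rightarrow> bool" where
  "bit_of_real r k \<longleftrightarrow> odd \<lfloor>4 ^ Suc k * r\<rfloor>"

lemma summable_bits: "summable (\<lambda>j. of_bool (\<beta> j) / (4::real) ^ Suc j)"
proof (rule summable_comparison_test')
  show "summable (\<lambda>j. (1 / 4 :: real) ^ j)"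
    by (intro summable_geometric) simp
  show "norm (of_bool (\<beta> j) / (4::real) ^ Suc j) \<le> (1 / 4) ^ j" for j
    by (simp add: power_one_over field_simps)
qed

lemma real_of_bits_nonneg: "0 \<le> real_of_bits \<beta>"
  unfolding real_of_bits_def by (intro suminf_nonneg summable_bits) simp

lemma real_of_bits_less_one: "real_of_bits \<beta> < 1"
proof -
  have g: "(\<lambda>j. (1 / 4) * (1 / 4 :: real) ^ j) sums ((1 / 4) * (1 / (1 - 1 / 4)))"
    by (intro sums_mult geometric_sums) simp
  have "real_of_bits \<beta> \<le> (\<Sum>j. (1 / 4) * (1 / 4 :: real) ^ j)"
    unfolding real_of_bits_def
    by (intro suminf_le summable_bits sums_summable[OF g]) (simp add: power_one_over)
  also have "\<dots> < 1"
    using sums_unique[OF g] by simp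
  finally show ?thesis .
qed

lemma real_of_bits_Suc: "4 * real_of_bits \<beta> = of_bool (\<beta> 0) + real_of_bits (\<lambda>j. \<beta> (Suc j))"
proof -
  have "real_of_bits \<beta> = of_bool (\<beta> 0) / 4 + (\<Sum>j. of_bool (\<beta> (Suc j)) / (4::real) ^ Suc (Suc j))"
    unfolding real_of_bits_def using suminf_split_head[OF summable_bits[of \<beta>]] by simp
  also have "(\<Sum>j. of_bool (\<beta> (Suc j)) / (4::real) ^ Suc (Suc j))
      = (\<Sum>j. (of_bool (\<beta> (Suc j)) / (4::real) ^ Suc j) / 4)"
    by (simp add: field_simps)
  also have "\<dots> = real_of_bits (\<lambda>j. \<beta> (Suc j)) / 4"
    unfolding real_of_bits_def by (rule suminf_divide[OF summable_bits])
  finally show ?thesis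
    by simp
qed

lemma bit_of_real_of_bits: "bit_of_real (real_of_bits \<beta>) k = \<beta> k"
proof -
  \<comment> \<open>Each factor 4 moves one digit in front of the point, and the remaining tail is
    below 1. At \<open>k = 0\<close> no digit has been moved yet, hence the guard
    \<open>k > 0\<close>.\<close>
  have "\<exists>m::int. 4 ^ k * real_of_bits \<beta> = 4 * of_int m + of_bool (k > 0 \<and> \<beta> (k - 1)) + real_of_bits (\<lambda>j. \<beta> (j + k))" for k
  proof (induction k)
    case 0
    show ?case
      by (rule exI[of _ 0]) simp
  next
    case (Suc k)
    then obtain m :: int where m: "4 ^ k * real_of_bits \<beta>
        = 4 * of_int m + of_bool (k > 0 \<and> \<beta> (k - 1)) + real_of_bits (\<lambda>j. \<beta> (j + k))" ..
    have "4 ^ Suc k * real_of_bits \<beta> = 4 * (4 ^ k * real_of_bits \<beta>)"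
      by simp
    also have "\<dots> = 4 * of_int (4 * m + of_bool (k > 0 \<and> \<beta> (k - 1))) + 4 * real_of_bits (\<lambda>j. \<beta> (j + k))"
      unfolding m by simp
    also have "4 * real_of_bits (\<lambda>j. \<beta> (j + k)) = of_bool (\<beta> k) + real_of_bits (\<lambda>j. \<beta> (j + Suc k))"
      using real_of_bits_Suc[of "\<lambda>j. \<beta> (j + k)"] by simp
    finally show ?case
      by (intro exI[of _ "4 * m + of_bool (k > 0 \<and> \<beta> (k - 1))"]) (simp add: add.assoc)
  qed
  from this[of "Suc k"] obtain m :: int where m: "4 ^ Suc k * real_of_bits \<beta>
      = of_int (4 * m + of_bool (\<beta> k)) + real_of_bits (\<lambda>j. \<beta> (j + Suc k))"
    by auto
  have "\<lfloor>4 ^ Suc k * real_of_bits \<beta>\<rfloor> = 4 * m + of_bool (\<beta> k)"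
    using real_of_bits_nonneg[of "\<lambda>j. \<beta> (j + Suc k)"] real_of_bits_less_one[of "\<lambda>j. \<beta> (j + Suc k)"]
    unfolding m by (intro floor_unique) auto
  then show ?thesis
    by (simp add: bit_of_real_def)
qed

lemma bit_of_real_measurable [measurable]: "(\<lambda>r. bit_of_real r k) \<in> borel \<rightarrow>\<^sub>M count_space UNIV"
  unfolding bit_of_real_def by measurable

lemma real_of_bits_measurable:
  assumes [measurable]: "\<And>k. Measurable.pred M (b k)"
  shows "(\<lambda>x. real_of_bits (\<lambda>k. b k x)) \<in> borel_measurable M"
  unfolding real_of_bits_def by measurable

section \<open>Nonatomic spaces and the unit interval\<close>

definition unit_interval :: "real measure" where
  "unit_interval = distr (restrict_space lborel {0<..<1}) borel (\<lambda>u. u)"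

text \<open>\<open>Q\<close> is the generalized inverse of the distribution function. Without atoms
  that function is continuous, so it inverts \<open>Q\<close> exactly on the open unit interval and
  carries \<open>L\<close> to the uniform measure.\<close>

lemma quantile:
  assumes "real_distribution L" and atomless: "\<And>r. measure L {r} = 0"
  obtains Q where "Q \<in> borel_measurable borel" "distr L borel (cdf L) = unit_interval"
    "AE r in L. Q (cdf L r) = r"
proof -
  interpret L: real_distribution L by fact
  interpret L: cdf_distribution L
    by unfold_locales
  let ?U = "restrict_space lborel {0<..<1::real}"
  define Q where "Q u = indicator {0<..<1} u *\<^sub>R L.I u" for u
  have Q [measurable]: "Q \<in> borel_measurable borel"
    using L.measurable_CI unfolding Q_def by (subst (asm) borel_measurable_restrict_space_iff) auto
  have C [measurable]: "cdf L \<in> borel_measurable borel"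
    by (rule L.measurable_C)
  have L_eq: "L = distr ?U borel Q"
    by (subst L.distr_I_eq_M[symmetric], rule distr_cong)
      (auto simp: Q_def space_restrict_space)
  have CQ: "cdf L (Q u) = u" if u: "u \<in> {0<..<1}" for u
  proof (rule antisym)
    have Qu: "Q u = L.I u"
      using u by (simp add: Q_def)
    have pinv: "u \<le> cdf L x \<longleftrightarrow> Q u \<le> x" for x
      using L.pseudoinverse[of u x] u Qu by auto
    show "u \<le> cdf L (Q u)"
      using pinv by simp
    \<comment> \<open>To the left of \<open>Q u\<close> the distribution function is at most
      \<open>u\<close>; continuity extends the bound to \<open>Q u\<close> itself.\<close>
    have "isCont (cdf L) (Q u)"
      using atomless by (simp add: L.isCont_cdf)
    then have "(cdf L \<longlongrightarrow> cdf L (Q u)) (at_left (Q u))"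
      using continuous_within by (metis filterlim_at_split isCont_def)
    moreover have "\<forall>\<^sub>F x in at_left (Q u). x < Q u"
      by (simp add: eventually_at_filter)
    then have "\<forall>\<^sub>F x in at_left (Q u). cdf L x \<le> u"
      by eventually_elim (meson pinv linear not_le)
    ultimately show "cdf L (Q u) \<le> u"
      by (rule tendsto_upperbound) simp
  qed
  have "distr L borel (cdf L) = distr (distr ?U borel Q) borel (cdf L)"
    using L_eq by simp
  also have "\<dots> = distr ?U borel (\<lambda>u. cdf L (Q u))"
    by (subst distr_distr) (auto simp: o_def measurable_restrict_space1)
  also have "\<dots> = unit_interval"
    unfolding unit_interval_def by (rule distr_cong) (auto simp: CQ space_restrict_space)
  finally have D: "distr L borel (cdf L) = unit_interval" .
  have "AE r in distr ?U borel Q. Q (cdf L r) = r"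
    by (subst AE_distr_iff) (auto simp: measurable_restrict_space1 CQ space_restrict_space AE_restrict_space_iff)
  then have "AE r in L. Q (cdf L r) = r"
    by (simp only: L_eq[symmetric])
  then show ?thesis
    by (rule that[OF Q D])
qed

text \<open>A substitute for being standard Borel: the bits embed the space into the reals, and
  \<open>dec\<close> returns a point measurably from every real, whether or not it codes
  one.\<close>

definition bit_coded :: "'a measure \<Rightarrow> (nat \<Rightarrow> 'a \<Rightarrow> bool) \<Rightarrow> ((nat \<Rightarrow> bool) \<Rightarrow> 'a) \<Rightarrow> bool" where
  "bit_coded M b dec \<longleftrightarrow> (\<forall>k. Measurable.pred M (b k)) \<and> (\<lambda>r. dec (bit_of_real r)) \<in> borel \<rightarrow>\<^sub>M M
     \<and> (\<forall>x\<in>space M. dec (\<lambda>k. b k x) = x)"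

text \<open>Push the measure to the line by \<open>real_of_bits\<close> and then to the unit
  interval by the distribution function; since points are null, the image on the line has no
  atoms.\<close>

lemma uniformize:
  assumes M: "prob_space M" and code: "bit_coded M b dec"
    and atomless: "\<And>x. x \<in> space M \<Longrightarrow> {x} \<in> null_sets M"
  obtains \<psi> \<theta> where "\<psi> \<in> borel_measurable M" "\<theta> \<in> borel \<rightarrow>\<^sub>M M" "distr M borel \<psi> = unit_interval"
    "AE x in M. \<theta> (\<psi> x) = x"
proof -
  interpret prob_space M by fact
  have b [measurable]: "Measurable.pred M (b k)" for k
    using code by (auto simp: bit_coded_def)
  have dec [measurable]: "(\<lambda>r. dec (bit_of_real r)) \<in> borel \<rightarrow>\<^sub>M M"
    using code by (auto simp: bit_coded_def)
  have inv: "dec (\<lambda>k. b k x) = x" if "x \<in> space M" for x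
    using code that by (auto simp: bit_coded_def)
  define \<phi> where "\<phi> x = real_of_bits (\<lambda>k. b k x)" for x
  have [measurable]: "\<phi> \<in> borel_measurable M"
    unfolding \<phi>_def by (rule real_of_bits_measurable) simp
  have dec_\<phi>: "dec (bit_of_real (\<phi> x)) = x" if "x \<in> space M" for x
    using inv[OF that] by (simp add: \<phi>_def bit_of_real_of_bits[abs_def])
  define L where "L = distr M borel \<phi>"
  have [measurable_cong]: "sets L = sets borel"
    by (simp add: L_def)
  have rd: "real_distribution L"
    unfolding L_def by (rule real_distribution_distr) simp
  have "measure L {r} = 0" for r
  proof -
    have "\<phi> -` {r} \<inter> space M \<subseteq> {dec (bit_of_real r)} \<inter> space M"
      using dec_\<phi> by auto
    moreover have "{dec (bit_of_real r)} \<inter> space M \<in> null_sets M"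
      using atomless[of "dec (bit_of_real r)"] by (cases "dec (bit_of_real r) \<in> space M") auto
    ultimately have "\<phi> -` {r} \<inter> space M \<in> null_sets M"
      by (rule null_sets_subset[rotated 2]) simp
    then have "measure M (\<phi> -` {r} \<inter> space M) = 0"
      by (rule measure_eq_0_null_sets)
    then show ?thesis
      unfolding L_def by (subst measure_distr) simp_all
  qed
  then obtain Q where Q [measurable]: "Q \<in> borel_measurable borel"
    and D: "distr L borel (cdf L) = unit_interval" and QC: "AE r in L. Q (cdf L r) = r"
    using quantile[OF rd] by blast
  interpret L: real_distribution L by fact
  interpret L: cdf_distribution L
    by unfold_locales
  have C [measurable]: "cdf L \<in> borel_measurable borel"
    by (rule L.measurable_C)
  show ?thesis
  proof (rule that[of "\<lambda>x. cdf L (\<phi> x)" "\<lambda>u. dec (bit_of_real (Q u))"])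
    show "distr M borel (\<lambda>x. cdf L (\<phi> x)) = unit_interval"
      using distr_distr[of "cdf L" borel borel \<phi> M] D by (simp add: L_def[symmetric] o_def)
    have "AE r in distr M borel \<phi>. Q (cdf L r) = r"
      using QC by (simp only: L_def[symmetric])
    then have "AE x in M. Q (cdf L (\<phi> x)) = \<phi> x"
      by (rule AE_distrD[rotated]) simp
    then show "AE x in M. dec (bit_of_real (Q (cdf L (\<phi> x)))) = x"
      using AE_space by eventually_elim (simp add: dec_\<phi>)
    show "(\<lambda>u. dec (bit_of_real (Q u))) \<in> borel \<rightarrow>\<^sub>M M"
      using measurable_compose[OF Q dec] by simp
  qed simp
qed

text \<open>The classical isomorphism theorem for nonatomic standard probability spaces, obtained by
  composing through the unit interval.\<close>

lemma isomorphic_mod_null: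
  fixes M :: "'a measure" and M' :: "'c measure"
  assumes M: "prob_space M" "bit_coded M b dec" "\<And>x. x \<in> space M \<Longrightarrow> {x} \<in> null_sets M"
    and M': "prob_space M'" "bit_coded M' b' dec'" "\<And>x. x \<in> space M' \<Longrightarrow> {x} \<in> null_sets M'"
  obtains p q where "p \<in> M \<rightarrow>\<^sub>M M'" "q \<in> M' \<rightarrow>\<^sub>M M" "distr M M' p = M'" "distr M' M q = M"
    "AE x in M. q (p x) = x" "AE y in M'. p (q y) = y"
proof -
  \<comment> \<open>Stated for two arbitrary spaces because it is used in both directions.\<close>
  have half: "distr M M' (\<lambda>x. \<theta>' (\<psi> x)) = M'" "AE x in M. \<psi>' (\<theta>' (\<psi> x)) = \<psi> x"
    if [measurable]: "\<psi> \<in> borel_measurable M" and \<psi>: "distr M borel \<psi> = unit_interval"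
      and [measurable]: "\<psi>' \<in> borel_measurable M'" "\<theta>' \<in> borel \<rightarrow>\<^sub>M M'"
      and \<psi>': "distr M' borel \<psi>' = unit_interval" "AE x in M'. \<theta>' (\<psi>' x) = x"
    for M :: "'d measure" and M' :: "'e measure" and \<psi> \<psi>' \<theta>'
  proof -
    have "distr M M' (\<lambda>x. \<theta>' (\<psi> x)) = distr (distr M borel \<psi>) M' \<theta>'"
      by (simp add: distr_distr o_def)
    also have "\<dots> = distr M' M' (\<lambda>x. \<theta>' (\<psi>' x))"
      unfolding \<psi> \<psi>'(1)[symmetric] by (simp add: distr_distr o_def)
    also have "\<dots> = distr M' M' (\<lambda>x. x)"
      using \<psi>'(2) by (intro distr_cong_AE) auto
    finally show "distr M M' (\<lambda>x. \<theta>' (\<psi> x)) = M'"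
      by simp
    have "AE x in M'. \<psi>' (\<theta>' (\<psi>' x)) = \<psi>' x"
      using \<psi>'(2) by eventually_elim simp
    moreover have "{u \<in> space borel. \<psi>' (\<theta>' u) = u} \<in> sets borel"
      by measurable
    ultimately have "AE u in distr M' borel \<psi>'. \<psi>' (\<theta>' u) = u"
      by (simp add: AE_distr_iff)
    then have "AE u in distr M borel \<psi>. \<psi>' (\<theta>' u) = u"
      unfolding \<psi> \<psi>'(1) .
    then show "AE x in M. \<psi>' (\<theta>' (\<psi> x)) = \<psi> x"
      by (rule AE_distrD[rotated]) simp
  qed
  obtain \<psi> \<theta> where 1: "\<psi> \<in> borel_measurable M" "distr M borel \<psi> = unit_interval" "\<theta> \<in> borel \<rightarrow>\<^sub>M M"
    "AE x in M. \<theta> (\<psi> x) = x"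
    using uniformize[OF M] by blast
  obtain \<psi>' \<theta>' where 2: "\<psi>' \<in> borel_measurable M'" "distr M' borel \<psi>' = unit_interval" "\<theta>' \<in> borel \<rightarrow>\<^sub>M M'"
    "AE x in M'. \<theta>' (\<psi>' x) = x"
    using uniformize[OF M'] by blast
  note [measurable] = 1(1,3) 2(1,3)
  note h1 = half[OF 1(1,2) 2(1,3,2,4)] and h2 = half[OF 2(1,2) 1(1,3,2,4)]
  show ?thesis
  proof (rule that[of "\<lambda>x. \<theta>' (\<psi> x)" "\<lambda>y. \<theta> (\<psi>' y)"])
    show "AE x in M. \<theta> (\<psi>' (\<theta>' (\<psi> x))) = x"
      using h1(2) 1(4) by eventually_elim simp
    show "AE y in M'. \<theta>' (\<psi> (\<theta> (\<psi>' y))) = y"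
      using h2(2) 2(4) by eventually_elim simp
  qed (use h1(1) h2(1) in simp_all)
qed

text \<open>Bit (n, i) records whether the point is within 2^-n of the i-th point of a countable
  dense set. Taking the least such i for each n gives a sequence converging to the point.\<close>

lemma polish_bit_coded:
  fixes N :: "'a::polish_space measure"
  assumes N: "sets N = sets borel"
  obtains b dec where "bit_coded N b dec"
proof -
  note [measurable_cong] = N
  obtain D :: "'a set" where D: "countable D" "\<And>X. open X \<Longrightarrow> X \<noteq> {} \<Longrightarrow> \<exists>d\<in>D. d \<in> X"
    by (rule countable_dense_setE) blast
  have "D \<noteq> {}"
    using D(2)[of UNIV] by auto
  define d where "d = from_nat_into D"
  have dense: "\<exists>i. dist x (d i) < e" if "0 < e" for x e
  proof -
    have "ball x e \<noteq> {}"
      using that by simp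
    then obtain y where "y \<in> D" "y \<in> ball x e"
      using D(2)[OF open_ball] by blast
    then show ?thesis
      using from_nat_into_surj[OF D(1)] by (metis d_def mem_ball)
  qed
  define b where "b k x = (case prod_decode k of (n, i) \<Rightarrow> dist x (d i) < 1 / 2 ^ n)" for k x
  define g where "g \<beta> n = d (LEAST i. \<beta> (prod_encode (n, i)))" for \<beta> :: "nat \<Rightarrow> bool" and n
  \<comment> \<open>The constant \<open>d 0\<close> replaces sequences that are not Cauchy, so that
    the limit exists, and is measurable, for every input.\<close>
  define dec where "dec \<beta> = lim (\<lambda>n. if Cauchy (g \<beta>) then g \<beta> n else d 0)" for \<beta>
  have conv: "convergent (\<lambda>n. if Cauchy (g \<beta>) then g \<beta> n else d 0)" for \<beta>
    by (cases "Cauchy (g \<beta>)") (simp_all add: Cauchy_convergent convergent_const)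
  have g [measurable]: "(\<lambda>r. g (bit_of_real r) n) \<in> borel_measurable borel" for n
    unfolding g_def by measurable
  have "bit_coded N b dec"
    unfolding bit_coded_def
  proof (intro conjI allI ballI)
    show "Measurable.pred N (b k)" for k
      unfolding b_def by (cases "prod_decode k") simp
    show "(\<lambda>r. dec (bit_of_real r)) \<in> borel \<rightarrow>\<^sub>M N"
    proof -
      have [measurable]: "Measurable.pred borel (\<lambda>r. Cauchy (g (bit_of_real r)))"
        using sets_Collect_Cauchy[OF g] by (simp add: pred_def)
      have "(\<lambda>r. dec (bit_of_real r)) \<in> borel_measurable borel"
      proof (rule borel_measurable_LIMSEQ_metric)
        show "(\<lambda>r. if Cauchy (g (bit_of_real r)) then g (bit_of_real r) n else d 0) \<in> borel_measurable borel" for n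
          by (intro measurable_If g) simp_all
        show "(\<lambda>n. if Cauchy (g (bit_of_real r)) then g (bit_of_real r) n else d 0) \<longlonglongrightarrow> dec (bit_of_real r)" for r
          using conv[of "bit_of_real r"] unfolding dec_def by (simp add: convergent_LIMSEQ_iff)
      qed
      then show ?thesis
        by (simp add: measurable_cong_sets[OF refl N])
    qed
    show "dec (\<lambda>k. b k x) = x" for x
    proof -
      let ?\<beta> = "\<lambda>k. b k x"
      have close: "dist x (g ?\<beta> n) < 1 / 2 ^ n" for n
      proof -
        have "\<exists>i. ?\<beta> (prod_encode (n, i))"
          using dense[of "1 / 2 ^ n" x] by (simp add: b_def)
        then have "?\<beta> (prod_encode (n, LEAST i. ?\<beta> (prod_encode (n, i))))"
          by (rule LeastI_ex)
        then show ?thesis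
          by (simp add: b_def g_def)
      qed
      have "(\<lambda>n. dist (g ?\<beta> n) x) \<longlonglongrightarrow> 0"
      proof (rule tendsto_sandwich[OF _ _ tendsto_const])
        show "(\<lambda>n. 1 / 2 ^ n :: real) \<longlonglongrightarrow> 0"
          using LIMSEQ_power_zero[of "1 / 2 :: real"] by (simp add: power_one_over)
      qed (auto intro!: always_eventually less_imp_le[OF close] simp: dist_commute)
      then have lim: "g ?\<beta> \<longlonglongrightarrow> x"
        by (subst tendsto_dist_iff)
      then have "Cauchy (g ?\<beta>)"
        by (rule LIMSEQ_imp_Cauchy)
      then show ?thesis
        using lim by (simp add: dec_def limI)
    qed
  qed
  then show ?thesis
    by (rule that)
qed

section \<open>Groups mapping onto the integers\<close>

text \<open>Let the group act diagonally on l2 by the characters cis (tau(g) / (n + 1)). They tend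
  to the trivial character, so basis vectors are almost invariant; but \<open>t\<close> multiplies
  coordinate n by cis (1 / (n + 1)), which is not 1 because 0 < 1 / (n + 1) < pi.\<close>

lemma not_kazhdan_T_of_hom_int:
  fixes G :: "('g, 'b) monoid_scheme" (structure) and \<tau> :: "'g \<Rightarrow> int"
  assumes G: "group G" and hom: "\<And>g h. g \<in> carrier G \<Longrightarrow> h \<in> carrier G \<Longrightarrow> \<tau> (g \<otimes> h) = \<tau> g + \<tau> h"
    and t: "t \<in> carrier G" "\<tau> t = 1"
  shows "\<not> kazhdan_T G"
proof
  assume T: "kazhdan_T G"
  interpret group G by fact
  define w where "w n g = cis (of_int (\<tau> g) / real (Suc n))" for n g
  define \<pi> where "\<pi> g f n = w n g * f n" for g n and f :: "nat \<Rightarrow> complex"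
  have one: "\<tau> \<one> = 0"
    using hom[of \<one> \<one>] by simp
  have w_mult: "w n (g \<otimes> h) = w n g * w n h" if "g \<in> carrier G" "h \<in> carrier G" for g h n
    using that by (simp add: w_def hom cis_mult add_divide_distrib)
  have w_one: "w n \<one> = 1" for n
    by (simp add: w_def one)
  have w_inv: "w n g * w n (inv g) = 1" if "g \<in> carrier G" for g n
    using w_mult[of g "inv g" n] that by (simp add: w_one)
  have cmod_w: "cmod (w n g) = 1" for n g
    by (simp add: w_def)
  have w_cnj: "w n g * cnj (w n g) = 1" for n g
    by (simp add: complex_norm_square[symmetric] cmod_w)
  have l2I: "f \<in> l2 \<longleftrightarrow> summable (\<lambda>n. (cmod (f n))\<^sup>2)" for f
    by (simp add: l2_def)
  have sub: "closed_subspace_l2 l2"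
    unfolding closed_subspace_l2_def
  proof (intro conjI ballI allI impI)
    show "(\<lambda>n. f n + g n) \<in> l2" if "f \<in> l2" "g \<in> l2" for f g
      unfolding l2I
    proof (rule summable_comparison_test')
      show "summable (\<lambda>n. 2 * (cmod (f n))\<^sup>2 + 2 * (cmod (g n))\<^sup>2)"
        using that by (intro summable_add summable_mult) (auto simp: l2I)
      show "norm ((cmod (f n + g n))\<^sup>2) \<le> 2 * (cmod (f n))\<^sup>2 + 2 * (cmod (g n))\<^sup>2" for n
      proof -
        have "(cmod (f n + g n))\<^sup>2 \<le> (cmod (f n) + cmod (g n))\<^sup>2"
          by (intro power_mono norm_triangle_ineq) simp
        also have "\<dots> \<le> 2 * (cmod (f n))\<^sup>2 + 2 * (cmod (g n))\<^sup>2"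
          using sum_squares_bound[of "cmod (f n)" "cmod (g n)"] by (simp add: power2_sum)
        finally show ?thesis
          by simp
      qed
    qed
    show "(\<lambda>n. c * f n) \<in> l2" if "f \<in> l2" for c f
      using that by (simp add: l2I norm_mult power_mult_distrib summable_mult)
  qed (auto simp: l2I)
  have \<pi>_l2: "\<pi> g f \<in> l2" if "f \<in> l2" for g f
    using that by (simp add: l2I \<pi>_def norm_mult cmod_w)
  have rep: "unitary_rep G l2 \<pi>"
    unfolding unitary_rep_def
  proof (intro conjI ballI allI)
    show "bij_betw (\<pi> g) l2 l2" if g: "g \<in> carrier G" for g
    proof (rule bij_betw_byWitness[where f'="\<pi> (inv g)"])
      have "w n (inv g) * (w n g * c) = c" "w n g * (w n (inv g) * c) = c" for n c
        using w_inv[OF g, of n] by (metis mult.assoc mult.commute mult_1)+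
      then show "\<forall>f\<in>l2. \<pi> (inv g) (\<pi> g f) = f" "\<forall>f\<in>l2. \<pi> g (\<pi> (inv g) f) = f"
        by (auto simp: \<pi>_def)
    qed (auto intro: \<pi>_l2)
    show "\<pi> g (\<lambda>n. c * f n + d * h n) = (\<lambda>n. c * \<pi> g f n + d * \<pi> g h n)" for g f h c d
      by (auto simp: \<pi>_def algebra_simps)
    show "l2_inner (\<pi> g f) (\<pi> g h) = l2_inner f h" for g f h
    proof -
      have "w n g * a * cnj (w n g * b) = (w n g * cnj (w n g)) * (a * cnj b)" for n a b
        by simp
      then show ?thesis
        by (simp only: l2_inner_def \<pi>_def w_cnj mult_1)
    qed
    show "\<pi> (g \<otimes> h) f = \<pi> g (\<pi> h f)" if "g \<in> carrier G" "h \<in> carrier G" for g h f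
      using that by (auto simp: \<pi>_def w_mult)
    show "\<pi> \<one> f = f" for f
      by (simp add: \<pi>_def w_one fun_eq_iff)
  qed
  have single: "l2_norm (\<lambda>n. if n = m then c else 0) = cmod c" for m c
  proof -
    have "(\<lambda>n. (cmod (if n = m then c else 0))\<^sup>2) = (\<lambda>n. if n = m then (cmod c)\<^sup>2 else 0)"
      by auto
    then show ?thesis
      using sums_unique[OF sums_single[of m "\<lambda>_. (cmod c)\<^sup>2"]] by (simp add: l2_norm_def)
  qed
  have ai: "has_almost_invariant_vectors G l2 \<pi>"
    unfolding has_almost_invariant_vectors_def
  proof (intro allI impI)
    fix Q :: "'g set" and \<epsilon> :: real
    assume Q: "finite Q" "Q \<subseteq> carrier G" and \<epsilon>: "\<epsilon> > 0"
    have "(\<lambda>n. w n g) \<longlonglongrightarrow> 1" for g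
    proof -
      have "(\<lambda>n. of_int (\<tau> g) / real (Suc n)) \<longlonglongrightarrow> 0"
        using LIMSEQ_Suc[OF lim_const_over_n[of "of_int (\<tau> g)"]] by simp
      then have "(\<lambda>n. Complex (cos (of_int (\<tau> g) / real (Suc n))) (sin (of_int (\<tau> g) / real (Suc n))))
          \<longlonglongrightarrow> Complex (cos 0) (sin 0)"
        by (intro tendsto_intros)
      then show ?thesis
        by (simp add: w_def cis.code one_complex.code)
    qed
    then have "\<forall>\<^sub>F n in sequentially. dist (w n g) 1 < \<epsilon>" for g
      using \<epsilon> by (rule tendstoD)
    then have "\<forall>\<^sub>F n in sequentially. \<forall>g\<in>Q. dist (w n g) 1 < \<epsilon>"
      using Q by (simp add: eventually_ball_finite)
    then obtain m where m: "\<forall>g\<in>Q. dist (w m g) 1 < \<epsilon>"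
      by (auto simp: eventually_sequentially)
    let ?v = "\<lambda>n. if n = m then 1 else (0::complex)"
    have "?v \<in> l2"
    proof -
      have "summable (\<lambda>n. if n = m then (1::real) else 0)"
        by (rule summable_single)
      moreover have "(\<lambda>n. (cmod (?v n))\<^sup>2) = (\<lambda>n. if n = m then 1 else 0)"
        by auto
      ultimately show ?thesis
        by (simp add: l2I)
    qed
    moreover have "l2_norm (\<lambda>n. \<pi> g ?v n - ?v n) = dist (w m g) 1" for g
    proof -
      have "(\<lambda>n. \<pi> g ?v n - ?v n) = (\<lambda>n. if n = m then w m g - 1 else 0)"
        by (auto simp: \<pi>_def)
      then show ?thesis
        by (simp only: single dist_norm)
    qed
    ultimately show "\<exists>v\<in>l2. l2_norm v = 1 \<and> (\<forall>g\<in>Q. l2_norm (\<lambda>n. \<pi> g v n - v n) < \<epsilon>)"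
      using m single[of m 1] by (intro bexI[of _ ?v]) auto
  qed
  have "has_nonzero_invariant_vector G l2 \<pi>"
    using T sub rep ai unfolding kazhdan_T_def by blast
  then obtain v where v: "v \<noteq> (\<lambda>n. 0)" "\<pi> t v = v"
    using t by (auto simp: has_nonzero_invariant_vector_def)
  have "v n = 0" for n
  proof (rule ccontr)
    assume "v n \<noteq> 0"
    moreover have "w n t * v n = v n"
      using v(2) by (auto simp: \<pi>_def fun_eq_iff)
    ultimately have "cis (1 / real (Suc n)) = 1"
      using t by (simp add: w_def)
    then have "sin (1 / real (Suc n)) = 0"
      by (metis one_complex.sel(2) cis.sel(2))
    moreover have "sin (1 / real (Suc n)) > 0"
    proof (rule sin_gt_zero)
      have "1 / real (Suc n) \<le> 1"
        by simp
      also have "1 < pi"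
        using pi_gt3 by simp
      finally show "1 / real (Suc n) < pi" .
    qed simp
    ultimately show False
      by simp
  qed
  with v show False
    by auto
qed

text \<open>The group is built from operators on series; this moves it to the natural numbers, the
  type that the theorem asks for.\<close>

definition nat_copy :: "('g, 'b) monoid_scheme \<Rightarrow> nat monoid" where
  "nat_copy H = \<lparr>carrier = to_nat_on (carrier H) ` carrier H,
     mult = (\<lambda>m n. to_nat_on (carrier H)
       (from_nat_into (carrier H) m \<otimes>\<^bsub>H\<^esub> from_nat_into (carrier H) n)),
     one = to_nat_on (carrier H) \<one>\<^bsub>H\<^esub>\<rparr>"

lemma nat_copy_iso:
  assumes "group H" "countable (carrier H)"
  shows "group (nat_copy H)" "to_nat_on (carrier H) \<in> hom H (nat_copy H)"
    "\<And>h. h \<in> carrier H \<Longrightarrow> inv\<^bsub>nat_copy H\<^esub> (to_nat_on (carrier H) h) = to_nat_on (carrier H) (inv\<^bsub>H\<^esub> h)"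
proof -
  interpret H: group H by fact
  let ?e = "to_nat_on (carrier H)"
  have de [simp]: "from_nat_into (carrier H) (?e h) = h" if "h \<in> carrier H" for h
    using assms(2) that by (rule from_nat_into_to_nat_on)
  show g: "group (nat_copy H)"
  proof (rule groupI)
    fix x assume "x \<in> carrier (nat_copy H)"
    then obtain h where h: "h \<in> carrier H" "x = ?e h"
      by (auto simp: nat_copy_def)
    then show "\<exists>y\<in>carrier (nat_copy H). y \<otimes>\<^bsub>nat_copy H\<^esub> x = \<one>\<^bsub>nat_copy H\<^esub>"
      by (intro bexI[of _ "?e (inv\<^bsub>H\<^esub> h)"]) (auto simp: nat_copy_def)
  qed (auto simp: nat_copy_def H.m_assoc)
  show e: "?e \<in> hom H (nat_copy H)"
    by (auto simp: hom_def nat_copy_def)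
  show "inv\<^bsub>nat_copy H\<^esub> (?e h) = ?e (inv\<^bsub>H\<^esub> h)" if "h \<in> carrier H" for h
    using that by (intro group.inv_equality[OF g]) (auto simp: nat_copy_def)
qed

section \<open>The field with 101 elements\<close>

typedef gf101 = "{0..<101 :: int}"
  by (intro exI[of _ 0]) simp

definition gf_of_int :: "int \<Rightarrow> gf101" where
  "gf_of_int n = Abs_gf101 (n mod 101)"

lemma Rep_gf_of_int: "Rep_gf101 (gf_of_int n) = n mod 101"
  by (simp add: gf_of_int_def Abs_gf101_inverse)

lemma gf_of_int_eq_iff: "gf_of_int m = gf_of_int n \<longleftrightarrow> m mod 101 = n mod 101"
  by (metis Rep_gf_of_int Rep_gf101_inject)

lemma gf_of_int_surj: obtains n where "x = gf_of_int n"
proof -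
  have "Rep_gf101 x mod 101 = Rep_gf101 x"
    using Rep_gf101[of x] by simp
  then have "x = gf_of_int (Rep_gf101 x)"
    by (simp add: gf_of_int_def Rep_gf101_inverse)
  then show ?thesis
    by (rule that)
qed

instantiation gf101 :: field
begin

definition "0 = gf_of_int 0"
definition "1 = gf_of_int 1"
definition "x + y = gf_of_int (Rep_gf101 x + Rep_gf101 y)"
definition "x * y = gf_of_int (Rep_gf101 x * Rep_gf101 y)"
definition "- x = gf_of_int (- Rep_gf101 x)"
definition "x - y = gf_of_int (Rep_gf101 x - Rep_gf101 y)"
definition "inverse x = (if x = 0 then 0 else SOME y. y * x = (1 :: gf101))"
definition "x div y = x * inverse (y :: gf101)"

lemma gf_of_int_simps:
  "gf_of_int m + gf_of_int n = gf_of_int (m + n)"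
  "gf_of_int m * gf_of_int n = gf_of_int (m * n)"
  "- gf_of_int m = gf_of_int (- m)"
  "gf_of_int m - gf_of_int n = gf_of_int (m - n)"
  by (simp_all add: plus_gf101_def times_gf101_def uminus_gf101_def minus_gf101_def Rep_gf_of_int
      gf_of_int_eq_iff mod_simps)

instance
proof
  fix a b c :: gf101
  obtain i where i: "a = gf_of_int i" by (rule gf_of_int_surj)
  obtain j where j: "b = gf_of_int j" by (rule gf_of_int_surj)
  obtain k where k: "c = gf_of_int k" by (rule gf_of_int_surj)
  note s = i j k zero_gf101_def one_gf101_def gf_of_int_simps
  show "a * b * c = a * (b * c)" "a * b = b * a" "1 * a = a" "a + b + c = a + (b + c)" "a + b = b + a"
    "0 + a = a" "- a + a = 0" "a - b = a + - b" "(a + b) * c = a * c + b * c"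
    by (simp_all add: s algebra_simps)
  show "(0 :: gf101) \<noteq> 1"
    by (simp add: zero_gf101_def one_gf101_def gf_of_int_eq_iff)
  show "inverse a * a = 1" if "a \<noteq> 0"
  proof -
    have "\<not> 101 dvd i"
      using that by (auto simp: i zero_gf101_def gf_of_int_eq_iff dvd_eq_mod_eq_0)
    moreover have "prime (101 :: int)"
      by simp
    ultimately have "coprime 101 i"
      by (rule prime_imp_coprime[rotated])
    then obtain u v where "u * i + v * 101 = 1"
      using bezout_int[of i 101] by (metis coprime_commute coprime_iff_gcd_eq_1)
    then have "u * i = 1 + 101 * (- v)"
      by simp
    then have "(u * i) mod 101 = 1 mod 101"
      by (metis mod_mult_self2)
    then have "gf_of_int u * a = 1"
      by (simp add: s gf_of_int_eq_iff)
    then have "(SOME y. y * a = 1) * a = 1"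
      by (rule someI)
    then show ?thesis
      using that by (simp add: inverse_gf101_def)
  qed
  show "inverse (0 :: gf101) = 0"
    by (simp add: inverse_gf101_def)
  show "a div b = a * inverse b"
    by (simp add: divide_gf101_def)
qed

end

lemma card_gf101: "CARD(gf101) = 101"
  using type_definition.card[OF type_definition_gf101] by simp

instance gf101 :: finite
  by standard (use card_gf101 in \<open>metis card.infinite zero_neq_numeral\<close>)

section \<open>Elementary operators on triples of Laurent series\<close>

type_synonym 'f vec3 = "'f \<times> 'f \<times> 'f"
type_synonym 'f seq3 = "(int \<Rightarrow> 'f) \<times> (int \<Rightarrow> 'f) \<times> (int \<Rightarrow> 'f)"

text \<open>A cyclic choice of three root subgroups: their commutators give the other three, so they
  generate all of SL_3.\<close>

fun e12 e23 e31 :: "'f::field \<Rightarrow> 'f vec3 \<Rightarrow> 'f vec3" where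
  "e12 c (x, y, z) = (x + c * y, y, z)"
| "e23 c (x, y, z) = (x, y + c * z, z)"
| "e31 c (x, y, z) = (x, y, z + c * x)"

text \<open>Words in the generators already form a group, because the inverse of a generator is a
  generator.\<close>

inductive_set SL3 :: "('f::field vec3 \<Rightarrow> 'f vec3) set" where
  id: "id \<in> SL3"
| e12: "k \<in> SL3 \<Longrightarrow> e12 c \<circ> k \<in> SL3"
| e23: "k \<in> SL3 \<Longrightarrow> e23 c \<circ> k \<in> SL3"
| e31: "k \<in> SL3 \<Longrightarrow> e31 c \<circ> k \<in> SL3"

lemma SL3_comp: "k \<in> SL3 \<Longrightarrow> k' \<in> SL3 \<Longrightarrow> k \<circ> k' \<in> SL3"
  by (induction rule: SL3.induct) (auto simp: o_assoc[symmetric] intro: SL3.intros)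

lemma e_inverse: "e12 c \<circ> e12 (- c) = id" "e23 c \<circ> e23 (- c) = id" "e31 c \<circ> e31 (- c) = id"
  by (auto simp: fun_eq_iff)

lemma SL3_generators: "e12 c \<in> SL3" "e23 c \<in> SL3" "e31 c \<in> SL3"
  using SL3.intros(2-4)[OF SL3.id, of c] by simp_all

lemma SL3_inverse:
  assumes "k \<in> SL3"
  obtains k' where "k' \<in> SL3" "k \<circ> k' = id" "k' \<circ> k = id"
proof -
  have step: "\<exists>k'\<in>SL3. (e c \<circ> k) \<circ> k' = id \<and> k' \<circ> (e c \<circ> k) = id"
    if e: "\<And>c. e c \<in> SL3" "\<And>c. e c \<circ> e (- c) = id" and ex: "\<exists>k'\<in>SL3. k \<circ> k' = id \<and> k' \<circ> k = id"
    for e :: "'a \<Rightarrow> 'a vec3 \<Rightarrow> 'a vec3" and c k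
  proof -
    obtain k' where k': "k' \<in> SL3" "k \<circ> k' = id" "k' \<circ> k = id"
      using ex by blast
    have "(e c \<circ> k) \<circ> (k' \<circ> e (- c)) = e c \<circ> (k \<circ> k') \<circ> e (- c)"
      by (simp only: o_assoc)
    moreover have "(k' \<circ> e (- c)) \<circ> (e c \<circ> k) = k' \<circ> (e (- c) \<circ> e c) \<circ> k"
      by (simp only: o_assoc)
    moreover have "e (- c) \<circ> e c = id"
      using e(2)[of "- c"] by simp
    ultimately show ?thesis
      using e k' by (intro bexI[of _ "k' \<circ> e (- c)"] SL3_comp) simp_all
  qed
  have "\<exists>k'\<in>SL3. k \<circ> k' = id \<and> k' \<circ> k = id"
    using assms
  proof induction
    case id
    then show ?case
      by (intro bexI[of _ id]) (auto intro: SL3.id)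
  qed (intro step SL3_generators e_inverse; assumption)+
  then show ?thesis
    using that by blast
qed

lemma finite_SL3: "finite (SL3 :: ('f::{finite,field} vec3 \<Rightarrow> 'f vec3) set)"
  by (rule finite_subset[OF subset_UNIV]) simp

lemma SL3_zero: "k \<in> SL3 \<Longrightarrow> k (0, 0, 0) = (0, 0, 0)"
  by (induction rule: SL3.induct) auto

lemma SL3_nonzero: "k \<in> SL3 \<Longrightarrow> k v = (0, 0, 0) \<longleftrightarrow> v = (0, 0, 0)"
proof
  assume k: "k \<in> SL3" and "k v = (0, 0, 0)"
  obtain k' where "k' \<in> SL3" "k' \<circ> k = id"
    using SL3_inverse[OF k] by metis
  then show "v = (0, 0, 0)"
    using \<open>k v = (0, 0, 0)\<close> SL3_zero[of k'] by (metis comp_apply id_apply)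
qed (simp add: SL3_zero)

text \<open>Every nonzero vector can be moved to (1, 1, 1). If x is nonzero it is used to make z =
  1, then z makes y = 1 and y makes x = 1; otherwise a nonzero y first makes x = 1, or a nonzero z
  first makes y = 1.\<close>

lemma SL3_transitive:
  assumes "u \<noteq> (0, 0, 0)" "v \<noteq> (0, 0, 0)"
  obtains k where "k \<in> SL3" "k u = v"
proof -
  have to_one: "\<exists>k\<in>SL3. k u = (1, 1, 1)" if "u \<noteq> (0, 0, 0)" for u :: "'a vec3"
  proof -
    obtain x y z where u: "u = (x, y, z)"
      by (cases u)
    have x: "\<exists>k\<in>SL3. k (x, y, z) = (1, 1, 1)" if "x \<noteq> 0" for x y z :: 'a
      using that
      by (intro bexI[of _ "e12 (1 - x) \<circ> (e23 (1 - y) \<circ> (e31 ((1 - z) / x) \<circ> id))"] SL3.intros) simp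
    have y: "\<exists>k\<in>SL3. k (x, y, z) = (1, 1, 1)" if "y \<noteq> 0" for x y z :: 'a
    proof -
      have "e12 ((1 - x) / y) (x, y, z) = (1, y, z)"
        using that by simp
      moreover obtain k where "k \<in> SL3" "k (1, y, z) = (1, 1, 1)"
        using x[of 1 y z] by auto
      ultimately show ?thesis
        by (intro bexI[of _ "k \<circ> e12 ((1 - x) / y)"] SL3_comp SL3_generators) auto
    qed
    show ?thesis
    proof (cases "y = 0")
      case True
      show ?thesis
      proof (cases "x = 0")
        case True
        then have "z \<noteq> 0"
          using u \<open>y = 0\<close> that by simp
        then have "e23 ((1 - y) / z) (x, y, z) = (x, 1, z)"
          by simp
        moreover obtain k where "k \<in> SL3" "k (x, 1, z) = (1, 1, 1)"
          using y[of 1 x z] by auto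
        ultimately show ?thesis
          unfolding u by (intro bexI[of _ "k \<circ> e23 ((1 - y) / z)"] SL3_comp SL3_generators) auto
      qed (use x u in simp)
    qed (use y u in simp)
  qed
  obtain k where k: "k \<in> SL3" "k u = (1, 1, 1)"
    using to_one assms by blast
  obtain l where l: "l \<in> SL3" "l v = (1, 1, 1)"
    using to_one assms by blast
  obtain l' where l': "l' \<in> SL3" "l' \<circ> l = id"
    using SL3_inverse[OF l(1)] by metis
  have "l' (1, 1, 1) = v"
    using l l'(2) by (metis comp_apply id_apply)
  then show ?thesis
    using k l' by (intro that[of "l' \<circ> k"] SL3_comp) auto
qed

text \<open>A triple of two-sided sequences stands for a vector of Laurent series in \<open>t\<close>;
  \<open>E12 m c\<close> is the elementary matrix with entry \<open>c t^m\<close>, and \<open>shift1\<close> is the diagonal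
  matrix with entries \<open>t, 1, 1\<close>.\<close>

fun E12 E23 E31 E13 E21 E32 :: "int \<Rightarrow> 'f::field \<Rightarrow> 'f seq3 \<Rightarrow> 'f seq3" where
  "E12 m c (x, y, z) = (\<lambda>n. x n + c * y (n - m), y, z)"
| "E23 m c (x, y, z) = (x, \<lambda>n. y n + c * z (n - m), z)"
| "E31 m c (x, y, z) = (x, y, \<lambda>n. z n + c * x (n - m))"
| "E13 m c (x, y, z) = (\<lambda>n. x n + c * z (n - m), y, z)"
| "E21 m c (x, y, z) = (x, \<lambda>n. y n + c * x (n - m), z)"
| "E32 m c (x, y, z) = (x, y, \<lambda>n. z n + c * y (n - m))"

fun shift1 unshift1 :: "'f seq3 \<Rightarrow> 'f seq3" where
  "shift1 (x, y, z) = (\<lambda>n. x (n - 1), y, z)"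
| "unshift1 (x, y, z) = (\<lambda>n. x (n + 1), y, z)"

text \<open>A constant matrix acting on each coefficient. The index type is left open because the
  action is needed on two-sided sequences and on digit sequences.\<close>

fun digitwise :: "('f vec3 \<Rightarrow> 'f vec3) \<Rightarrow> ('i \<Rightarrow> 'f) \<times> ('i \<Rightarrow> 'f) \<times> ('i \<Rightarrow> 'f) \<Rightarrow> ('i \<Rightarrow> 'f) \<times> ('i \<Rightarrow> 'f) \<times> ('i \<Rightarrow> 'f)" where
  "digitwise k (x, y, z) = (\<lambda>n. fst (k (x n, y n, z n)), \<lambda>n. fst (snd (k (x n, y n, z n))),
     \<lambda>n. snd (snd (k (x n, y n, z n))))"

definition conjugate1 :: "('f vec3 \<Rightarrow> 'f vec3) \<Rightarrow> 'f seq3 \<Rightarrow> 'f seq3" where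
  "conjugate1 k = shift1 \<circ> digitwise k \<circ> unshift1"

lemma shift1_unshift1 [simp]: "shift1 \<circ> unshift1 = id" "unshift1 \<circ> shift1 = id"
  by (auto simp: fun_eq_iff)

lemma digitwise_id [simp]: "digitwise id = id"
  by (auto simp: fun_eq_iff)

lemma digitwise_comp: "digitwise (k \<circ> l) = digitwise k \<circ> digitwise l"
  by (auto simp: fun_eq_iff)

lemma conjugate1_comp: "conjugate1 (k \<circ> l) = conjugate1 k \<circ> conjugate1 l"
proof -
  have "conjugate1 k \<circ> conjugate1 l = shift1 \<circ> digitwise k \<circ> (unshift1 \<circ> shift1) \<circ> digitwise l \<circ> unshift1"
    unfolding conjugate1_def by (simp only: o_assoc)
  then show ?thesis
    by (simp only: shift1_unshift1 o_id) (simp only: conjugate1_def digitwise_comp o_assoc)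
qed

lemma conjugate1_id [simp]: "conjugate1 id = id"
  by (simp add: conjugate1_def)

text \<open>The root subgroups of both copies of SL_3. Conjugation by diag(t, 1, 1) multiplies the
  entry of e12 by t and that of e31 by 1/t and fixes e23, hence five subgroups and not six. Indices
  above 4 repeat the last one.\<close>

fun elmat :: "nat \<Rightarrow> 'f::field \<Rightarrow> 'f seq3 \<Rightarrow> 'f seq3" where
  "elmat 0 = E12 0"
| "elmat (Suc 0) = E12 1"
| "elmat (Suc (Suc 0)) = E23 0"
| "elmat (Suc (Suc (Suc 0))) = E31 0"
| "elmat (Suc (Suc (Suc (Suc _)))) = E31 (- 1)"

lemma elem_digitwise:
  "digitwise (e12 c) = elmat 0 c" "digitwise (e23 c) = elmat 2 c" "digitwise (e31 c) = elmat 3 c"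
  "conjugate1 (e12 c) = elmat 1 c" "conjugate1 (e23 c) = elmat 2 c" "conjugate1 (e31 c) = elmat 4 c"
  by (auto simp: fun_eq_iff conjugate1_def numeral_eq_Suc)

lemma elem_add: "elmat i (c + d) = elmat i c \<circ> elmat i d"
  by (induction i rule: elmat.induct) (auto simp: fun_eq_iff algebra_simps)

lemma elem_zero: "elmat i 0 = id"
  by (induction i rule: elmat.induct) (auto simp: fun_eq_iff)

inductive_set EL3 :: "('f::field seq3 \<Rightarrow> 'f seq3) set" where
  id: "id \<in> EL3"
| elem: "l \<in> EL3 \<Longrightarrow> i < 5 \<Longrightarrow> elmat i c \<circ> l \<in> EL3"

lemma EL3_comp: "k \<in> EL3 \<Longrightarrow> l \<in> EL3 \<Longrightarrow> k \<circ> l \<in> EL3"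
  by (induction rule: EL3.induct) (auto simp: o_assoc[symmetric] intro: EL3.intros)

lemma EL3_elem: "i < 5 \<Longrightarrow> elmat i c \<in> EL3"
  using EL3.elem[OF EL3.id, of i c] by simp

lemma EL3_digitwise: "k \<in> SL3 \<Longrightarrow> digitwise k \<in> EL3"
proof (induction rule: SL3.induct)
  case id
  show ?case
    unfolding digitwise_id by (rule EL3.id)
next
  case (e12 k c)
  then show ?case
    unfolding digitwise_comp elem_digitwise by (intro EL3.elem) simp_all
next
  case (e23 k c)
  then show ?case
    unfolding digitwise_comp elem_digitwise by (intro EL3.elem) simp_all
next
  case (e31 k c)
  then show ?case
    unfolding digitwise_comp elem_digitwise by (intro EL3.elem) simp_all
qed

lemma EL3_conjugate1: "k \<in> SL3 \<Longrightarrow> conjugate1 k \<in> EL3"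
proof (induction rule: SL3.induct)
  case id
  show ?case
    unfolding conjugate1_id by (rule EL3.id)
next
  case (e12 k c)
  then show ?case
    unfolding conjugate1_comp elem_digitwise by (intro EL3.elem) simp_all
next
  case (e23 k c)
  then show ?case
    unfolding conjugate1_comp elem_digitwise by (intro EL3.elem) simp_all
next
  case (e31 k c)
  then show ?case
    unfolding conjugate1_comp elem_digitwise by (intro EL3.elem) simp_all
qed

lemma EL3_inverse: "l \<in> EL3 \<Longrightarrow> \<exists>l'\<in>EL3. l' \<circ> l = id"
proof (induction rule: EL3.induct)
  case id
  show ?case
    by (intro bexI[of _ id]) (auto intro: EL3.id)
next
  case (elem l i c)
  then obtain l' where l': "l' \<in> EL3" "l' \<circ> l = id"
    by blast
  have "(l' \<circ> elmat i (- c)) \<circ> (elmat i c \<circ> l) = l' \<circ> (elmat i (- c) \<circ> elmat i c) \<circ> l"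
    by (simp only: o_assoc)
  also have "elmat i (- c) \<circ> elmat i c = id"
    by (simp add: elem_add[symmetric] elem_zero)
  finally show ?case
    using l' elem by (intro bexI[of _ "l' \<circ> elmat i (- c)"] EL3_comp EL3_elem) simp_all
qed

fun word :: "(nat \<times> 'f::field) list \<Rightarrow> 'f seq3 \<Rightarrow> 'f seq3" where
  "word [] = id"
| "word ((i, c) # xs) = elmat i c \<circ> word xs"

lemma countable_EL3: "countable (EL3 :: ('f::{finite,field} seq3 \<Rightarrow> 'f seq3) set)"
proof -
  have "l \<in> range word" if "l \<in> EL3" for l :: "'f seq3 \<Rightarrow> 'f seq3"
    using that
  proof induction
    case id
    show ?case
      using word.simps(1) by (metis rangeI)
  next
    case (elem l i c)
    then obtain xs where "l = word xs"
      by blast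
    then have "elmat i c \<circ> l = word ((i, c) # xs)"
      by simp
    then show ?case
      by (metis rangeI)
  qed
  then have "EL3 \<subseteq> range (word :: (nat \<times> 'f) list \<Rightarrow> _)"
    by blast
  then show ?thesis
    by (rule countable_subset) (intro countable_image countableI_type)
qed

definition EL3_int :: "(('f::field seq3 \<Rightarrow> 'f seq3) \<times> int) monoid" where
  "EL3_int = \<lparr>carrier = EL3 \<times> UNIV, mult = (\<lambda>(k, m) (l, n). (k \<circ> l, m + n)), one = (id, 0)\<rparr>"

lemma group_EL3_int: "group (EL3_int :: (('f::field seq3 \<Rightarrow> 'f seq3) \<times> int) monoid)"
proof (rule groupI)
  fix x assume "x \<in> carrier (EL3_int :: (('f seq3 \<Rightarrow> 'f seq3) \<times> int) monoid)"
  then obtain l m where x: "x = (l, m)" "l \<in> EL3"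
    by (auto simp: EL3_int_def)
  then obtain l' where "l' \<in> EL3" "l' \<circ> l = id"
    using EL3_inverse by blast
  then show "\<exists>y\<in>carrier EL3_int. y \<otimes>\<^bsub>EL3_int\<^esub> x = \<one>\<^bsub>EL3_int\<^esub>"
    using x by (intro bexI[of _ "(l', - m)"]) (auto simp: EL3_int_def)
qed (auto simp: EL3_int_def EL3.id EL3_comp o_assoc)

lemma elem_one_param:
  assumes "i < 5"
  shows "group.one_param (EL3_int :: (('f::{finite,field} seq3 \<Rightarrow> 'f seq3) \<times> int) monoid) (\<lambda>c. (elmat i c, 0))"
  unfolding group.one_param_def[OF group_EL3_int]
  using assms by (auto simp: EL3_int_def EL3_elem elem_add simp del: elmat.simps)

text \<open>Of the ten pairs, two share a root position and commute. In the other eight the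
  commutator is a single elementary matrix in the product position, with the exponents of t
  added.\<close>

lemma elem_relations:
  assumes "i < 5" "j < 5" "i \<noteq> j"
  shows "(\<forall>c d. elmat i c \<circ> elmat j d = elmat j d \<circ> (elmat i c :: 'f::{finite,field} seq3 \<Rightarrow> _))
    \<or> (\<exists>z. group.heis (EL3_int :: (('f seq3 \<Rightarrow> 'f seq3) \<times> int) monoid)
          (\<lambda>c. (elmat i c, 0)) (\<lambda>c. (elmat j c, 0)) z)
    \<or> (\<exists>z. group.heis (EL3_int :: (('f seq3 \<Rightarrow> 'f seq3) \<times> int) monoid)
          (\<lambda>c. (elmat j c, 0)) (\<lambda>c. (elmat i c, 0)) z)"
proof -
  let ?H = "EL3_int :: (('f seq3 \<Rightarrow> 'f seq3) \<times> int) monoid"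
  have heis: "group.heis ?H (\<lambda>c. (elmat i c, 0)) (\<lambda>c. (elmat j c, 0)) (\<lambda>c. (f c, 0))"
    if "i < 5" "j < 5" and f: "\<And>c d. f (c + d) = f c \<circ> f d"
      and comm: "\<And>c d. elmat i c \<circ> f d = f d \<circ> elmat i c" "\<And>c d. elmat j c \<circ> f d = f d \<circ> elmat j c"
      and rel: "\<And>c d. elmat i c \<circ> elmat j d = f (c * d) \<circ> elmat j d \<circ> elmat i c"
    for i j and f :: "'f \<Rightarrow> 'f seq3 \<Rightarrow> 'f seq3"
  proof -
    have cancel: "elmat k c \<circ> elmat k (- c) = id" for k and c :: 'f
      by (simp add: elem_add[symmetric] elem_zero)
    \<comment> \<open>The relation exhibits the central element as a commutator of generators, so it
      belongs to the group.\<close>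
    have "f c \<in> EL3" for c
    proof -
      have "elmat i c \<circ> elmat j 1 \<circ> (elmat i (- c) \<circ> elmat j (- 1))
          = f c \<circ> elmat j 1 \<circ> (elmat i c \<circ> elmat i (- c)) \<circ> elmat j (- 1)"
        using rel[of c 1] by (simp add: o_assoc)
      also have "\<dots> = f c \<circ> elmat j 1 \<circ> elmat j (- 1)"
        unfolding cancel by simp
      also have "\<dots> = f c \<circ> (elmat j 1 \<circ> elmat j (- 1))"
        by (rule o_assoc[symmetric])
      also have "\<dots> = f c"
        unfolding cancel by simp
      finally have f_eq: "f c = elmat i c \<circ> elmat j 1 \<circ> (elmat i (- c) \<circ> elmat j (- 1))" ..
      show ?thesis
        by (subst f_eq) (intro EL3_comp EL3_elem that(1,2))
    qed
    note f_EL3 = this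
    show ?thesis
      unfolding group.heis_def[OF group_EL3_int]
    proof (intro conjI allI)
      show "group.one_param ?H (\<lambda>c. (elmat i c, 0))" "group.one_param ?H (\<lambda>c. (elmat j c, 0))"
        using that by (simp_all add: elem_one_param del: elmat.simps)
      show "group.one_param ?H (\<lambda>c. (f c, 0))"
        unfolding group.one_param_def[OF group_EL3_int] by (simp add: EL3_int_def f_EL3 f)
      show "(elmat i c, 0) \<otimes>\<^bsub>?H\<^esub> (f d, 0) = (f d, 0) \<otimes>\<^bsub>?H\<^esub> (elmat i c, 0)" for c d
        by (simp add: EL3_int_def comm(1))
      show "(elmat j c, 0) \<otimes>\<^bsub>?H\<^esub> (f d, 0) = (f d, 0) \<otimes>\<^bsub>?H\<^esub> (elmat j c, 0)" for c d
        by (simp add: EL3_int_def comm(2))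
      show "(elmat i c, 0) \<otimes>\<^bsub>?H\<^esub> (elmat j d, 0)
          = (f (c * d), 0) \<otimes>\<^bsub>?H\<^esub> (elmat j d, 0) \<otimes>\<^bsub>?H\<^esub> (elmat i c, 0)" for c d
        by (simp add: EL3_int_def rel)
    qed
  qed
  have "i \<in> {0,1,2,3,4}" "j \<in> {0,1,2,3,4}"
    using assms by auto
  have 1: "elmat 0 c \<circ> elmat 1 d = elmat 1 d \<circ> (elmat 0 c :: 'f seq3 \<Rightarrow> _)"
      "elmat 3 c \<circ> elmat 4 d = elmat 4 d \<circ> (elmat 3 c :: 'f seq3 \<Rightarrow> _)" for c d
    by (auto simp: fun_eq_iff numeral_eq_Suc algebra_simps)
  have 2: "group.heis ?H (\<lambda>c. (elmat 0 c, 0)) (\<lambda>c. (elmat 2 c, 0)) (\<lambda>c. (E13 0 c, 0))"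
      "group.heis ?H (\<lambda>c. (elmat 1 c, 0)) (\<lambda>c. (elmat 2 c, 0)) (\<lambda>c. (E13 1 c, 0))"
      "group.heis ?H (\<lambda>c. (elmat 2 c, 0)) (\<lambda>c. (elmat 3 c, 0)) (\<lambda>c. (E21 0 c, 0))"
      "group.heis ?H (\<lambda>c. (elmat 2 c, 0)) (\<lambda>c. (elmat 4 c, 0)) (\<lambda>c. (E21 (- 1) c, 0))"
      "group.heis ?H (\<lambda>c. (elmat 3 c, 0)) (\<lambda>c. (elmat 0 c, 0)) (\<lambda>c. (E32 0 c, 0))"
      "group.heis ?H (\<lambda>c. (elmat 3 c, 0)) (\<lambda>c. (elmat 1 c, 0)) (\<lambda>c. (E32 1 c, 0))"
      "group.heis ?H (\<lambda>c. (elmat 4 c, 0)) (\<lambda>c. (elmat 0 c, 0)) (\<lambda>c. (E32 (- 1) c, 0))"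
      "group.heis ?H (\<lambda>c. (elmat 4 c, 0)) (\<lambda>c. (elmat 1 c, 0)) (\<lambda>c. (E32 0 c, 0))"
    by (rule heis; auto simp: fun_eq_iff numeral_eq_Suc algebra_simps)+
  show ?thesis
    using \<open>i \<in> _\<close> \<open>j \<in> _\<close> \<open>i \<noteq> j\<close> 1 2
    by (auto simp del: elmat.simps simp flip: One_nat_def)
qed

lemma one_param_hom:
  assumes "group H" "group G" "h \<in> hom H G" "group.one_param H k"
  shows "group.one_param G (\<lambda>c. h (k c))"
  using assms by (auto simp: group.one_param_def hom_def Pi_iff)

lemma heis_hom:
  assumes H: "group H" and G: "group G" and h: "h \<in> hom H G" and k: "group.heis H k k' z"
  shows "group.heis G (\<lambda>c. h (k c)) (\<lambda>c. h (k' c)) (\<lambda>c. h (z c))"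
proof -
  interpret H: group H by fact
  interpret G: group G by fact
  have op: "H.one_param k" "H.one_param k'" "H.one_param z"
    and rel: "\<And>c d. k c \<otimes>\<^bsub>H\<^esub> z d = z d \<otimes>\<^bsub>H\<^esub> k c" "\<And>c d. k' c \<otimes>\<^bsub>H\<^esub> z d = z d \<otimes>\<^bsub>H\<^esub> k' c"
      "\<And>c d. k c \<otimes>\<^bsub>H\<^esub> k' d = z (c * d) \<otimes>\<^bsub>H\<^esub> k' d \<otimes>\<^bsub>H\<^esub> k c"
    using k by (auto simp: H.heis_def)
  note car = op[THEN H.one_paramD(1)]
  have mult: "h (x \<otimes>\<^bsub>H\<^esub> y) = h x \<otimes>\<^bsub>G\<^esub> h y" if "x \<in> carrier H" "y \<in> carrier H" for x y
    using h that by (simp add: hom_def)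
  show ?thesis
    unfolding G.heis_def
  proof (intro conjI allI)
    show "h (k c) \<otimes>\<^bsub>G\<^esub> h (z d) = h (z d) \<otimes>\<^bsub>G\<^esub> h (k c)" for c d
      using mult[OF car(1,3), of c d] mult[OF car(3,1), of d c] rel(1)[of c d] by simp
    show "h (k' c) \<otimes>\<^bsub>G\<^esub> h (z d) = h (z d) \<otimes>\<^bsub>G\<^esub> h (k' c)" for c d
      using mult[OF car(2,3), of c d] mult[OF car(3,2), of d c] rel(2)[of c d] by simp
    show "h (k c) \<otimes>\<^bsub>G\<^esub> h (k' d) = h (z (c * d)) \<otimes>\<^bsub>G\<^esub> h (k' d) \<otimes>\<^bsub>G\<^esub> h (k c)" for c d
    proof -
      have "h (z (c * d)) \<otimes>\<^bsub>G\<^esub> h (k' d) \<otimes>\<^bsub>G\<^esub> h (k c) = h (z (c * d) \<otimes>\<^bsub>H\<^esub> k' d \<otimes>\<^bsub>H\<^esub> k c)"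
        by (simp add: mult car)
      then show ?thesis
        using mult[OF car(1,2), of c d] rel(3)[of c d] by simp
    qed
  qed (use op one_param_hom[OF H G h] in blast)+
qed

section \<open>The concrete countable group and its generating measure\<close>

type_synonym op101 = "gf101 seq3 \<Rightarrow> gf101 seq3"

abbreviation H101 :: "(op101 \<times> int) monoid" where
  "H101 \<equiv> EL3_int"

definition code101 :: "op101 \<times> int \<Rightarrow> nat" where
  "code101 = to_nat_on (carrier H101)"

definition decode101 :: "nat \<Rightarrow> op101 \<times> int" where
  "decode101 = from_nat_into (carrier H101)"

definition G101 :: "nat monoid" where
  "G101 = nat_copy H101"

definition linear_part :: "nat \<Rightarrow> nat" where
  "linear_part m = code101 (fst (decode101 m), 0)"

text \<open>The integer step is independent of the rest: -1 and 1 generate the integers as a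
  semigroup, and 0 puts elements of L itself into the support.\<close>

definition mu101 :: "nat pmf" where
  "mu101 = map_pmf (\<lambda>((k, l), n). code101 (digitwise k \<circ> conjugate1 l, n))
     (pair_pmf (pair_pmf (pmf_of_set SL3) (pmf_of_set SL3)) (pmf_of_set {- 1, 0, 1}))"

lemma countable_H101: "countable (carrier H101)"
  by (simp add: EL3_int_def countable_EL3)

lemma decode_code101 [simp]: "l \<in> EL3 \<Longrightarrow> decode101 (code101 (l, n)) = (l, n)"
  unfolding decode101_def code101_def
  by (rule from_nat_into_to_nat_on[OF countable_H101]) (simp add: EL3_int_def)

lemma group_G101: "group G101" and code101_hom: "code101 \<in> hom H101 G101"
  unfolding G101_def code101_def by (rule nat_copy_iso[OF group_EL3_int countable_H101])+

lemma carrier_G101: "m \<in> carrier G101 \<longleftrightarrow> (\<exists>l\<in>EL3. \<exists>n. m = code101 (l, n))"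
  by (auto simp: G101_def nat_copy_def code101_def EL3_int_def)

lemma code101_mult: "k \<in> EL3 \<Longrightarrow> l \<in> EL3 \<Longrightarrow> code101 (k, m) \<otimes>\<^bsub>G101\<^esub> code101 (l, n) = code101 (k \<circ> l, m + n)"
  using code101_hom by (auto simp: hom_def EL3_int_def)

lemma one_G101: "\<one>\<^bsub>G101\<^esub> = code101 (id, 0)"
  by (simp add: G101_def nat_copy_def code101_def EL3_int_def)

lemma code101_in_carrier [simp]: "l \<in> EL3 \<Longrightarrow> code101 (l, n) \<in> carrier G101"
  by (auto simp: carrier_G101)

lemma linear_part_code [simp]: "l \<in> EL3 \<Longrightarrow> linear_part (code101 (l, n)) = code101 (l, 0)"
  by (simp add: linear_part_def)

lemma linear_part_central:
  assumes "g \<in> carrier G101" "h \<in> carrier G101"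
  shows "h \<otimes>\<^bsub>G101\<^esub> (inv\<^bsub>G101\<^esub> linear_part g \<otimes>\<^bsub>G101\<^esub> g) = inv\<^bsub>G101\<^esub> linear_part g \<otimes>\<^bsub>G101\<^esub> g \<otimes>\<^bsub>G101\<^esub> h"
proof -
  interpret group G101 by (rule group_G101)
  obtain k m where g: "g = code101 (k, m)" "k \<in> EL3"
    using assms(1) by (auto simp: carrier_G101)
  obtain l n where h: "h = code101 (l, n)" "l \<in> EL3"
    using assms(2) by (auto simp: carrier_G101)
  have "inv\<^bsub>G101\<^esub> linear_part g \<otimes>\<^bsub>G101\<^esub> g = code101 (id, m)"
  proof -
    have "g = linear_part g \<otimes>\<^bsub>G101\<^esub> code101 (id, m)"
      using g by (simp add: code101_mult EL3.id)
    then have "inv\<^bsub>G101\<^esub> linear_part g \<otimes>\<^bsub>G101\<^esub> g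
        = inv\<^bsub>G101\<^esub> linear_part g \<otimes>\<^bsub>G101\<^esub> (linear_part g \<otimes>\<^bsub>G101\<^esub> code101 (id, m))"
      by simp
    also have "\<dots> = code101 (id, m)"
      using g by (simp add: m_assoc[symmetric] EL3.id)
    finally show ?thesis .
  qed
  then show ?thesis
    using h by (simp add: code101_mult EL3.id add.commute)
qed

lemma elem_code_in_semigroup:
  assumes S: "\<And>i c. i < 5 \<Longrightarrow> code101 (elmat i c, 0) \<in> semigroup_generated G101 S" and "l \<in> EL3"
  shows "code101 (l, 0) \<in> semigroup_generated G101 S"
  using assms(2)
proof induction
  case id
  show ?case
    using S[of 0 0] by (simp add: elem_zero id_def del: elmat.simps)
next
  case (elem l i c)
  then show ?case
    using semigroup_generated.mult[OF S[of i c], of "code101 (l, 0)"]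
    by (simp add: code101_mult EL3_elem o_def del: elmat.simps)
qed

lemma SL3_nonempty: "SL3 \<noteq> {}"
  using SL3.id by blast

lemma set_mu101:
  "set_pmf mu101 = {code101 (digitwise k \<circ> conjugate1 l, n) |k l n. k \<in> SL3 \<and> l \<in> SL3 \<and> n \<in> {- 1, 0, 1}}"
  unfolding mu101_def by (force simp: set_pmf_of_set finite_SL3 SL3_nonempty)

lemma finite_mu101: "finite (set_pmf mu101)"
  unfolding mu101_def by (simp add: set_pmf_of_set finite_SL3 SL3_nonempty)

lemma generating_mu101: "generating G101 mu101"
  unfolding generating_def
proof
  show sub: "set_pmf mu101 \<subseteq> carrier G101"
    by (auto simp: set_mu101 EL3_comp EL3_digitwise EL3_conjugate1)
  let ?T = "semigroup_generated G101 (set_pmf mu101)"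
  interpret group G101 by (rule group_G101)
  have in_T: "code101 (digitwise k \<circ> conjugate1 l, n) \<in> ?T"
    if "k \<in> SL3" "l \<in> SL3" "n \<in> {- 1, 0, 1}" for k l n
    using that by (intro semigroup_generated.gen) (auto simp: set_mu101)
  have 1: "code101 (digitwise k, 0) \<in> ?T" if "k \<in> SL3" for k
    using in_T[OF that SL3.id, of 0] by simp
  have 2: "code101 (conjugate1 k, 0) \<in> ?T" if "k \<in> SL3" for k
    using in_T[OF SL3.id that, of 0] by simp
  have el: "code101 (elmat i c, 0) \<in> ?T" if i: "i < 5" for i c
  proof -
    consider "i = 0" | "i = 1" | "i = 2" | "i = 3" | "i = 4"
      using i by linarith
    then show ?thesis
      using 1[OF SL3_generators(1)[of c]] 1[OF SL3_generators(2)[of c]] 1[OF SL3_generators(3)[of c]]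
        2[OF SL3_generators(1)[of c]] 2[OF SL3_generators(3)[of c]]
      by cases (simp_all only: elem_digitwise)
  qed
  have z: "code101 (id, n) \<in> ?T" for n
  proof (induction n rule: int_induct[of _ 0])
    case base
    show ?case
      using 1[OF SL3.id] unfolding digitwise_id .
  next
    case (step1 n)
    then show ?case
      using semigroup_generated.mult[OF step1(2) in_T[OF SL3.id SL3.id, of 1]]
      by (simp add: code101_mult EL3.id flip: id_def)
  next
    case (step2 n)
    then show ?case
      using semigroup_generated.mult[OF step2(2) in_T[OF SL3.id SL3.id, of "- 1"]]
      by (simp add: code101_mult EL3.id flip: id_def)
  qed
  show "?T = carrier G101"
  proof
    show "?T \<subseteq> carrier G101"
    proof
      fix x assume "x \<in> ?T"
      then show "x \<in> carrier G101"
        by induction (use sub in auto)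
    qed
    show "carrier G101 \<subseteq> ?T"
    proof
      fix x assume "x \<in> carrier G101"
      then obtain l n where x: "x = code101 (l, n)" "l \<in> EL3"
        by (auto simp: carrier_G101)
      then have "x = code101 (l, 0) \<otimes>\<^bsub>G101\<^esub> code101 (id, n)"
        by (simp add: code101_mult EL3.id)
      then show "x \<in> ?T"
        using semigroup_generated.mult[OF elem_code_in_semigroup[OF el x(2)] z[of n]] by simp
    qed
  qed
qed

lemma not_kazhdan_T_G101: "\<not> kazhdan_T G101"
proof (rule not_kazhdan_T_of_hom_int[OF group_G101])
  show "snd (decode101 (g \<otimes>\<^bsub>G101\<^esub> h)) = snd (decode101 g) + snd (decode101 h)"
    if "g \<in> carrier G101" "h \<in> carrier G101" for g h
    using that by (auto simp: carrier_G101 code101_mult EL3_comp)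
  show "code101 (id, 1) \<in> carrier G101" "snd (decode101 (code101 (id, 1))) = 1"
    by (simp_all add: EL3.id)
qed

lemma elem_one_param_G101: "i < 5 \<Longrightarrow> group.one_param G101 (\<lambda>c. code101 (elmat i c, 0))"
  by (rule one_param_hom[OF group_EL3_int group_G101 code101_hom elem_one_param])

lemma elem_relations_G101:
  assumes "i < 5" "j < 5" "i \<noteq> j"
  shows "(\<forall>c d. code101 (elmat i c, 0) \<otimes>\<^bsub>G101\<^esub> code101 (elmat j d, 0)
        = code101 (elmat j d, 0) \<otimes>\<^bsub>G101\<^esub> code101 (elmat i c, 0))
    \<or> (\<exists>z. group.heis G101 (\<lambda>c. code101 (elmat i c, 0)) (\<lambda>c. code101 (elmat j c, 0)) z)
    \<or> (\<exists>z. group.heis G101 (\<lambda>c. code101 (elmat j c, 0)) (\<lambda>c. code101 (elmat i c, 0)) z)"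
  using elem_relations[OF assms, where 'f=gf101]
proof (elim disjE exE)
  assume "\<forall>c d. elmat i c \<circ> elmat j d = elmat j d \<circ> (elmat i c :: op101)"
  then show ?thesis
    using assms by (simp add: code101_mult EL3_elem del: elmat.simps)
qed (blast dest: heis_hom[OF group_EL3_int group_G101 code101_hom])+

section \<open>Uniform measure on triples of digit sequences\<close>

type_synonym 'f digits3 = "(nat \<Rightarrow> 'f) \<times> (nat \<Rightarrow> 'f) \<times> (nat \<Rightarrow> 'f)"

definition digit :: "'f::finite measure" where
  "digit = measure_pmf (pmf_of_set UNIV)"

definition digits :: "(nat \<Rightarrow> 'f::finite) measure" where
  "digits = (\<Pi>\<^sub>M n\<in>UNIV. digit)"

text \<open>Haar probability measure on triples of formal power series: all coefficients are
  independent and uniform.\<close>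

definition haar :: "'f::finite digits3 measure" where
  "haar = digits \<Otimes>\<^sub>M (digits \<Otimes>\<^sub>M digits)"

lemma sets_digit [measurable_cong, simp]: "sets digit = UNIV"
  by (simp add: digit_def)

lemma space_digit [simp]: "space digit = UNIV"
  by (simp add: digit_def)

lemma prob_space_digit: "prob_space digit"
  unfolding digit_def by (rule prob_space_measure_pmf)

interpretation digit_seq: sequence_space digit
  by (intro sequence_space.intro product_prob_space.intro product_sigma_finite.intro
      product_prob_space_axioms.intro prob_space_digit prob_space_imp_sigma_finite)

lemma prob_space_digits: "prob_space digits"
  unfolding digits_def by (rule digit_seq.P.prob_space_axioms)

interpretation digits: prob_space digits
  by (rule prob_space_digits)

interpretation digits2: pair_prob_space digits digits
  by unfold_locales

interpretation haar: pair_prob_space digits "digits \<Otimes>\<^sub>M digits"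
  by unfold_locales

lemma prob_space_haar: "prob_space haar"
  unfolding haar_def by (rule haar.prob_space_axioms)

lemma space_haar [simp]: "space haar = UNIV"
  by (simp add: haar_def digits_def space_pair_measure space_PiM)

lemma space_digits [simp]: "space digits = UNIV"
  by (simp add: digits_def space_PiM)

lemma measurable_digit_at: "(\<lambda>x. x n) \<in> digits \<rightarrow>\<^sub>M digit"
  unfolding digits_def by (rule measurable_component_singleton) simp

lemma measurable_digits_component:
  assumes f: "f \<in> M \<rightarrow>\<^sub>M digits"
  shows "(\<lambda>x. f x n) \<in> M \<rightarrow>\<^sub>M digit"
  using measurable_compose[OF f measurable_digit_at] .

lemma measurable_digits:
  assumes "\<And>n. (\<lambda>x. f x n) \<in> M \<rightarrow>\<^sub>M digit"
  shows "f \<in> M \<rightarrow>\<^sub>M digits"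
  unfolding digits_def using assms by (intro measurable_PiM_single') auto

lemma measurable_from_digit: "f \<in> digit \<rightarrow>\<^sub>M count_space UNIV"
  by (simp add: measurable_def)

lemma pred_digit_eq [measurable]: "Measurable.pred digit (\<lambda>c. c = d)"
  by (rule measurable_from_digit)

lemma case_nat_digits [measurable]: "case_nat c \<in> digits \<rightarrow>\<^sub>M digits"
proof (rule measurable_digits)
  fix n show "(\<lambda>x. case_nat c x n) \<in> digits \<rightarrow>\<^sub>M digit"
    by (cases n) (simp_all add: measurable_digit_at)
qed

lemma Suc_digits [measurable]: "(\<lambda>x n. x (Suc n)) \<in> digits \<rightarrow>\<^sub>M digits"
  by (intro measurable_digits measurable_digit_at)

lemma nn_integral_digits_split:
  fixes f :: "(nat \<Rightarrow> 'f::finite) \<Rightarrow> ennreal"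
  assumes [measurable]: "f \<in> borel_measurable digits"
  shows "(\<integral>\<^sup>+x. f x \<partial>digits) = (\<Sum>c\<in>UNIV. \<integral>\<^sup>+x. f (case_nat c x) \<partial>digits) / ennreal CARD('f)"
proof -
  have [measurable]: "(\<lambda>(s, \<omega>). case_nat s \<omega>) \<in> digit \<Otimes>\<^sub>M digits \<rightarrow>\<^sub>M digits"
  proof (rule measurable_digits)
    fix n show "(\<lambda>x. (case x of (s, \<omega>) \<Rightarrow> case_nat s \<omega>) n) \<in> digit \<Otimes>\<^sub>M digits \<rightarrow>\<^sub>M digit"
      by (cases n) (simp_all add: case_prod_beta measurable_digits_component)
  qed
  have "(\<integral>\<^sup>+x. f x \<partial>digits) = (\<integral>\<^sup>+x. f x \<partial>distr (digit \<Otimes>\<^sub>M digits) digits (\<lambda>(s, \<omega>). case_nat s \<omega>))"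
    unfolding digit_seq.PiM_iter[folded digits_def] ..
  also have "\<dots> = (\<integral>\<^sup>+p. f (case_nat (fst p) (snd p)) \<partial>(digit \<Otimes>\<^sub>M digits))"
    by (subst nn_integral_distr) (simp_all add: case_prod_beta)
  also have "\<dots> = (\<integral>\<^sup>+c. \<integral>\<^sup>+x. f (case_nat c x) \<partial>digits \<partial>digit)"
  proof -
    have "(\<lambda>p. f (case_nat (fst p) (snd p))) \<in> borel_measurable (digit \<Otimes>\<^sub>M digits)"
      using measurable_compose[OF \<open>(\<lambda>(s, \<omega>). case_nat s \<omega>) \<in> _\<close> assms] by (simp add: case_prod_beta)
    from digits.nn_integral_fst[OF this] show ?thesis
      by simp
  qed
  also have "\<dots> = (\<Sum>c\<in>UNIV. \<integral>\<^sup>+x. f (case_nat c x) \<partial>digits) / ennreal CARD('f)"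
    unfolding digit_def by (subst nn_integral_pmf_of_set) (simp_all add: ennreal_of_nat_eq_real_of_nat)
  finally show ?thesis .
qed

lemma emeasure_haar:
  assumes "E \<in> sets haar"
  shows "emeasure haar E = (\<integral>\<^sup>+x. \<integral>\<^sup>+y. \<integral>\<^sup>+z. indicator E (x, y, z) \<partial>digits \<partial>digits \<partial>digits)"
    "(\<lambda>x. \<integral>\<^sup>+y. \<integral>\<^sup>+z. indicator E (x, y, z) \<partial>digits \<partial>digits :: ennreal) \<in> borel_measurable digits"
    "(\<lambda>y. \<integral>\<^sup>+z. indicator E (x, y, z) \<partial>digits :: ennreal) \<in> borel_measurable digits"
    "(\<lambda>z. indicator E (x, y, z) :: ennreal) \<in> borel_measurable digits"
proof -
  have E: "(indicator E :: _ \<Rightarrow> ennreal) \<in> borel_measurable (digits \<Otimes>\<^sub>M (digits \<Otimes>\<^sub>M digits))"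
    using assms by (simp add: haar_def)
  have E1: "(\<lambda>w. indicator E (x, w) :: ennreal) \<in> borel_measurable (digits \<Otimes>\<^sub>M digits)" for x
    by (rule measurable_Pair2[OF E]) simp
  have inner: "(\<integral>\<^sup>+w. indicator E (x, w) \<partial>(digits \<Otimes>\<^sub>M digits)) = (\<integral>\<^sup>+y. \<integral>\<^sup>+z. indicator E (x, y, z) \<partial>digits \<partial>digits)" for x
    by (rule digits.nn_integral_fst[OF E1, symmetric])
  have "emeasure haar E = (\<integral>\<^sup>+v. indicator E v \<partial>(digits \<Otimes>\<^sub>M (digits \<Otimes>\<^sub>M digits)))"
    using assms by (simp add: haar_def)
  also have "\<dots> = (\<integral>\<^sup>+x. \<integral>\<^sup>+w. indicator E (x, w) \<partial>(digits \<Otimes>\<^sub>M digits) \<partial>digits)"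
    by (rule digits2.nn_integral_fst[OF E, symmetric])
  finally show "emeasure haar E = (\<integral>\<^sup>+x. \<integral>\<^sup>+y. \<integral>\<^sup>+z. indicator E (x, y, z) \<partial>digits \<partial>digits \<partial>digits)"
    unfolding inner .
  show "(\<lambda>x. \<integral>\<^sup>+y. \<integral>\<^sup>+z. indicator E (x, y, z) \<partial>digits \<partial>digits :: ennreal) \<in> borel_measurable digits"
    using digits2.borel_measurable_nn_integral_fst[OF E] unfolding inner .
  show "(\<lambda>y. \<integral>\<^sup>+z. indicator E (x, y, z) \<partial>digits :: ennreal) \<in> borel_measurable digits"
    by (rule digits.borel_measurable_nn_integral_fst[OF E1])
  show "(\<lambda>z. indicator E (x, y, z) :: ennreal) \<in> borel_measurable digits"
    by (rule measurable_Pair2[OF E1]) simp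
qed

fun cons1 cons2 cons3 :: "'f \<Rightarrow> 'f digits3 \<Rightarrow> 'f digits3" where
  "cons1 c (x, y, z) = (case_nat c x, y, z)"
| "cons2 c (x, y, z) = (x, case_nat c y, z)"
| "cons3 c (x, y, z) = (x, y, case_nat c z)"

fun tail1 tail2 tail3 :: "'f digits3 \<Rightarrow> 'f digits3" where
  "tail1 (x, y, z) = (\<lambda>n. x (Suc n), y, z)"
| "tail2 (x, y, z) = (x, \<lambda>n. y (Suc n), z)"
| "tail3 (x, y, z) = (x, y, \<lambda>n. z (Suc n))"

fun head :: "'f digits3 \<Rightarrow> 'f vec3" where
  "head (x, y, z) = (x 0, y 0, z 0)"

lemma cons_measurable [measurable]:
  "cons1 c \<in> haar \<rightarrow>\<^sub>M haar" "cons2 c \<in> haar \<rightarrow>\<^sub>M haar" "cons3 c \<in> haar \<rightarrow>\<^sub>M haar"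
proof -
  have "cons1 c = (\<lambda>v. (case_nat c (fst v), fst (snd v), snd (snd v)))"
    "cons2 c = (\<lambda>v. (fst v, case_nat c (fst (snd v)), snd (snd v)))"
    "cons3 c = (\<lambda>v. (fst v, fst (snd v), case_nat c (snd (snd v))))"
    by (auto simp: fun_eq_iff)
  then show "cons1 c \<in> haar \<rightarrow>\<^sub>M haar" "cons2 c \<in> haar \<rightarrow>\<^sub>M haar" "cons3 c \<in> haar \<rightarrow>\<^sub>M haar"
    unfolding haar_def by simp_all
qed

lemma tail_measurable [measurable]:
  "tail1 \<in> haar \<rightarrow>\<^sub>M haar" "tail2 \<in> haar \<rightarrow>\<^sub>M haar" "tail3 \<in> haar \<rightarrow>\<^sub>M haar"
proof -
  have eq: "tail1 = (\<lambda>v. ((\<lambda>x n. x (Suc n)) (fst v), fst (snd v), snd (snd v)))"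
    "tail2 = (\<lambda>v. (fst v, (\<lambda>x n. x (Suc n)) (fst (snd v)), snd (snd v)))"
    "tail3 = (\<lambda>v. (fst v, fst (snd v), (\<lambda>x n. x (Suc n)) (snd (snd v))))"
    by (auto simp: fun_eq_iff)
  have t: "(\<lambda>v. (\<lambda>x n. x (Suc n)) (f v)) \<in> M \<rightarrow>\<^sub>M digits" if "f \<in> M \<rightarrow>\<^sub>M digits" for f and M :: "'b measure"
    using measurable_compose[OF that Suc_digits] .
  show "tail1 \<in> haar \<rightarrow>\<^sub>M haar" "tail2 \<in> haar \<rightarrow>\<^sub>M haar" "tail3 \<in> haar \<rightarrow>\<^sub>M haar"
    unfolding haar_def eq by (intro measurable_Pair t; measurable)+
qed

lemma haar_head_sets: "{v. Q (head v)} \<in> sets (haar :: 'f::finite digits3 measure)"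
proof -
  have "{v \<in> space haar. head v = d} \<in> sets haar" for d :: "'f vec3"
  proof -
    have comp: "(\<lambda>v. f v 0) -` {c} \<in> sets haar"
      if "f \<in> haar \<rightarrow>\<^sub>M digits" for f :: "'f digits3 \<Rightarrow> nat \<Rightarrow> 'f" and c
      using measurable_sets[OF measurable_digits_component[OF that, of 0], of "{c}"] by simp
    have "{v. head v = d} = (\<lambda>v. fst v 0) -` {fst d} \<inter> (\<lambda>v. fst (snd v) 0) -` {fst (snd d)}
        \<inter> (\<lambda>v. snd (snd v) 0) -` {snd (snd d)}"
      by auto
    also have "\<dots> \<in> sets haar"
      by (intro sets.Int comp) (simp_all add: haar_def)
    finally show ?thesis
      by simp
  qed
  then have "(\<Union>d\<in>{d. Q d}. {v. head v = d}) \<in> sets (haar :: 'f digits3 measure)"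
    by (intro sets.finite_UN) simp_all
  also have "(\<Union>d\<in>{d. Q d}. {v. head v = d}) = {v. Q (head v)}"
    by auto
  finally show ?thesis .
qed

lemma haar_vimage: "f \<in> haar \<rightarrow>\<^sub>M haar \<Longrightarrow> E \<in> sets haar \<Longrightarrow> {v. f v \<in> E} \<in> sets haar"
  using measurable_sets[of f haar haar E] by (simp add: vimage_def)

text \<open>Conditioning on the leading digit of one coordinate; this is the source of the factor
  1/q by which multiplication of a coordinate by t scales the measure.\<close>

lemma measure_haar_split:
  fixes E :: "'f::finite digits3 set"
  assumes E: "E \<in> sets haar"
  shows "measure haar E = (\<Sum>c\<in>UNIV. measure haar {v. cons1 c v \<in> E}) / CARD('f)"
    "measure haar E = (\<Sum>c\<in>UNIV. measure haar {v. cons2 c v \<in> E}) / CARD('f)"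
    "measure haar E = (\<Sum>c\<in>UNIV. measure haar {v. cons3 c v \<in> E}) / CARD('f)"
proof -
  interpret haar: prob_space haar by (rule prob_space_haar)
  note E' = E[THEN haar_vimage[OF cons_measurable(1)]] E[THEN haar_vimage[OF cons_measurable(2)]]
    E[THEN haar_vimage[OF cons_measurable(3)]]
  have conv: "measure haar E = (\<Sum>c\<in>UNIV. measure haar (F c)) / CARD('f)"
    if "emeasure haar E = (\<Sum>c\<in>UNIV. emeasure haar (F c)) / ennreal CARD('f)" for F :: "'f \<Rightarrow> 'f digits3 set"
  proof -
    have "ennreal (measure haar E) = ennreal ((\<Sum>c\<in>UNIV. measure haar (F c)) / CARD('f))"
      using that by (simp add: haar.emeasure_eq_measure sum_nonneg divide_ennreal)
    then show ?thesis
      by (subst (asm) ennreal_inj) (auto intro!: divide_nonneg_nonneg sum_nonneg)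
  qed
  have ind: "indicator {v. cons1 c v \<in> E} (x, y, z) = (indicator E (case_nat c x, y, z) :: ennreal)"
      "indicator {v. cons2 c v \<in> E} (x, y, z) = (indicator E (x, case_nat c y, z) :: ennreal)"
      "indicator {v. cons3 c v \<in> E} (x, y, z) = (indicator E (x, y, case_nat c z) :: ennreal)" for c x y z
    by (simp_all add: indicator_def)
  note em1 = emeasure_haar[OF E'(1), unfolded ind] and em2 = emeasure_haar[OF E'(2), unfolded ind]
    and em3 = emeasure_haar[OF E'(3), unfolded ind]
  have avg: "(\<integral>\<^sup>+x. (\<Sum>c\<in>UNIV. f c x) / ennreal CARD('f) \<partial>digits) = (\<Sum>c\<in>UNIV. \<integral>\<^sup>+x. f c x \<partial>digits) / ennreal CARD('f)"
    if f: "\<And>c. f c \<in> borel_measurable digits" for f :: "'f \<Rightarrow> (nat \<Rightarrow> 'f) \<Rightarrow> ennreal"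
    using f by (subst nn_integral_divide) (simp_all add: nn_integral_sum)
  show "measure haar E = (\<Sum>c\<in>UNIV. measure haar {v. cons1 c v \<in> E}) / CARD('f)"
  proof (rule conv)
    show "emeasure haar E = (\<Sum>c\<in>UNIV. emeasure haar {v. cons1 c v \<in> E}) / ennreal CARD('f)"
      unfolding em1(1) emeasure_haar(1)[OF E] by (rule nn_integral_digits_split[OF emeasure_haar(2)[OF E]])
  qed
  show "measure haar E = (\<Sum>c\<in>UNIV. measure haar {v. cons2 c v \<in> E}) / CARD('f)"
  proof (rule conv)
    have "emeasure haar E = (\<integral>\<^sup>+x. (\<Sum>c\<in>UNIV. \<integral>\<^sup>+y. \<integral>\<^sup>+z. indicator E (x, case_nat c y, z) \<partial>digits \<partial>digits) / ennreal CARD('f) \<partial>digits)"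
      unfolding emeasure_haar(1)[OF E] by (intro nn_integral_cong nn_integral_digits_split emeasure_haar(3)[OF E])
    then show "emeasure haar E = (\<Sum>c\<in>UNIV. emeasure haar {v. cons2 c v \<in> E}) / ennreal CARD('f)"
      unfolding em2(1) by (simp only: avg[OF em2(2)])
  qed
  show "measure haar E = (\<Sum>c\<in>UNIV. measure haar {v. cons3 c v \<in> E}) / CARD('f)"
  proof (rule conv)
    have "emeasure haar E = (\<integral>\<^sup>+x. \<integral>\<^sup>+y. (\<Sum>c\<in>UNIV. \<integral>\<^sup>+z. indicator E (x, y, case_nat c z) \<partial>digits) / ennreal CARD('f) \<partial>digits \<partial>digits)"
      unfolding emeasure_haar(1)[OF E] by (intro nn_integral_cong nn_integral_digits_split emeasure_haar(4)[OF E])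
    then show "emeasure haar E = (\<Sum>c\<in>UNIV. emeasure haar {v. cons3 c v \<in> E}) / ennreal CARD('f)"
      unfolding em3(1) by (simp only: avg[OF em3(3)] avg[OF em3(2)])
  qed
qed

text \<open>Addition of series has no carries, so a translation permutes each digit
  separately.\<close>

lemma distr_digits_translate:
  fixes t :: "nat \<Rightarrow> 'f::{finite,field}"
  shows "(\<lambda>x n. x n + t n) \<in> digits \<rightarrow>\<^sub>M digits" "distr digits digits (\<lambda>x n. x n + t n) = digits"
proof -
  show meas [measurable]: "(\<lambda>x n. x n + t n) \<in> digits \<rightarrow>\<^sub>M digits"
  proof (rule measurable_digits)
    fix n
    have "(\<lambda>c. c + t n) \<in> digit \<rightarrow>\<^sub>M digit"
      by (simp add: measurable_def)
    then show "(\<lambda>x. x n + t n) \<in> digits \<rightarrow>\<^sub>M digit"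
      by (rule measurable_compose[OF measurable_digit_at])
  qed
  show "distr digits digits (\<lambda>x n. x n + t n) = digits"
    unfolding digits_def[symmetric]
  proof (subst (3) digits_def, rule digit_seq.PiM_eq)
    show "sets (distr digits digits (\<lambda>x n. x n + t n)) = sets (\<Pi>\<^sub>M n\<in>UNIV. digit)"
      by (simp add: digits_def)
    fix J :: "nat set" and F :: "nat \<Rightarrow> 'f set"
    assume J: "finite J"
    have "prod_emb UNIV (\<lambda>_. digit) J (Pi\<^sub>E J F) \<in> sets digits"
      unfolding digits_def using J by (intro sets_PiM_I) auto
    then have "emeasure (distr digits digits (\<lambda>x n. x n + t n)) (prod_emb UNIV (\<lambda>_. digit) J (Pi\<^sub>E J F))
        = emeasure digits ((\<lambda>x n. x n + t n) -` prod_emb UNIV (\<lambda>_. digit) J (Pi\<^sub>E J F))"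
      by (simp add: emeasure_distr)
    also have "(\<lambda>x n. x n + t n) -` prod_emb UNIV (\<lambda>_. digit) J (Pi\<^sub>E J F)
        = prod_emb UNIV (\<lambda>_. digit) J (\<Pi>\<^sub>E j\<in>J. {c. c + t j \<in> F j})"
      by (auto simp: prod_emb_def PiE_iff extensional_def)
    also have "emeasure digits \<dots> = (\<Prod>j\<in>J. emeasure digit {c. c + t j \<in> F j})"
      unfolding digits_def using J by (intro digit_seq.emeasure_PiM_emb) auto
    also have "\<dots> = (\<Prod>j\<in>J. emeasure digit (F j))"
    proof (intro prod.cong refl)
      fix j
      have "card {c. c + t j \<in> F j} = card (F j)"
        by (rule bij_betw_same_card[of "\<lambda>c. c + t j"]) (rule bij_betw_byWitness[where f'="\<lambda>c. c - t j"]; auto)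
      then show "emeasure digit {c. c + t j \<in> F j} = emeasure digit (F j)"
        by (simp add: digit_def emeasure_pmf_of_set)
    qed
    finally show "emeasure (distr digits digits (\<lambda>x n. x n + t n)) (prod_emb UNIV (\<lambda>_. digit) J (Pi\<^sub>E J F))
        = (\<Prod>j\<in>J. emeasure digit (F j))" .
  qed
qed

lemma emeasure_digits_translate:
  fixes t :: "nat \<Rightarrow> 'f::{finite,field}"
  assumes "E \<in> sets digits"
  shows "emeasure digits {x. (\<lambda>n. x n + t n) \<in> E} = emeasure digits E"
proof -
  have "emeasure digits E = emeasure (distr digits digits (\<lambda>x n. x n + t n)) E"
    by (simp add: distr_digits_translate(2))
  also have "\<dots> = emeasure digits {x. (\<lambda>n. x n + t n) \<in> E}"
    using assms by (simp add: emeasure_distr[OF distr_digits_translate(1)] vimage_def)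
  finally show ?thesis ..
qed

lemma haar_digit_sets: "{v. Q (fst v n, fst (snd v) n, snd (snd v) n)} \<in> sets (haar :: 'f::finite digits3 measure)"
proof -
  define s where "s = (tail1 \<circ> tail2 \<circ> tail3 :: 'f digits3 \<Rightarrow> 'f digits3)"
  have s: "s \<in> haar \<rightarrow>\<^sub>M haar"
    unfolding s_def
    by (rule measurable_comp[OF tail_measurable(3) measurable_comp[OF tail_measurable(2,1)]])
  have "s ^^ n \<in> haar \<rightarrow>\<^sub>M haar"
  proof (induction n)
    case (Suc n)
    then show ?case
      unfolding funpow.simps by (rule measurable_comp[OF _ s])
  qed (simp add: id_def)
  then have "{v. (s ^^ n) v \<in> {v. Q (head v)}} \<in> sets haar"
    by (intro haar_vimage haar_head_sets)
  also have "head ((s ^^ n) v) = (fst v n, fst (snd v) n, snd (snd v) n)" for v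
  proof (induction n arbitrary: v)
    case 0
    show ?case
      by (cases v) simp
  next
    case (Suc n)
    have "(s ^^ Suc n) v = (s ^^ n) (s v)"
      by (simp only: funpow_Suc_right o_apply)
    moreover have "fst (s v) n = fst v (Suc n)" "fst (snd (s v)) n = fst (snd v) (Suc n)"
        "snd (snd (s v)) n = snd (snd v) (Suc n)"
      by (cases v; simp add: s_def)+
    ultimately show ?case
      using Suc[of "s v"] by simp
  qed
  then have "{v. (s ^^ n) v \<in> {v. Q (head v)}} = {v. Q (fst v n, fst (snd v) n, snd (snd v) n)}"
    by simp
  finally show ?thesis .
qed

lemma digitwise_measurable: "digitwise k \<in> (haar :: 'f::finite digits3 measure) \<rightarrow>\<^sub>M haar"
proof -
  have comp: "(\<lambda>v n. p (k (fst v n, fst (snd v) n, snd (snd v) n))) \<in> (haar :: 'f digits3 measure) \<rightarrow>\<^sub>M digits"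
    for p :: "'f vec3 \<Rightarrow> 'f"
  proof (rule measurable_digits)
    fix n
    show "(\<lambda>v. p (k (fst v n, fst (snd v) n, snd (snd v) n))) \<in> (haar :: 'f digits3 measure) \<rightarrow>\<^sub>M digit"
    proof (rule measurableI)
      fix A :: "'f set"
      show "(\<lambda>v. p (k (fst v n, fst (snd v) n, snd (snd v) n))) -` A \<inter> space haar \<in> sets haar"
        using haar_digit_sets[of "\<lambda>d. p (k d) \<in> A" n] by (simp add: vimage_def)
    qed simp
  qed
  have eq: "digitwise k = (\<lambda>v. (\<lambda>n. fst (k (fst v n, fst (snd v) n, snd (snd v) n)),
      \<lambda>n. fst (snd (k (fst v n, fst (snd v) n, snd (snd v) n))),
      \<lambda>n. snd (snd (k (fst v n, fst (snd v) n, snd (snd v) n)))))"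
    by (auto simp: fun_eq_iff)
  have "digitwise k \<in> (haar :: 'f digits3 measure) \<rightarrow>\<^sub>M digits \<Otimes>\<^sub>M (digits \<Otimes>\<^sub>M digits)"
    unfolding eq
    by (intro measurable_Pair comp[of fst] comp[of "\<lambda>d. fst (snd d)"] comp[of "\<lambda>d. snd (snd d)"])
  then show ?thesis
    by (simp only: haar_def[symmetric])
qed

text \<open>Each generator is a shear, translating one coordinate by a function of the others, so
  Fubini reduces the claim to translation invariance.\<close>

lemma emeasure_haar_digitwise:
  fixes E :: "'f::{finite,field} digits3 set"
  assumes k: "k \<in> SL3" and E: "E \<in> sets haar"
  shows "emeasure haar {v. digitwise k v \<in> E} = emeasure haar E"
proof -
  have e12: "emeasure haar {v. digitwise (e12 c) v \<in> E} = emeasure haar E" if E: "E \<in> sets haar"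
    for c and E :: "'f digits3 set"
  proof -
    have E': "{v. digitwise (e12 c) v \<in> E} \<in> sets (digits \<Otimes>\<^sub>M (digits \<Otimes>\<^sub>M digits))"
      using haar_vimage[OF digitwise_measurable E] by (simp add: haar_def)
    have E2: "E \<in> sets (digits \<Otimes>\<^sub>M (digits \<Otimes>\<^sub>M digits))"
      using E by (simp add: haar_def)
    have "emeasure digits ((\<lambda>x. (x, w)) -` {v. digitwise (e12 c) v \<in> E}) = emeasure digits ((\<lambda>x. (x, w)) -` E)" for w
    proof -
      have "(\<lambda>x. (x, w)) -` {v. digitwise (e12 c) v \<in> E} = {x. (\<lambda>n. x n + c * fst w n) \<in> (\<lambda>x. (x, w)) -` E}"
        by (cases w) (auto simp: vimage_def)
      then show ?thesis
        using emeasure_digits_translate[OF sets_Pair2[OF E2], of "\<lambda>n. c * fst w n" w] by simp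
    qed
    then show ?thesis
      unfolding haar_def haar.emeasure_pair_measure_alt2[OF E'] haar.emeasure_pair_measure_alt2[OF E2] by simp
  qed
  have e23: "emeasure haar {v. digitwise (e23 c) v \<in> E} = emeasure haar E" if E: "E \<in> sets haar"
    for c and E :: "'f digits3 set"
  proof -
    have E': "{v. digitwise (e23 c) v \<in> E} \<in> sets (digits \<Otimes>\<^sub>M (digits \<Otimes>\<^sub>M digits))"
      using haar_vimage[OF digitwise_measurable E] by (simp add: haar_def)
    have E2: "E \<in> sets (digits \<Otimes>\<^sub>M (digits \<Otimes>\<^sub>M digits))"
      using E by (simp add: haar_def)
    have "emeasure (digits \<Otimes>\<^sub>M digits) (Pair x -` {v. digitwise (e23 c) v \<in> E}) = emeasure (digits \<Otimes>\<^sub>M digits) (Pair x -` E)" for x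
    proof -
      have "emeasure digits ((\<lambda>y. (y, z)) -` (Pair x -` {v. digitwise (e23 c) v \<in> E}))
          = emeasure digits ((\<lambda>y. (y, z)) -` (Pair x -` E))" for z
      proof -
        have "(\<lambda>y. (y, z)) -` (Pair x -` {v. digitwise (e23 c) v \<in> E})
            = {y. (\<lambda>n. y n + c * z n) \<in> (\<lambda>y. (y, z)) -` (Pair x -` E)}"
          by (auto simp: vimage_def)
        then show ?thesis
          using emeasure_digits_translate[OF sets_Pair2[OF sets_Pair1[OF E2, of x], of z], of "\<lambda>n. c * z n"] by simp
      qed
      then show ?thesis
        unfolding digits2.emeasure_pair_measure_alt2[OF sets_Pair1[OF E2]]
          digits2.emeasure_pair_measure_alt2[OF sets_Pair1[OF E']] by simp
    qed
    then show ?thesis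
      unfolding haar_def digits2.emeasure_pair_measure_alt[OF E'] digits2.emeasure_pair_measure_alt[OF E2] by simp
  qed
  have e31: "emeasure haar {v. digitwise (e31 c) v \<in> E} = emeasure haar E" if E: "E \<in> sets haar"
    for c and E :: "'f digits3 set"
  proof -
    have E': "{v. digitwise (e31 c) v \<in> E} \<in> sets (digits \<Otimes>\<^sub>M (digits \<Otimes>\<^sub>M digits))"
      using haar_vimage[OF digitwise_measurable E] by (simp add: haar_def)
    have E2: "E \<in> sets (digits \<Otimes>\<^sub>M (digits \<Otimes>\<^sub>M digits))"
      using E by (simp add: haar_def)
    have "emeasure (digits \<Otimes>\<^sub>M digits) (Pair x -` {v. digitwise (e31 c) v \<in> E}) = emeasure (digits \<Otimes>\<^sub>M digits) (Pair x -` E)" for x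
    proof -
      have "emeasure digits (Pair y -` (Pair x -` {v. digitwise (e31 c) v \<in> E}))
          = emeasure digits (Pair y -` (Pair x -` E))" for y
      proof -
        have "Pair y -` (Pair x -` {v. digitwise (e31 c) v \<in> E})
            = {z. (\<lambda>n. z n + c * x n) \<in> Pair y -` (Pair x -` E)}"
          by (auto simp: vimage_def)
        then show ?thesis
          using emeasure_digits_translate[OF sets_Pair1[OF sets_Pair1[OF E2, of x], of y], of "\<lambda>n. c * x n"] by simp
      qed
      then show ?thesis
        unfolding digits.emeasure_pair_measure_alt[OF sets_Pair1[OF E2]]
          digits.emeasure_pair_measure_alt[OF sets_Pair1[OF E']] by simp
    qed
    then show ?thesis
      unfolding haar_def digits2.emeasure_pair_measure_alt[OF E'] digits2.emeasure_pair_measure_alt[OF E2] by simp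
  qed
  have comp: "emeasure haar {v. digitwise (e \<circ> k) v \<in> E} = emeasure haar E"
    if e: "\<And>E. E \<in> sets haar \<Longrightarrow> emeasure haar {v. digitwise e v \<in> E} = emeasure haar E"
      and k: "\<And>E. E \<in> sets haar \<Longrightarrow> emeasure haar {v. digitwise k v \<in> E} = emeasure haar E" and E: "E \<in> sets haar"
    for e k :: "'f vec3 \<Rightarrow> 'f vec3" and E
    using k[OF haar_vimage[OF digitwise_measurable[of e] E]] e[OF E] by (simp add: digitwise_comp)
  from k E show ?thesis
  proof (induction arbitrary: E rule: SL3.induct)
    case id
    then show ?case
      unfolding digitwise_id by simp
  next
    case (e12 k c)
    show ?case
      by (rule comp[OF _ e12.IH e12.prems]) (rule \<open>\<And>E c. E \<in> sets haar \<Longrightarrow> emeasure haar {v. digitwise (Submission.e12 c) v \<in> E} = emeasure haar E\<close>)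
  next
    case (e23 k c)
    show ?case
      by (rule comp[OF _ e23.IH e23.prems]) (rule \<open>\<And>E c. E \<in> sets haar \<Longrightarrow> emeasure haar {v. digitwise (Submission.e23 c) v \<in> E} = emeasure haar E\<close>)
  next
    case (e31 k c)
    show ?case
      by (rule comp[OF _ e31.IH e31.prems]) (rule \<open>\<And>E c. E \<in> sets haar \<Longrightarrow> emeasure haar {v. digitwise (Submission.e31 c) v \<in> E} = emeasure haar E\<close>)
  qed
qed

lemma head_digitwise [simp]: "head (digitwise k v) = k (head v)"
  by (cases v) simp

text \<open>Every nonzero Laurent vector is a power of t times exactly one of these, so they
  represent such vectors modulo powers of t.\<close>

definition primitive :: "'f::field digits3 set" where
  "primitive = {v. head v \<noteq> (0, 0, 0)}"

lemma primitive_sets [measurable]: "primitive \<in> sets (haar :: 'f::{finite,field} digits3 measure)"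
  unfolding primitive_def by (rule haar_head_sets)

lemma digitwise_primitive: "k \<in> SL3 \<Longrightarrow> digitwise k v \<in> primitive \<longleftrightarrow> v \<in> primitive"
  by (simp add: primitive_def SL3_nonzero)

text \<open>Averaging over \<open>SL3\<close>, which is transitive on the leading digits of primitive vectors, turns
  any density depending on the leading digits only into a constant.\<close>

lemma average_SL3:
  fixes w :: "'f::{finite,field} vec3 \<Rightarrow> real" and E :: "'f digits3 set"
  assumes E: "E \<in> sets haar" and w: "(\<Sum>d\<in>UNIV - {(0, 0, 0)}. w d) = CARD('f vec3) - 1"
  shows "(\<Sum>k\<in>SL3. \<Sum>d\<in>UNIV - {(0, 0, 0)}. w d * measure haar {v. digitwise k v \<in> E \<and> head v = d})
    = card (SL3 :: ('f vec3 \<Rightarrow> 'f vec3) set) * measure haar (primitive \<inter> E)"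
proof -
  interpret haar: prob_space haar by (rule prob_space_haar)
  let ?D = "UNIV - {(0, 0, 0) :: 'f vec3}"
  define m where "m d = measure haar (E \<inter> {v. head v = d})" for d
  \<comment> \<open>As \<open>k\<close> is injective, the condition on the leading digits of v
    becomes one on those of kv, and \<open>k\<close> preserves the Haar measure.\<close>
  have kd: "measure haar {v. digitwise k v \<in> E \<and> head v = d} = m (k d)" if k: "k \<in> SL3" for k d
  proof -
    obtain k' where k': "k' \<circ> k = id"
      using SL3_inverse[OF k] by metis
    have "k a = k b \<longleftrightarrow> a = b" for a b
      using k' by (metis comp_apply id_apply)
    then have "{v. digitwise k v \<in> E \<and> head v = d} = {v. digitwise k v \<in> E \<inter> {v. head v = k d}}"
      by auto
    then have "emeasure haar {v. digitwise k v \<in> E \<and> head v = d} = emeasure haar (E \<inter> {v. head v = k d})"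
      using emeasure_haar_digitwise[OF k sets.Int[OF E haar_head_sets]] by simp
    then show ?thesis
      by (simp add: m_def measure_def)
  qed
  define h where "h d = (\<Sum>k\<in>SL3. m (k d))" for d
  \<comment> \<open>A sum over the group does not change under right translation by an element
    carrying \<open>a\<close> to \<open>b\<close>.\<close>
  have h: "h a = h b" if ab: "a \<in> ?D" "b \<in> ?D" for a b
  proof -
    obtain k0 where k0: "k0 \<in> SL3" "k0 a = b"
      by (rule SL3_transitive[of a b]) (use ab in auto)
    obtain k1 where k1: "k1 \<in> SL3" "k0 \<circ> k1 = id" "k1 \<circ> k0 = id"
      using SL3_inverse[OF k0(1)] by metis
    have "h b = (\<Sum>k\<in>SL3. m ((k \<circ> k0) a))"
      by (simp add: h_def k0)
    also have "\<dots> = h a"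
      unfolding h_def
      by (rule sum.reindex_bij_witness[of _ "\<lambda>k. k \<circ> k1" "\<lambda>k. k \<circ> k0"])
        (use k0 k1 in \<open>auto simp: SL3_comp o_assoc[symmetric]\<close>)
    finally show ?thesis ..
  qed
  have prim: "measure haar (primitive \<inter> F) = (\<Sum>d\<in>?D. measure haar (F \<inter> {v. head v = d}))" if F: "F \<in> sets haar" for F
  proof -
    have "primitive \<inter> F = (\<Union>d\<in>?D. F \<inter> {v. head v = d})"
      by (auto simp: primitive_def)
    also have "measure haar \<dots> = (\<Sum>d\<in>?D. measure haar (F \<inter> {v. head v = d}))"
      using F by (intro haar.finite_measure_finite_Union) (auto simp: disjoint_family_on_def intro!: sets.Int haar_head_sets)
    finally show ?thesis .
  qed
  have sum_h: "(\<Sum>d\<in>?D. h d) = card (SL3 :: ('f vec3 \<Rightarrow> 'f vec3) set) * measure haar (primitive \<inter> E)"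
  proof -
    have "(\<Sum>d\<in>?D. h d) = (\<Sum>k\<in>SL3. \<Sum>d\<in>?D. measure haar {v. digitwise k v \<in> E \<and> head v = d})"
      unfolding h_def by (subst sum.swap) (simp add: kd)
    also have "\<dots> = (\<Sum>k\<in>(SL3 :: ('f vec3 \<Rightarrow> 'f vec3) set). measure haar (primitive \<inter> E))"
    proof (intro sum.cong refl)
      fix k :: "'f vec3 \<Rightarrow> 'f vec3" assume k: "k \<in> SL3"
      have "(\<Sum>d\<in>?D. measure haar {v. digitwise k v \<in> E \<and> head v = d}) = measure haar (primitive \<inter> {v. digitwise k v \<in> E})"
        unfolding prim[OF haar_vimage[OF digitwise_measurable E]] by (simp add: Int_def)
      also have "primitive \<inter> {v. digitwise k v \<in> E} = {v. digitwise k v \<in> primitive \<inter> E}"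
        using digitwise_primitive[OF k] by auto
      also have "measure haar \<dots> = measure haar (primitive \<inter> E)"
        using emeasure_haar_digitwise[OF k sets.Int[OF primitive_sets E]] by (simp add: measure_def)
      finally show "(\<Sum>d\<in>?D. measure haar {v. digitwise k v \<in> E \<and> head v = d}) = measure haar (primitive \<inter> E)" .
    qed
    finally show ?thesis
      by simp
  qed
  have one: "(1, 1, 1) \<in> ?D"
    by simp
  have hc: "h d = h (1, 1, 1)" if "d \<in> ?D" for d
    by (rule h[OF that one])
  have "card ?D = CARD('f vec3) - 1"
    by (simp add: card_Diff_subset)
  then have cD: "real (card ?D) = CARD('f vec3) - 1"
    using card_gt_0_iff[of "UNIV :: 'f vec3 set"] by (simp add: of_nat_diff Suc_le_eq)
  have "(\<Sum>k\<in>SL3. \<Sum>d\<in>?D. w d * measure haar {v. digitwise k v \<in> E \<and> head v = d}) = (\<Sum>d\<in>?D. w d * h d)"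
    unfolding h_def by (subst sum.swap) (simp add: kd sum_distrib_left)
  also have "\<dots> = (\<Sum>d\<in>?D. w d) * h (1, 1, 1)"
    unfolding sum_distrib_right by (intro sum.cong refl) (simp only: hc)
  \<comment> \<open>The weights have mean 1 over the nonzero digit vectors, and \<open>h\<close> is
    constant there.\<close>
  also have "\<dots> = (\<Sum>d\<in>?D. h d)"
  proof -
    have "(\<Sum>d\<in>?D. h d) = (\<Sum>d\<in>?D. h (1, 1, 1))"
      by (intro sum.cong refl hc)
    then show ?thesis
      unfolding w cD[symmetric] by simp
  qed
  finally show ?thesis
    unfolding sum_h .
qed

text \<open>The matrix diag(t, 1, 1) and its inverse, each followed by the power of t that makes the
  result primitive again.\<close>

fun dilate contract :: "'f::field digits3 \<Rightarrow> 'f digits3" where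
  "dilate (x, y, z) = (if (y 0, z 0) \<noteq> (0, 0) then (case_nat 0 x, y, z) else (x, \<lambda>n. y (Suc n), \<lambda>n. z (Suc n)))"
| "contract (x, y, z) = (if x 0 = 0 then (\<lambda>n. x (Suc n), y, z) else (x, case_nat 0 y, case_nat 0 z))"

lemma dilate_contract_measurable:
  "dilate \<in> (haar :: 'f::{finite,field} digits3 measure) \<rightarrow>\<^sub>M haar"
  "contract \<in> (haar :: 'f digits3 measure) \<rightarrow>\<^sub>M haar"
proof -
  have eq: "dilate = (\<lambda>v. if v \<in> {v. snd (head v) \<noteq> (0, 0)} then cons1 0 v else tail2 (tail3 v))"
    "contract = (\<lambda>v :: 'f digits3. if v \<in> {v. fst (head v) = 0} then tail1 v else cons2 0 (cons3 0 v))"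
    by (auto simp: fun_eq_iff)
  show "dilate \<in> (haar :: 'f digits3 measure) \<rightarrow>\<^sub>M haar"
    unfolding eq
    by (intro measurable_If_set cons_measurable measurable_compose[OF tail_measurable(3) tail_measurable(2)])
      (simp add: haar_head_sets[of "\<lambda>d. snd d \<noteq> (0, 0)"])
  show "contract \<in> (haar :: 'f digits3 measure) \<rightarrow>\<^sub>M haar"
    unfolding eq
    by (intro measurable_If_set tail_measurable measurable_compose[OF cons_measurable(3) cons_measurable(2)])
      (simp add: haar_head_sets[of "\<lambda>d. fst d = 0"])
qed

lemma dilate_contract_primitive:
  assumes "v \<in> primitive"
  shows "dilate v \<in> primitive" "contract v \<in> primitive" "dilate (contract v) = v" "contract (dilate v) = v"
  using assms by (cases v; auto simp: primitive_def fun_eq_iff split: nat.split)+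

section \<open>The projective action\<close>

lemma measure_head_split:
  fixes E :: "'f::finite digits3 set"
  assumes E: "E \<in> sets haar"
  shows "measure haar {v. v \<in> E \<and> Q (head v)} = (\<Sum>d\<in>{d. Q d}. measure haar {v. v \<in> E \<and> head v = d})"
proof -
  interpret haar: prob_space haar by (rule prob_space_haar)
  have s: "{v. v \<in> E \<and> head v = d} \<in> sets haar" for d
    using sets.Int[OF E haar_head_sets[of "\<lambda>e. e = d"]] by (simp add: Int_def)
  have "{v. v \<in> E \<and> Q (head v)} = (\<Union>d\<in>{d. Q d}. {v. v \<in> E \<and> head v = d})"
    by auto
  also have "measure haar \<dots> = (\<Sum>d\<in>{d. Q d}. measure haar {v. v \<in> E \<and> head v = d})"
    by (intro haar.finite_measure_finite_Union) (auto simp: disjoint_family_on_def intro: s)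
  finally show ?thesis .
qed

lemma head_cons [simp]:
  "head (cons1 c v) = (c, snd (head v))"
  "head (cons2 c v) = (fst (head v), c, snd (snd (head v)))"
  "head (cons3 c v) = (fst (head v), fst (snd (head v)), c)"
  by (cases v; simp)+

lemma tail_cons [simp]:
  "tail1 (cons1 c v) = v" "tail2 (cons2 c v) = v" "tail3 (cons3 c v) = v"
  "tail3 (cons2 c v) = cons2 c (tail3 v)"
  by (cases v; simp)+

lemma sum_delta_zero:
  fixes a :: real and f :: "'f::{finite,zero} \<Rightarrow> real"
  assumes "\<And>c. c \<noteq> 0 \<Longrightarrow> f c = 0"
  shows "(\<Sum>c\<in>UNIV. f c) = f 0"
proof -
  have "(\<Sum>c\<in>UNIV. f c) = (\<Sum>c\<in>{0}. f c)"
    by (rule sum.mono_neutral_right) (use assms in auto)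
  then show ?thesis
    by simp
qed

text \<open>The weights are the density of the image under \<open>dilate\<close>. Vectors with first
  digit 0 come from multiplying x by t, which shrinks the measure by q; the others come from
  dividing y and z by t, which stretches it by q^2.\<close>

lemma measure_dilate:
  fixes E :: "'f::{finite,field} digits3 set"
  assumes E: "E \<in> sets haar"
  shows "measure haar (primitive \<inter> {v. dilate v \<in> E})
    = (\<Sum>d\<in>UNIV - {(0, 0, 0)}. (if fst d = 0 then real CARD('f) else 1 / (real CARD('f))\<^sup>2) * measure haar {v. v \<in> E \<and> head v = d})"
proof -
  interpret haar: prob_space haar by (rule prob_space_haar)
  let ?q = "real CARD('f)"
  have q: "?q > 0"
    by simp
  define A where "A = {v. snd (head v) \<noteq> (0, 0) \<and> cons1 0 v \<in> E}"
  define B where "B = {v. snd (head v) = (0, 0) \<and> fst (head v) \<noteq> 0 \<and> tail2 (tail3 v) \<in> E}"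
  define E1 where "E1 = {v. v \<in> E \<and> (head v \<noteq> (0, 0, 0) \<and> fst (head v) = 0)}"
  define E2 where "E2 = {v. v \<in> E \<and> fst (head v) \<noteq> 0}"
  have A: "A \<in> sets haar"
    using sets.Int[OF haar_vimage[OF cons_measurable(1)[of 0] E] haar_head_sets[of "\<lambda>d. snd d \<noteq> (0, 0)"]]
    by (simp add: A_def Int_def conj_commute)
  have B: "B \<in> sets haar"
    using sets.Int[OF haar_vimage[OF measurable_compose[OF tail_measurable(3,2)] E]
        haar_head_sets[of "\<lambda>d. snd d = (0, 0) \<and> fst d \<noteq> 0"]]
    by (simp add: B_def Int_def conj_ac)
  have E1: "E1 \<in> sets haar"
    using sets.Int[OF E haar_head_sets[of "\<lambda>d. d \<noteq> (0, 0, 0) \<and> fst d = 0"]] by (simp add: E1_def Int_def)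
  have E2: "E2 \<in> sets haar"
    using sets.Int[OF E haar_head_sets[of "\<lambda>d. fst d \<noteq> 0"]] by (simp add: E2_def Int_def)
  have "primitive \<inter> {v. dilate v \<in> E} = A \<union> B"
    by (auto simp: primitive_def A_def B_def split: if_splits)
  moreover have "A \<inter> B = {}"
    by (auto simp: A_def B_def)
  ultimately have "measure haar (primitive \<inter> {v. dilate v \<in> E}) = measure haar A + measure haar B"
    using A B by (simp add: haar.finite_measure_Union)
  also have "measure haar A = ?q * measure haar E1"
  proof -
    have "(\<Sum>c\<in>UNIV. measure haar {v. cons1 c v \<in> E1}) = measure haar {v. cons1 0 v \<in> E1}"
      by (rule sum_delta_zero) (auto simp: E1_def)
    also have "{v. cons1 0 v \<in> E1} = A"
      by (auto simp: E1_def A_def)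
    finally show ?thesis
      using q by (simp add: measure_haar_split(1)[OF E1])
  qed
  also have "measure haar B = measure haar E2 / ?q\<^sup>2"
  proof -
    define C where "C = {v. cons2 0 v \<in> B}"
    have C: "C \<in> sets haar"
      unfolding C_def by (rule haar_vimage[OF cons_measurable(2) B])
    have "(\<Sum>c\<in>UNIV. measure haar {v. cons2 c v \<in> B}) = measure haar C"
      unfolding C_def by (rule sum_delta_zero) (auto simp: B_def)
    then have "measure haar B = measure haar C / ?q"
      using measure_haar_split(2)[OF B] by simp
    moreover have "(\<Sum>c\<in>UNIV. measure haar {v. cons3 c v \<in> C}) = measure haar {v. cons3 0 v \<in> C}"
      by (rule sum_delta_zero) (auto simp: B_def C_def)
    moreover have "{v. cons3 0 v \<in> C} = E2"
      by (auto simp: B_def C_def E2_def)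
    ultimately show ?thesis
      using measure_haar_split(3)[OF C] by (simp add: power2_eq_square)
  qed
  also have "measure haar E1 = (\<Sum>d\<in>{d. d \<noteq> (0, 0, 0) \<and> fst d = 0}. measure haar {v. v \<in> E \<and> head v = d})"
    unfolding E1_def by (rule measure_head_split[OF E])
  also have "measure haar E2 = (\<Sum>d\<in>{d. fst d \<noteq> 0}. measure haar {v. v \<in> E \<and> head v = d})"
    unfolding E2_def by (rule measure_head_split[OF E])
  finally have *: "measure haar (primitive \<inter> {v. dilate v \<in> E})
      = ?q * (\<Sum>d\<in>{d. d \<noteq> (0, 0, 0) \<and> fst d = 0}. measure haar {v. v \<in> E \<and> head v = d})
      + (\<Sum>d\<in>{d. fst d \<noteq> 0}. measure haar {v. v \<in> E \<and> head v = d}) / ?q\<^sup>2" .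
  have "(UNIV - {(0, 0, 0)}) \<inter> {d. fst d = 0} = {d :: 'f vec3. d \<noteq> (0, 0, 0) \<and> fst d = 0}"
    "(UNIV - {(0, 0, 0)}) \<inter> - {d. fst d = 0} = {d :: 'f vec3. fst d \<noteq> 0}"
    by auto
  then show ?thesis
    unfolding * by (simp add: if_distrib[of "\<lambda>a. a * _"] sum.If_cases sum_distrib_left sum_divide_distrib)
qed

text \<open>The branches are exchanged: multiplying y and z by t shrinks the measure by q^2, and
  dividing x by t stretches it by q.\<close>

lemma measure_contract:
  fixes E :: "'f::{finite,field} digits3 set"
  assumes E: "E \<in> sets haar"
  shows "measure haar (primitive \<inter> {v. contract v \<in> E})
    = (\<Sum>d\<in>UNIV - {(0, 0, 0)}. (if snd d = (0, 0) then (real CARD('f))\<^sup>2 else 1 / real CARD('f)) * measure haar {v. v \<in> E \<and> head v = d})"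
proof -
  interpret haar: prob_space haar by (rule prob_space_haar)
  let ?q = "real CARD('f)"
  have q: "?q > 0"
    by simp
  define A where "A = {v. fst (head v) = 0 \<and> snd (head v) \<noteq> (0, 0) \<and> tail1 v \<in> E}"
  define B where "B = {v. fst (head v) \<noteq> 0 \<and> cons2 0 (cons3 0 v) \<in> E}"
  define E1 where "E1 = {v. v \<in> E \<and> snd (head v) \<noteq> (0, 0)}"
  define E2 where "E2 = {v. v \<in> E \<and> (head v \<noteq> (0, 0, 0) \<and> snd (head v) = (0, 0))}"
  have A: "A \<in> sets haar"
    using sets.Int[OF haar_vimage[OF tail_measurable(1) E] haar_head_sets[of "\<lambda>d. fst d = 0 \<and> snd d \<noteq> (0, 0)"]]
    by (simp add: A_def Int_def conj_ac)
  have B: "B \<in> sets haar"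
    using sets.Int[OF haar_vimage[OF measurable_compose[OF cons_measurable(3)[of 0] cons_measurable(2)[of 0]] E]
        haar_head_sets[of "\<lambda>d. fst d \<noteq> 0"]]
    by (simp add: B_def Int_def conj_commute)
  have E1: "E1 \<in> sets haar"
    using sets.Int[OF E haar_head_sets[of "\<lambda>d. snd d \<noteq> (0, 0)"]] by (simp add: E1_def Int_def)
  have E2: "E2 \<in> sets haar"
    using sets.Int[OF E haar_head_sets[of "\<lambda>d. d \<noteq> (0, 0, 0) \<and> snd d = (0, 0)"]] by (simp add: E2_def Int_def)
  have "primitive \<inter> {v. contract v \<in> E} = A \<union> B"
    by (auto simp: primitive_def A_def B_def split: if_splits)
  moreover have "A \<inter> B = {}"
    by (auto simp: A_def B_def)
  ultimately have "measure haar (primitive \<inter> {v. contract v \<in> E}) = measure haar A + measure haar B"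
    using A B by (simp add: haar.finite_measure_Union)
  also have "measure haar A = measure haar E1 / ?q"
  proof -
    have "(\<Sum>c\<in>UNIV. measure haar {v. cons1 c v \<in> A}) = measure haar {v. cons1 0 v \<in> A}"
      by (rule sum_delta_zero) (auto simp: A_def)
    also have "{v. cons1 0 v \<in> A} = E1"
      by (auto simp: E1_def A_def)
    finally show ?thesis
      by (simp add: measure_haar_split(1)[OF A])
  qed
  also have "measure haar B = ?q\<^sup>2 * measure haar E2"
  proof -
    define C where "C = {v. cons2 0 v \<in> E2}"
    have C: "C \<in> sets haar"
      unfolding C_def by (rule haar_vimage[OF cons_measurable(2) E2])
    have "(\<Sum>c\<in>UNIV. measure haar {v. cons2 c v \<in> E2}) = measure haar C"
      unfolding C_def by (rule sum_delta_zero) (auto simp: E2_def)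
    then have "measure haar E2 = measure haar C / ?q"
      using measure_haar_split(2)[OF E2] by simp
    moreover have "(\<Sum>c\<in>UNIV. measure haar {v. cons3 c v \<in> C}) = measure haar {v. cons3 0 v \<in> C}"
      by (rule sum_delta_zero) (auto simp: E2_def C_def)
    moreover have "{v. cons3 0 v \<in> C} = B"
      by (auto simp: B_def C_def E2_def)
    ultimately show ?thesis
      using measure_haar_split(3)[OF C] q by (simp add: power2_eq_square)
  qed
  also have "measure haar E1 = (\<Sum>d\<in>{d. snd d \<noteq> (0, 0)}. measure haar {v. v \<in> E \<and> head v = d})"
    unfolding E1_def by (rule measure_head_split[OF E])
  also have "measure haar E2 = (\<Sum>d\<in>{d. d \<noteq> (0, 0, 0) \<and> snd d = (0, 0)}. measure haar {v. v \<in> E \<and> head v = d})"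
    unfolding E2_def by (rule measure_head_split[OF E])
  finally have *: "measure haar (primitive \<inter> {v. contract v \<in> E})
      = (\<Sum>d\<in>{d. snd d \<noteq> (0, 0)}. measure haar {v. v \<in> E \<and> head v = d}) / ?q
      + ?q\<^sup>2 * (\<Sum>d\<in>{d. d \<noteq> (0, 0, 0) \<and> snd d = (0, 0)}. measure haar {v. v \<in> E \<and> head v = d})" .
  have "(UNIV - {(0, 0, 0)}) \<inter> {d. snd d = (0, 0)} = {d :: 'f vec3. d \<noteq> (0, 0, 0) \<and> snd d = (0, 0)}"
    "(UNIV - {(0, 0, 0)}) \<inter> - {d. snd d = (0, 0)} = {d :: 'f vec3. snd d \<noteq> (0, 0)}"
    by auto
  then show ?thesis
    unfolding * by (simp add: if_distrib[of "\<lambda>a. a * _"] sum.If_cases sum_distrib_left sum_divide_distrib)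
qed

text \<open>Conservation of mass: q (q^2 - 1) + q^2 (q - 1) / q^2 = q^3 - 1.\<close>

lemma sum_dilate_weights:
  "(\<Sum>d\<in>UNIV - {(0, 0, 0) :: 'f::{finite,field} vec3}. if fst d = 0 then real CARD('f) else 1 / (real CARD('f))\<^sup>2)
    = CARD('f vec3) - 1"
proof -
  have 1: "(UNIV - {(0, 0, 0)}) \<inter> {d. fst d = 0} = {0} \<times> (UNIV - {(0, 0)} :: ('f \<times> 'f) set)"
    and 2: "(UNIV - {(0, 0, 0)}) \<inter> - {d. fst d = 0} = (UNIV - {0 :: 'f}) \<times> (UNIV :: ('f \<times> 'f) set)"
    by auto
  have "CARD('f) \<ge> 1" "CARD('f) * CARD('f) \<ge> 1"
    by (simp_all add: Suc_le_eq)
  then show ?thesis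
    by (simp add: sum.If_cases 1 2 card_cartesian_product card_Diff_subset of_nat_diff card_prod power2_eq_square field_simps)
qed

lemma sum_contract_weights:
  "(\<Sum>d\<in>UNIV - {(0, 0, 0) :: 'f::{finite,field} vec3}. if snd d = (0, 0) then (real CARD('f))\<^sup>2 else 1 / real CARD('f))
    = CARD('f vec3) - 1"
proof -
  have 1: "(UNIV - {(0, 0, 0)}) \<inter> {d. snd d = (0, 0)} = (UNIV - {0 :: 'f}) \<times> {(0, 0) :: 'f \<times> 'f}"
    and 2: "(UNIV - {(0, 0, 0)}) \<inter> - {d. snd d = (0, 0)} = (UNIV :: 'f set) \<times> (UNIV - {(0, 0)} :: ('f \<times> 'f) set)"
    by auto
  have "CARD('f) \<ge> 1" "CARD('f) * CARD('f) \<ge> 1"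
    by (simp_all add: Suc_le_eq)
  then show ?thesis
    by (simp add: sum.If_cases 1 2 card_cartesian_product card_Diff_subset of_nat_diff card_prod power2_eq_square field_simps)
qed

lemma average_dilate:
  fixes E :: "'f::{finite,field} digits3 set"
  assumes E: "E \<in> sets haar"
  shows "(\<Sum>k\<in>SL3. measure haar (primitive \<inter> {v. digitwise k (dilate v) \<in> E}))
    = card (SL3 :: ('f vec3 \<Rightarrow> 'f vec3) set) * measure haar (primitive \<inter> E)"
    "(\<Sum>k\<in>SL3. measure haar (primitive \<inter> {v. digitwise k (contract v) \<in> E}))
    = card (SL3 :: ('f vec3 \<Rightarrow> 'f vec3) set) * measure haar (primitive \<inter> E)"
  unfolding measure_dilate[OF haar_vimage[OF digitwise_measurable E], unfolded mem_Collect_eq]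
    measure_contract[OF haar_vimage[OF digitwise_measurable E], unfolded mem_Collect_eq]
  by (rule average_SL3[OF E sum_dilate_weights], rule average_SL3[OF E sum_contract_weights])

text \<open>The inner average cancels the density caused by \<open>contract\<close>, which leaves
  the image of the measure under \<open>dilate\<close>; the outer average cancels that one in
  turn.\<close>

lemma average_dilate_contract:
  fixes E :: "'f::{finite,field} digits3 set"
  assumes E: "E \<in> sets haar"
  shows "(\<Sum>k\<in>SL3. \<Sum>l\<in>SL3. measure haar (primitive \<inter> {v. digitwise k (dilate (digitwise l (contract v))) \<in> E}))
    = (card (SL3 :: ('f vec3 \<Rightarrow> 'f vec3) set))\<^sup>2 * measure haar (primitive \<inter> E)"
proof -
  have "(\<Sum>l\<in>SL3. measure haar (primitive \<inter> {v. digitwise k (dilate (digitwise l (contract v))) \<in> E}))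
      = card (SL3 :: ('f vec3 \<Rightarrow> 'f vec3) set) * measure haar (primitive \<inter> {v. digitwise k (dilate v) \<in> E})" for k
    using average_dilate(2)[OF haar_vimage[OF dilate_contract_measurable(1)
          haar_vimage[OF digitwise_measurable E, of k]]] by simp
  then show ?thesis
    by (simp add: sum_distrib_left[symmetric] average_dilate(1)[OF E] power2_eq_square)
qed

lemma measure_head1: "measure haar {v :: 'f::{finite,field} digits3. fst (head v) \<noteq> 0} > 0"
proof -
  interpret haar: prob_space "haar :: 'f digits3 measure" by (rule prob_space_haar)
  let ?E = "{v :: 'f digits3. fst (head v) \<noteq> 0}"
  have "measure haar {v. cons1 c v \<in> ?E} \<ge> (if c = 1 then 1 else 0)" for c
  proof (cases "c = 1")
    case True
    then have "{v. cons1 c v \<in> ?E} = space haar"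
      by auto
    then show ?thesis
      using haar.prob_space by simp
  qed simp
  then have "(\<Sum>c\<in>UNIV. measure haar {v. cons1 c v \<in> ?E}) \<ge> (\<Sum>c\<in>(UNIV :: 'f set). if c = 1 then 1 else 0)"
    by (intro sum_mono)
  then show ?thesis
    by (subst measure_haar_split(1)[OF haar_head_sets]) (auto intro!: divide_pos_pos)
qed

section \<open>Valuations of Laurent vectors and the action modulo powers of t\<close>

definition coeffs :: "'f seq3 \<Rightarrow> int \<Rightarrow> 'f vec3" where
  "coeffs w n = (fst w n, fst (snd w) n, snd (snd w) n)"

definition has_val :: "'f::field seq3 \<Rightarrow> int \<Rightarrow> bool" where
  "has_val w N \<longleftrightarrow> coeffs w N \<noteq> (0, 0, 0) \<and> (\<forall>n<N. coeffs w n = (0, 0, 0))"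

definition val :: "'f::field seq3 \<Rightarrow> int" where
  "val w = (THE N. has_val w N)"

text \<open>This excludes the zero vector, which has no valuation.\<close>

definition laurent :: "'f::field seq3 \<Rightarrow> bool" where
  "laurent w \<longleftrightarrow> (\<exists>N. has_val w N)"

fun lshift :: "int \<Rightarrow> 'f seq3 \<Rightarrow> 'f seq3" where
  "lshift m (x, y, z) = (\<lambda>n. x (n + m), \<lambda>n. y (n + m), \<lambda>n. z (n + m))"

fun embed :: "'f::field digits3 \<Rightarrow> 'f seq3" where
  "embed (x, y, z) = (\<lambda>n. if n < 0 then 0 else x (nat n), \<lambda>n. if n < 0 then 0 else y (nat n),
     \<lambda>n. if n < 0 then 0 else z (nat n))"

fun truncate :: "'f seq3 \<Rightarrow> 'f digits3" where
  "truncate (x, y, z) = (\<lambda>n. x (int n), \<lambda>n. y (int n), \<lambda>n. z (int n))"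

definition normalize3 :: "'f::field seq3 \<Rightarrow> 'f digits3" where
  "normalize3 w = truncate (lshift (val w) w)"

text \<open>What an operator needs in order to act modulo powers of t: multiplication by t^-m is
  \<open>lshift m\<close>.\<close>

definition seq_op :: "('f::field seq3 \<Rightarrow> 'f seq3) \<Rightarrow> bool" where
  "seq_op l \<longleftrightarrow> (\<forall>w. laurent w \<longrightarrow> laurent (l w)) \<and> (\<forall>w m. l (lshift m w) = lshift m (l w))"

text \<open>The identity off \<open>primitive\<close> is a default value on a null set of the later
  measure.\<close>

definition projective :: "('f::field seq3 \<Rightarrow> 'f seq3) \<Rightarrow> 'f digits3 \<Rightarrow> 'f digits3" where
  "projective l v = (if v \<in> primitive then normalize3 (l (embed v)) else v)"

lemma val_eq: "has_val w N \<Longrightarrow> val w = N"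
  unfolding val_def by (rule the_equality) (assumption, meson has_val_def linorder_cases)

lemma laurent_val: "laurent w \<Longrightarrow> has_val w (val w)"
  unfolding laurent_def using val_eq by metis

lemma laurentI:
  assumes "\<And>n. n < N \<Longrightarrow> coeffs w n = (0, 0, 0)" and "coeffs w n1 \<noteq> (0, 0, 0)"
  shows "laurent w"
proof -
  let ?P = "\<lambda>k::nat. coeffs w (N + int k) \<noteq> (0, 0, 0)"
  have "N \<le> n1"
    using assms by (meson not_le)
  then have "?P (nat (n1 - N))"
    using assms(2) by simp
  then have "?P (LEAST k. ?P k)"
    by (rule LeastI)
  moreover have "coeffs w n = (0, 0, 0)" if "n < N + int (LEAST k. ?P k)" for n
  proof (cases "n < N")
    case False
    then have "nat (n - N) < (LEAST k. ?P k)"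
      using that by linarith
    then show ?thesis
      using not_less_Least[of "nat (n - N)" ?P] False by simp
  qed (use assms in simp)
  ultimately show ?thesis
    unfolding laurent_def has_val_def by blast
qed

lemma coeffs_lshift [simp]: "coeffs (lshift m w) n = coeffs w (n + m)"
  by (cases w) (simp add: coeffs_def)

lemma seq_opD:
  assumes "seq_op l"
  shows "laurent w \<Longrightarrow> laurent (l w)" "l (lshift m w) = lshift m (l w)"
  using assms unfolding seq_op_def by blast+

lemma seq_op_comp: "seq_op l \<Longrightarrow> seq_op l' \<Longrightarrow> seq_op (l \<circ> l')"
  unfolding seq_op_def by (metis comp_apply)

lemma seq_op_id: "seq_op id"
  by (simp add: seq_op_def)

text \<open>The left inverse keeps nonzero vectors nonzero; the bound \<open>N - 1\<close> fits
  operators whose exponents of t are at least -1.\<close>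

lemma seq_opI:
  fixes l l' :: "'f::field seq3 \<Rightarrow> 'f seq3"
  assumes shift: "\<And>w m. l (lshift m w) = lshift m (l w)"
    and inv: "\<And>w. l' (l w) = w" "\<And>w. (\<forall>n. coeffs w n = (0, 0, 0)) \<Longrightarrow> (\<forall>n. coeffs (l' w) n = (0, 0, 0))"
    and supp: "\<And>w N. (\<forall>n<N. coeffs w n = (0, 0, 0)) \<Longrightarrow> (\<forall>n<N - 1. coeffs (l w) n = (0, 0, 0))"
  shows "seq_op l"
  unfolding seq_op_def
proof (intro conjI allI impI shift)
  fix w :: "'f seq3" assume "laurent w"
  then obtain N where N: "has_val w N"
    by (auto simp: laurent_def)
  have "\<not> (\<forall>n. coeffs (l w) n = (0, 0, 0))"
  proof
    assume "\<forall>n. coeffs (l w) n = (0, 0, 0)"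
    then have "\<forall>n. coeffs w n = (0, 0, 0)"
      using inv by metis
    then show False
      using N by (auto simp: has_val_def)
  qed
  then obtain n1 where "coeffs (l w) n1 \<noteq> (0, 0, 0)"
    by blast
  then show "laurent (l w)"
    using supp[of N w] N by (intro laurentI[of "N - 1" "l w" n1]) (auto simp: has_val_def)
qed

lemma seq_op_elmat: "seq_op (elmat i c)"
proof (rule seq_opI[where l'="elmat i (- c)"])
  show "elmat i (- c) (elmat i c w) = w" for w
  proof -
    have "elmat i (- c) \<circ> elmat i c = id"
      by (simp add: elem_add[symmetric] elem_zero)
    then show ?thesis
      by (metis comp_apply id_apply)
  qed
  show "elmat i c (lshift m w) = lshift m (elmat i c w)" for m w
    by (cases w; induction i rule: elmat.induct) (auto simp: fun_eq_iff algebra_simps)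
  show "\<forall>n. coeffs (elmat i (- c) w) n = (0, 0, 0)" if "\<forall>n. coeffs w n = (0, 0, 0)" for w
    using that by (cases w; induction i rule: elmat.induct) (auto simp: coeffs_def)
  show "\<forall>n<N - 1. coeffs (elmat i c w) n = (0, 0, 0)" if "\<forall>n<N. coeffs w n = (0, 0, 0)" for w N
    using that by (cases w; induction i rule: elmat.induct) (auto simp: coeffs_def)
qed

lemma seq_op_shift1:
  "seq_op (shift1 :: 'f::field seq3 \<Rightarrow> 'f seq3)" "seq_op (unshift1 :: 'f seq3 \<Rightarrow> 'f seq3)"
proof -
  have inv: "shift1 (unshift1 w) = w" "unshift1 (shift1 w) = w" for w :: "'f seq3"
    by (cases w; simp)+
  show "seq_op (shift1 :: 'f seq3 \<Rightarrow> 'f seq3)"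
  proof (rule seq_opI[of shift1 unshift1])
    show "shift1 (lshift m w) = lshift m (shift1 w)" for m and w :: "'f seq3"
      by (cases w) (simp add: algebra_simps)
  qed (auto simp: inv coeffs_def)
  show "seq_op (unshift1 :: 'f seq3 \<Rightarrow> 'f seq3)"
  proof (rule seq_opI[of unshift1 shift1])
    show "unshift1 (lshift m w) = lshift m (unshift1 w)" for m and w :: "'f seq3"
      by (cases w) (simp add: algebra_simps)
  qed (auto simp: inv coeffs_def)
qed

lemma seq_op_EL3: "l \<in> EL3 \<Longrightarrow> seq_op l"
proof (induction rule: EL3.induct)
  case id
  show ?case
    by (rule seq_op_id)
next
  case (elem l i c)
  show ?case
    by (rule seq_op_comp[OF seq_op_elmat elem.IH])
qed

lemma seq_op_digitwise: "k \<in> SL3 \<Longrightarrow> seq_op (digitwise k)"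
  by (rule seq_op_EL3[OF EL3_digitwise])

lemma has_val_embed: "v \<in> primitive \<Longrightarrow> has_val (embed v) 0"
  by (cases v) (auto simp: has_val_def coeffs_def primitive_def)

lemma normalize3_embed: "v \<in> primitive \<Longrightarrow> normalize3 (embed v) = v"
proof -
  assume "v \<in> primitive"
  then have "val (embed v) = 0"
    by (intro val_eq has_val_embed)
  then show ?thesis
    by (simp only: normalize3_def) (cases v, simp add: fun_eq_iff)
qed

lemma normalize3_primitive: "laurent w \<Longrightarrow> normalize3 w \<in> primitive"
  using laurent_val[of w] by (cases w) (auto simp: normalize3_def primitive_def has_val_def coeffs_def)

lemma embed_normalize3: "laurent w \<Longrightarrow> embed (normalize3 w) = lshift (val w) w"
  using laurent_val[of w] by (cases w) (auto simp: normalize3_def has_val_def coeffs_def fun_eq_iff)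

lemma normalize3_lshift: "laurent w \<Longrightarrow> normalize3 (lshift m w) = normalize3 w"
proof -
  assume w: "laurent w"
  have "has_val (lshift m w) (val w - m)"
    using laurent_val[OF w] by (auto simp: has_val_def)
  then have "val (lshift m w) = val w - m"
    by (rule val_eq)
  then show ?thesis
    by (cases w) (simp add: normalize3_def add.assoc)
qed

lemma laurent_embed: "v \<in> primitive \<Longrightarrow> laurent (embed v)"
  using has_val_embed unfolding laurent_def by blast

lemma projective_primitive:
  assumes "seq_op l"
  shows "projective l v \<in> primitive \<longleftrightarrow> v \<in> primitive"
  using normalize3_primitive[OF seq_opD(1)[OF assms laurent_embed]] by (simp add: projective_def)

text \<open>The inner normalization multiplies by a power of t, which \<open>l\<close> commutes with
  and the outer normalization absorbs.\<close>

lemma projective_comp: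
  assumes l: "seq_op l" and l': "seq_op l'"
  shows "projective (l \<circ> l') v = projective l (projective l' v)"
proof (cases "v \<in> primitive")
  case True
  let ?w = "l' (embed v)"
  have w: "laurent ?w"
    by (rule seq_opD(1)[OF l' laurent_embed[OF True]])
  have "projective l (projective l' v) = normalize3 (l (embed (normalize3 ?w)))"
    using True normalize3_primitive[OF w] by (simp only: projective_def if_True)
  also have "\<dots> = normalize3 (lshift (val ?w) (l ?w))"
    by (simp only: embed_normalize3[OF w] seq_opD(2)[OF l])
  also have "\<dots> = normalize3 (l ?w)"
    by (rule normalize3_lshift[OF seq_opD(1)[OF l w]])
  finally show ?thesis
    using True by (simp only: projective_def if_True o_apply)
qed (simp add: projective_def)

lemma projective_id: "projective id v = v"
  by (simp add: projective_def normalize3_embed)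

lemma projective_digitwise:
  assumes k: "k \<in> SL3" and v: "v \<in> primitive"
  shows "projective (digitwise k) v = digitwise k v"
proof -
  have "digitwise k (embed v) = embed (digitwise k v)"
    using SL3_zero[OF k] by (cases v) (auto simp: fun_eq_iff)
  then show ?thesis
    using v digitwise_primitive[OF k, of v] by (simp add: projective_def normalize3_embed)
qed

lemma projective_shift1:
  assumes v: "v \<in> primitive"
  shows "projective shift1 v = dilate v"
proof (cases v)
  case (fields x y z)
  have "has_val (shift1 (embed v)) (if (y 0, z 0) \<noteq> (0, 0) then 0 else 1)"
    using v by (auto simp: fields has_val_def coeffs_def primitive_def)
  then have "val (shift1 (embed v)) = (if (y 0, z 0) \<noteq> (0, 0) then 0 else 1)"
    by (rule val_eq)
  then show ?thesis
    using v by (auto simp: projective_def normalize3_def fields fun_eq_iff nat_add_distrib split: nat.split)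
qed

lemma projective_unshift1:
  assumes v: "v \<in> primitive"
  shows "projective unshift1 v = contract v"
proof (cases v)
  case (fields x y z)
  have "has_val (unshift1 (embed v)) (if x 0 = 0 then 0 else - 1)"
    using v by (auto simp: fields has_val_def coeffs_def primitive_def)
  then have "val (unshift1 (embed v)) = (if x 0 = 0 then 0 else - 1)"
    by (rule val_eq)
  then show ?thesis
    using v by (auto simp: projective_def normalize3_def fields fun_eq_iff nat_add_distrib split: nat.split)
qed

lemma projective_conjugate1:
  assumes k: "k \<in> SL3" and v: "v \<in> primitive"
  shows "projective (conjugate1 k) v = dilate (digitwise k (contract v))"
proof -
  have c: "contract v \<in> primitive" "digitwise k (contract v) \<in> primitive"
    using dilate_contract_primitive(2)[OF v] digitwise_primitive[OF k] by auto
  show ?thesis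
    unfolding conjugate1_def
    using k v c by (simp add: projective_comp seq_op_comp seq_op_shift1 seq_op_digitwise projective_unshift1
        projective_digitwise projective_shift1)
qed

section \<open>The model with a trivial and a projective half\<close>

definition proj_measure :: "'f::{finite,field} digits3 measure" where
  "proj_measure = uniform_measure haar primitive"

definition model :: "(bool \<times> 'f::{finite,field} digits3) measure" where
  "model = digit \<Otimes>\<^sub>M proj_measure"

fun model_act :: "('f::field seq3 \<Rightarrow> 'f seq3) \<Rightarrow> bool \<times> 'f digits3 \<Rightarrow> bool \<times> 'f digits3" where
  "model_act l (s, v) = (s, if s then v else projective l v)"

lemma measure_primitive_pos: "measure haar (primitive :: 'f::{finite,field} digits3 set) > 0"
proof -
  interpret haar: prob_space "haar :: 'f digits3 measure" by (rule prob_space_haar)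
  have "measure haar {v :: 'f digits3. fst (head v) \<noteq> 0} \<le> measure haar (primitive :: 'f digits3 set)"
    by (rule haar.finite_measure_mono[OF _ primitive_sets]) (auto simp: primitive_def)
  then show ?thesis
    using measure_head1[where 'f='f] by linarith
qed

lemma sets_proj_measure [simp, measurable_cong]: "sets proj_measure = sets haar"
  by (simp add: proj_measure_def)

lemma space_proj_measure [simp]: "space proj_measure = UNIV"
  by (simp add: proj_measure_def)

lemma prob_space_proj_measure: "prob_space (proj_measure :: 'f::{finite,field} digits3 measure)"
proof -
  interpret haar: prob_space "haar :: 'f digits3 measure" by (rule prob_space_haar)
  show ?thesis
    unfolding proj_measure_def using measure_primitive_pos[where 'f='f]
    by (intro prob_space_uniform_measure) (simp_all add: haar.emeasure_eq_measure)
qed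

lemma measure_proj_measure:
  fixes E :: "'f::{finite,field} digits3 set"
  assumes "E \<in> sets haar"
  shows "measure proj_measure E = measure haar (primitive \<inter> E) / measure haar (primitive :: 'f digits3 set)"
proof -
  interpret haar: prob_space "haar :: 'f digits3 measure" by (rule prob_space_haar)
  show ?thesis
    unfolding proj_measure_def using assms measure_primitive_pos[where 'f='f]
    by (intro measure_uniform_measure) (simp_all add: haar.emeasure_eq_measure)
qed

lemma space_model [simp]: "space model = UNIV"
  by (simp add: model_def space_pair_measure)

lemma prob_space_model: "prob_space (model :: (bool \<times> 'f::{finite,field} digits3) measure)"
proof -
  interpret PM: prob_space "proj_measure :: 'f digits3 measure" by (rule prob_space_proj_measure)
  interpret DM: prob_space "digit :: bool measure" by (rule prob_space_digit)
  interpret PP: pair_prob_space "digit :: bool measure" "proj_measure :: 'f digits3 measure" ..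
  show ?thesis
    unfolding model_def by (rule PP.prob_space_axioms)
qed

lemma model_section: "E \<in> sets model \<Longrightarrow> {v. (s, v) \<in> E} \<in> sets haar"
  using sets_Pair1[of E digit proj_measure s] by (simp add: model_def vimage_def)

lemma measure_model:
  fixes E :: "(bool \<times> 'f::{finite,field} digits3) set"
  assumes E: "E \<in> sets model"
  shows "measure model E = (measure proj_measure {v. (True, v) \<in> E} + measure proj_measure {v. (False, v) \<in> E}) / 2"
proof -
  interpret PM: prob_space "proj_measure :: 'f digits3 measure" by (rule prob_space_proj_measure)
  interpret Y2: prob_space "model :: (bool \<times> 'f digits3) measure" by (rule prob_space_model)
  have "emeasure model E = (\<integral>\<^sup>+s. emeasure proj_measure (Pair s -` E) \<partial>digit)"
    using E unfolding model_def by (rule PM.emeasure_pair_measure_alt)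
  also have "\<dots> = (emeasure proj_measure (Pair False -` E) + emeasure proj_measure (Pair True -` E)) / 2"
    unfolding digit_def by (subst nn_integral_pmf_of_set) (simp_all add: UNIV_bool)
  finally have "ennreal (measure model E)
      = ennreal ((measure proj_measure {v. (True, v) \<in> E} + measure proj_measure {v. (False, v) \<in> E}) / 2)"
    by (simp add: Y2.emeasure_eq_measure PM.emeasure_eq_measure vimage_def ennreal_plus[symmetric]
        divide_ennreal add.commute del: ennreal_plus flip: ennreal_numeral)
  then show ?thesis
    by (subst (asm) ennreal_inj) auto
qed

lemma model_sets_Times: "E \<in> sets haar \<Longrightarrow> S \<times> E \<in> sets model"
  unfolding model_def by (intro pair_measureI) auto

lemma elmat_cases:
  assumes "i < 5"
  obtains k where "k \<in> SL3" "elmat i c = digitwise k \<or> elmat i c = conjugate1 k"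
proof -
  consider "i = 0" | "i = 1" | "i = 2" | "i = 3" | "i = 4"
    using assms by linarith
  then show ?thesis
    using that[OF SL3_generators(1)[of c]] that[OF SL3_generators(2)[of c]] that[OF SL3_generators(3)[of c]]
    by cases (simp_all only: elem_digitwise, auto)
qed

text \<open>One half of nonsingularity for the uniform measure on \<open>primitive\<close>; the
  other half will come from the same property of the inverse group element.\<close>

definition quasi_preserving :: "('f::{finite,field} digits3 \<Rightarrow> 'f digits3) \<Rightarrow> bool" where
  "quasi_preserving T \<longleftrightarrow> T \<in> haar \<rightarrow>\<^sub>M haar
     \<and> (\<forall>E\<in>sets haar. measure haar (primitive \<inter> E) = 0 \<longrightarrow> measure haar (primitive \<inter> {v. T v \<in> E}) = 0)"

lemma quasi_preserving_comp: "quasi_preserving S \<Longrightarrow> quasi_preserving T \<Longrightarrow> quasi_preserving (\<lambda>v. S (T v))"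
proof -
  assume S: "quasi_preserving S" and T: "quasi_preserving T"
  then have m: "S \<in> haar \<rightarrow>\<^sub>M haar" "T \<in> haar \<rightarrow>\<^sub>M haar"
    by (auto simp: quasi_preserving_def)
  have "measure haar (primitive \<inter> {v. S (T v) \<in> E}) = 0" if "E \<in> sets haar" "measure haar (primitive \<inter> E) = 0" for E
  proof -
    have "measure haar (primitive \<inter> {v. T v \<in> {v. S v \<in> E}}) = 0"
      using S T that haar_vimage[OF m(1) that(1)] by (auto simp only: quasi_preserving_def)
    then show ?thesis
      by simp
  qed
  then show ?thesis
    using measurable_compose[OF m(2,1)] by (simp add: quasi_preserving_def)
qed

lemma quasi_preserving_restrict:
  assumes T: "quasi_preserving T"
  shows "quasi_preserving (\<lambda>v. if v \<in> primitive then T v else v)"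
proof -
  have "(\<lambda>v. if v \<in> primitive then T v else v) \<in> haar \<rightarrow>\<^sub>M haar"
    using T by (intro measurable_If_set) (auto simp: quasi_preserving_def)
  moreover have "primitive \<inter> {v. (if v \<in> primitive then T v else v) \<in> E} = primitive \<inter> {v. T v \<in> E}" for E
    by auto
  ultimately show ?thesis
    using T by (simp add: quasi_preserving_def)
qed

lemma quasi_preserving_digitwise:
  assumes k: "k \<in> SL3"
  shows "quasi_preserving (digitwise k)"
proof -
  have "measure haar (primitive \<inter> {v. digitwise k v \<in> E}) = measure haar (primitive \<inter> E)" if E: "E \<in> sets haar" for E
  proof -
    have "primitive \<inter> {v. digitwise k v \<in> E} = {v. digitwise k v \<in> primitive \<inter> E}"
      using digitwise_primitive[OF k] by auto
    then show ?thesis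
      using emeasure_haar_digitwise[OF k sets.Int[OF primitive_sets E]] by (simp add: measure_def)
  qed
  then show ?thesis
    by (simp add: quasi_preserving_def digitwise_measurable)
qed

lemma quasi_preserving_dilate: "quasi_preserving (dilate :: 'f::{finite,field} digits3 \<Rightarrow> 'f digits3)"
  "quasi_preserving (contract :: 'f digits3 \<Rightarrow> 'f digits3)"
proof -
  have zero: "measure haar {v. v \<in> E \<and> head v = d} = 0"
    if E: "E \<in> sets haar" "measure haar (primitive \<inter> E) = 0" and d: "d \<noteq> (0, 0, 0)"
    for E :: "'f digits3 set" and d
  proof -
    interpret haar: prob_space "haar :: 'f digits3 measure" by (rule prob_space_haar)
    have "measure haar {v. v \<in> E \<and> head v = d} \<le> measure haar (primitive \<inter> E)"
      using E d by (intro haar.finite_measure_mono) (auto simp: primitive_def[symmetric], auto simp: primitive_def)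
    then show ?thesis
      using E(2) measure_nonneg[of haar "{v. v \<in> E \<and> head v = d}"] by linarith
  qed
  show "quasi_preserving (dilate :: 'f digits3 \<Rightarrow> _)"
    unfolding quasi_preserving_def
    by (auto simp: dilate_contract_measurable measure_dilate zero intro!: sum.neutral)
  show "quasi_preserving (contract :: 'f digits3 \<Rightarrow> _)"
    unfolding quasi_preserving_def
    by (auto simp: dilate_contract_measurable measure_contract zero intro!: sum.neutral)
qed

text \<open>Each generator lies in one of the two copies of SL_3, where it is a measure-preserving
  digitwise map, possibly conjugated by \<open>dilate\<close>; the explicit densities show that
  \<open>dilate\<close> and \<open>contract\<close> pull null sets back to null sets.\<close>

lemma quasi_preserving_projective:
  assumes "l \<in> EL3"
  shows "quasi_preserving (projective (l :: 'f::{finite,field} seq3 \<Rightarrow> 'f seq3))"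
  using assms
proof (induction rule: EL3.induct)
  case id
  have "projective (id :: 'f seq3 \<Rightarrow> 'f seq3) = (\<lambda>v. v)"
    by (rule ext) (rule projective_id)
  then show ?case
    by (simp only:) (simp add: quasi_preserving_def)
next
  case (elem l i c)
  obtain k where k: "k \<in> SL3" "elmat i c = digitwise k \<or> elmat i c = conjugate1 k"
    by (rule elmat_cases[OF elem.hyps(2)])
  have "quasi_preserving (projective (elmat i c))"
    using k(2)
  proof
    assume e: "elmat i c = digitwise k"
    have "projective (elmat i c) = (\<lambda>v. if v \<in> primitive then digitwise k v else v)"
      unfolding e using projective_digitwise[OF k(1)] by (auto simp: fun_eq_iff projective_def)
    then show ?thesis
      using quasi_preserving_restrict[OF quasi_preserving_digitwise[OF k(1)]] by (simp only:)
  next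
    assume e: "elmat i c = conjugate1 k"
    have "projective (elmat i c) = (\<lambda>v. if v \<in> primitive then dilate (digitwise k (contract v)) else v)"
      unfolding e using projective_conjugate1[OF k(1)] by (auto simp: fun_eq_iff projective_def)
    then show ?thesis
      using quasi_preserving_restrict[OF quasi_preserving_comp[OF quasi_preserving_dilate(1)
            quasi_preserving_comp[OF quasi_preserving_digitwise[OF k(1)] quasi_preserving_dilate(2)]]]
      by (simp only:)
  qed
  moreover have "projective (elmat i c \<circ> l) = (\<lambda>v. projective (elmat i c) (projective l v))"
    by (rule ext) (rule projective_comp[OF seq_op_elmat seq_op_EL3[OF elem.hyps(1)]])
  ultimately show ?case
    using quasi_preserving_comp[OF _ elem.IH] by (simp only:)
qed

lemma model_act_measurable:
  assumes l: "l \<in> EL3"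
  shows "model_act l \<in> (model :: (bool \<times> 'f::{finite,field} digits3) measure) \<rightarrow>\<^sub>M model"
proof -
  have [measurable]: "projective l \<in> (proj_measure :: 'f digits3 measure) \<rightarrow>\<^sub>M proj_measure"
    using quasi_preserving_projective[OF l] by (simp add: quasi_preserving_def cong: measurable_cong_sets)
  have [measurable]: "(\<lambda>s. s) \<in> (digit :: bool measure) \<rightarrow>\<^sub>M count_space UNIV"
    by (rule measurable_from_digit)
  have "model_act l = (\<lambda>p. (fst p, if fst p then snd p else projective l (snd p)))"
    by (auto simp: fun_eq_iff)
  moreover have "(\<lambda>p. (fst p, if fst p then snd p else projective l (snd p)))
      \<in> (digit \<Otimes>\<^sub>M proj_measure :: (bool \<times> 'f digits3) measure) \<rightarrow>\<^sub>M (digit \<Otimes>\<^sub>M proj_measure)"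
    by measurable
  ultimately show ?thesis
    by (simp add: model_def)
qed

lemma model_vimage: "l \<in> EL3 \<Longrightarrow> E \<in> sets model \<Longrightarrow> {y. model_act l y \<in> E} \<in> sets model"
  using measurable_sets[OF model_act_measurable, of l E] by (simp add: vimage_def)

lemma model_act_comp: "l \<in> EL3 \<Longrightarrow> l' \<in> EL3 \<Longrightarrow> model_act (l \<circ> l') y = model_act l (model_act l' y)"
  by (cases y) (simp add: projective_comp[OF seq_op_EL3 seq_op_EL3] del: o_apply)

lemma model_act_id: "model_act id y = y"
  by (cases y) (simp add: projective_id del: id_apply)

lemma model_act_null:
  fixes E :: "(bool \<times> 'f::{finite,field} digits3) set"
  assumes l: "l \<in> EL3" and E: "E \<in> sets model" "measure model E = 0"
  shows "measure model {y. model_act l y \<in> E} = 0"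
proof -
  have sec: "{v. (s, v) \<in> E} \<in> sets haar" for s
    by (rule model_section[OF E(1)])
  have pos: "measure haar (primitive :: 'f digits3 set) \<noteq> 0"
    using measure_primitive_pos[where 'f='f] by simp
  have "measure proj_measure {v. (True, v) \<in> E} = 0 \<and> measure proj_measure {v. (False, v) \<in> E} = 0"
    using E(2) unfolding measure_model[OF E(1)]
    by (simp add: add_nonneg_eq_0_iff)
  then have z: "measure haar (primitive \<inter> {v. (s, v) \<in> E}) = 0" for s
    using pos by (cases s) (simp_all add: measure_proj_measure[OF sec])
  have "measure haar (primitive \<inter> {v. projective l v \<in> {v. (False, v) \<in> E}}) = 0"
    using quasi_preserving_projective[OF l] sec[of False] z[of False] by (simp only: quasi_preserving_def)
  moreover have "{v. projective l v \<in> {v. (False, v) \<in> E}} \<in> sets haar"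
    using quasi_preserving_projective[OF l] sec[of False] by (intro haar_vimage) (simp_all only: quasi_preserving_def)
  ultimately have "measure proj_measure {v. projective l v \<in> {v. (False, v) \<in> E}} = 0"
    by (simp only: measure_proj_measure div_0)
  moreover have "measure proj_measure {v. (True, v) \<in> E} = 0"
    using z[of True] by (simp add: measure_proj_measure[OF sec])
  ultimately show ?thesis
    unfolding measure_model[OF model_vimage[OF l E(1)]] by simp
qed

text \<open>On the trivial half all terms are equal; on the other half the sum is that of
  \<open>average_dilate_contract\<close>.\<close>

lemma model_stationary:
  fixes E :: "(bool \<times> 'f::{finite,field} digits3) set"
  assumes E: "E \<in> sets model"
  shows "(\<Sum>k\<in>SL3. \<Sum>l\<in>SL3. measure model {y. model_act (digitwise k \<circ> conjugate1 l) y \<in> E})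
    = (card (SL3 :: ('f vec3 \<Rightarrow> 'f vec3) set))\<^sup>2 * measure model E"
proof -
  let ?K = "SL3 :: ('f vec3 \<Rightarrow> 'f vec3) set" and ?F = "{v. (False, v) \<in> E}" and ?m = "measure haar (primitive :: 'f digits3 set)"
  have F: "?F \<in> sets haar"
    by (rule model_section[OF E])
  define T where "T k l v = digitwise k (dilate (digitwise l (contract v)))" for k l and v :: "'f digits3"
  have Tm: "{v. T k l v \<in> ?F} \<in> sets haar" for k l
  proof -
    have "T k l \<in> haar \<rightarrow>\<^sub>M haar"
      unfolding T_def[abs_def]
      using measurable_compose[OF measurable_compose[OF measurable_compose[OF dilate_contract_measurable(2)
              digitwise_measurable[of l]] dilate_contract_measurable(1)] digitwise_measurable[of k]] by simp
    then show ?thesis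
      by (rule haar_vimage[OF _ F])
  qed
  have 1: "measure model {y. model_act (digitwise k \<circ> conjugate1 l) y \<in> E}
      = (measure proj_measure {v. (True, v) \<in> E} + measure haar (primitive \<inter> {v. T k l v \<in> ?F}) / ?m) / 2"
    if k: "k \<in> SL3" and l: "l \<in> SL3" for k l
  proof -
    have EL: "digitwise k \<circ> conjugate1 l \<in> EL3"
      by (intro EL3_comp EL3_digitwise EL3_conjugate1 k l)
    have p: "projective (digitwise k \<circ> conjugate1 l) v = T k l v" if v: "v \<in> primitive" for v
    proof -
      have "T k l v = digitwise k (projective (conjugate1 l) v)"
        by (simp add: T_def projective_conjugate1[OF l v])
      moreover have "projective (conjugate1 l) v \<in> primitive"
        using v projective_primitive[OF seq_op_EL3[OF EL3_conjugate1[OF l]]] by simp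
      ultimately show ?thesis
        by (simp only: projective_comp[OF seq_op_digitwise[OF k] seq_op_EL3[OF EL3_conjugate1[OF l]]]
            projective_digitwise[OF k])
    qed
    have "projective (digitwise k \<circ> conjugate1 l) \<in> haar \<rightarrow>\<^sub>M haar"
      using quasi_preserving_projective[OF EL] by (simp only: quasi_preserving_def)
    from haar_vimage[OF this F]
    have "measure proj_measure {v. projective (digitwise k \<circ> conjugate1 l) v \<in> ?F}
        = measure haar (primitive \<inter> {v. projective (digitwise k \<circ> conjugate1 l) v \<in> ?F}) / ?m"
      by (rule measure_proj_measure)
    also have "primitive \<inter> {v. projective (digitwise k \<circ> conjugate1 l) v \<in> ?F} = primitive \<inter> {v. T k l v \<in> ?F}"
      using p by auto
    finally show ?thesis
      unfolding measure_model[OF model_vimage[OF EL E]] by (simp del: o_apply)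
  qed
  have card: "card ?K > 0"
    using finite_SL3 SL3.id by (auto simp: card_gt_0_iff)
  have "(\<Sum>k\<in>SL3. \<Sum>l\<in>SL3. measure model {y. model_act (digitwise k \<circ> conjugate1 l) y \<in> E})
      = (\<Sum>k\<in>?K. \<Sum>l\<in>?K. (measure proj_measure {v. (True, v) \<in> E} + measure haar (primitive \<inter> {v. T k l v \<in> ?F}) / ?m) / 2)"
    by (intro sum.cong refl 1)
  also have "\<dots> = ((card ?K)\<^sup>2 * measure proj_measure {v. (True, v) \<in> E}
      + (\<Sum>k\<in>?K. \<Sum>l\<in>?K. measure haar (primitive \<inter> {v. T k l v \<in> ?F})) / ?m) / 2"
    by (simp add: sum_divide_distrib[symmetric] sum.distrib power2_eq_square)
  also have "\<dots> = (card ?K)\<^sup>2 * measure model E"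
    unfolding T_def average_dilate_contract[OF F] measure_model[OF E] measure_proj_measure[OF F]
    by (simp add: algebra_simps add_divide_distrib)
  finally show ?thesis .
qed

text \<open>Averaging over the conjugated copy turns the measure into its image under
  \<open>dilate\<close>. So if the whole copy preserved the measure, \<open>dilate\<close> would
  too; but where the first leading digit is nonzero, that image has density 1 / q^2.\<close>

lemma model_not_preserved:
  obtains l :: "'f::{finite,field} vec3 \<Rightarrow> 'f vec3" and E where "l \<in> SL3" "E \<in> sets model"
    "measure model {y. model_act (conjugate1 l) y \<in> E} \<noteq> measure model E"
proof (rule ccontr)
  let ?K = "SL3 :: ('f vec3 \<Rightarrow> 'f vec3) set" and ?m = "measure haar (primitive :: 'f digits3 set)"
  assume "\<not> thesis"
  then have pres: "measure model {y. model_act (conjugate1 l) y \<in> E} = measure model E"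
    if "l \<in> ?K" "E \<in> sets model" for l E
    using that by (metis \<open>\<And>l E. \<lbrakk>l \<in> SL3; E \<in> sets model; measure model {y. model_act (conjugate1 l) y \<in> E} \<noteq> measure model E\<rbrakk> \<Longrightarrow> thesis\<close>)
  let ?F = "{v :: 'f digits3. fst (head v) \<noteq> 0}"
  have F: "?F \<in> sets haar"
    by (rule haar_head_sets[of "\<lambda>d. fst d \<noteq> 0"])
  have FY: "UNIV \<times> ?F \<in> sets model"
    by (rule model_sets_Times[OF F])
  have card: "card ?K > 0"
    using finite_SL3 SL3.id by (auto simp: card_gt_0_iff)
  have m: "?m > 0"
    by (rule measure_primitive_pos)
  have eq: "measure haar (primitive \<inter> {v. dilate (digitwise l (contract v)) \<in> ?F}) = measure haar (primitive \<inter> ?F)"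
    if l: "l \<in> ?K" for l
  proof -
    have EL: "conjugate1 l \<in> EL3"
      by (rule EL3_conjugate1[OF l])
    have "measure proj_measure {v. projective (conjugate1 l) v \<in> ?F} = measure proj_measure ?F"
      using pres[OF l FY] unfolding measure_model[OF model_vimage[OF EL FY]] measure_model[OF FY] by simp
    moreover have "projective (conjugate1 l) \<in> haar \<rightarrow>\<^sub>M haar"
      using quasi_preserving_projective[OF EL] by (simp only: quasi_preserving_def)
    ultimately have "measure haar (primitive \<inter> {v. projective (conjugate1 l) v \<in> ?F}) = measure haar (primitive \<inter> ?F)"
      using m by (simp only: measure_proj_measure[OF F] measure_proj_measure[OF haar_vimage[OF _ F]]) simp
    moreover have "primitive \<inter> {v. projective (conjugate1 l) v \<in> ?F}
        = primitive \<inter> {v. dilate (digitwise l (contract v)) \<in> ?F}"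
      using projective_conjugate1[OF l] by auto
    ultimately show ?thesis
      by (simp only:)
  qed
  have "(\<Sum>l\<in>?K. measure haar (primitive \<inter> {v. digitwise l (contract v) \<in> {v. dilate v \<in> ?F}}))
      = card ?K * measure haar (primitive \<inter> {v. dilate v \<in> ?F})"
    by (rule average_dilate(2)[OF haar_vimage[OF dilate_contract_measurable(1) F]])
  moreover have "(\<Sum>l\<in>?K. measure haar (primitive \<inter> {v. digitwise l (contract v) \<in> {v. dilate v \<in> ?F}}))
      = (\<Sum>l\<in>?K. measure haar (primitive \<inter> ?F))"
    by (rule sum.cong[OF refl], subst mem_Collect_eq, rule eq)
  ultimately have "card ?K * measure haar (primitive \<inter> {v. dilate v \<in> ?F}) = card ?K * measure haar (primitive \<inter> ?F)"
    by (simp only: sum_constant)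
  then have "measure haar (primitive \<inter> {v. dilate v \<in> ?F}) = measure haar (primitive \<inter> ?F)"
    using card by (metis mult_cancel_left of_nat_eq_0_iff less_irrefl)
  moreover have "measure haar (primitive \<inter> {v. dilate v \<in> ?F}) = measure haar (primitive \<inter> ?F) / (real CARD('f))\<^sup>2"
  proof -
    have "measure haar (primitive \<inter> {v. dilate v \<in> ?F})
        = (\<Sum>d\<in>UNIV - {(0, 0, 0)}. (1 / (real CARD('f))\<^sup>2) * measure haar {v. v \<in> ?F \<and> head v = d})"
      unfolding measure_dilate[OF F]
    proof (intro sum.cong refl)
      fix d :: "'f vec3"
      have "{v. v \<in> ?F \<and> head v = d} = {}" if "fst d = 0"
        using that by auto
      then show "(if fst d = 0 then real CARD('f) else 1 / (real CARD('f))\<^sup>2) * measure haar {v. v \<in> ?F \<and> head v = d}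
          = 1 / (real CARD('f))\<^sup>2 * measure haar {v. v \<in> ?F \<and> head v = d}"
        by (cases "fst d = 0") (simp_all only: measure_empty mult_zero_right if_False)
    qed
    also have "\<dots> = (1 / (real CARD('f))\<^sup>2) * measure haar {v. v \<in> ?F \<and> head v \<noteq> (0, 0, 0)}"
      unfolding sum_distrib_left[symmetric] measure_head_split[OF F, of "\<lambda>d. d \<noteq> (0, 0, 0)"]
      by (intro arg_cong[of _ _ "\<lambda>x. _ * x"] sum.cong) auto
    also have "{v. v \<in> ?F \<and> head v \<noteq> (0, 0, 0)} = primitive \<inter> ?F"
      by (auto simp: primitive_def)
    finally show ?thesis
      by simp
  qed
  moreover have "primitive \<inter> ?F = ?F"
    by (auto simp: primitive_def)
  moreover have "(real CARD('f))\<^sup>2 > 1"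
  proof -
    have "card {0, 1 :: 'f} \<le> CARD('f)"
      by (intro card_mono) auto
    then have "1 < real CARD('f)"
      by simp
    then show ?thesis
      by (rule one_less_power) simp
  qed
  ultimately show False
    using measure_head1[where 'f='f] by (simp add: field_simps)
qed

section \<open>Transport to the given space\<close>

lemma digits_singleton_sets: "{x} \<in> sets (digits :: (nat \<Rightarrow> 'f::finite) measure)"
proof -
  have "Measurable.pred digits (\<lambda>y. \<forall>n. y n = x n)"
    by (intro pred_intros_countable measurable_compose[OF measurable_digit_at pred_digit_eq])
  then have "{y \<in> space digits. \<forall>n. y n = x n} \<in> sets digits"
    by (simp only: pred_def)
  moreover have "{y \<in> space digits. \<forall>n. y n = x n} = {x}"
    by (auto simp: fun_eq_iff)
  ultimately show ?thesis
    by simp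
qed

text \<open>Fixing one more digit divides the measure by q, which is at least 2.\<close>

lemma measure_digits_singleton:
  fixes x :: "nat \<Rightarrow> 'f::{finite,field}"
  shows "measure digits {x} = 0"
proof -
  have "card {0, 1 :: 'f} \<le> CARD('f)"
    by (intro card_mono) auto
  then have q: "2 \<le> real CARD('f)"
    by simp
  have step: "measure digits {x} = measure digits {\<lambda>n. x (Suc n)} / real CARD('f)" for x :: "nat \<Rightarrow> 'f"
  proof -
    have "emeasure digits {x} = (\<integral>\<^sup>+y. indicator {x} y \<partial>digits)"
      by (simp add: digits_singleton_sets)
    also have "\<dots> = (\<Sum>c\<in>UNIV. \<integral>\<^sup>+y. indicator {x} (case_nat c y) \<partial>digits) / ennreal CARD('f)"
      by (rule nn_integral_digits_split, rule borel_measurable_indicator, rule digits_singleton_sets)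
    also have "(\<Sum>c\<in>UNIV. \<integral>\<^sup>+y. indicator {x} (case_nat c y) \<partial>digits)
        = (\<Sum>c\<in>UNIV. if c = x 0 then emeasure digits {\<lambda>n. x (Suc n)} else 0)"
    proof (rule sum.cong[OF refl])
      fix c
      have "case_nat c y = x \<longleftrightarrow> c = x 0 \<and> y = (\<lambda>n. x (Suc n))" for y
        by (auto simp: fun_eq_iff split: nat.split)
      then have "(\<lambda>y. indicator {x} (case_nat c y) :: ennreal)
          = (\<lambda>y. if c = x 0 then indicator {\<lambda>n. x (Suc n)} y else 0)"
        by (auto simp: indicator_def)
      then show "(\<integral>\<^sup>+y. indicator {x} (case_nat c y) \<partial>digits)
          = (if c = x 0 then emeasure digits {\<lambda>n. x (Suc n)} else 0)"
        by (simp add: digits_singleton_sets)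
    qed
    also have "\<dots> = emeasure digits {\<lambda>n. x (Suc n)}"
      by simp
    finally have "ennreal (measure digits {x}) = ennreal (measure digits {\<lambda>n. x (Suc n)} / real CARD('f))"
      using q by (simp add: digits.emeasure_eq_measure divide_ennreal)
    then show ?thesis
      by (subst (asm) ennreal_inj) auto
  qed
  have le: "measure digits {x} \<le> (1 / 2) ^ n" for n and x :: "nat \<Rightarrow> 'f"
  proof (induction n arbitrary: x)
    case 0
    show ?case
      by (simp add: digits.prob_le_1)
  next
    case (Suc n)
    have "measure digits {x} \<le> measure digits {\<lambda>n. x (Suc n)} / 2"
      unfolding step[of x] using q by (intro divide_left_mono) auto
    also have "\<dots> \<le> (1 / 2) ^ n / 2"
      using Suc.IH[of "\<lambda>n. x (Suc n)"] by simp
    finally show ?case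
      by simp
  qed
  show ?thesis
  proof (rule ccontr)
    assume "measure digits {x} \<noteq> 0"
    then have "0 < measure digits {x}"
      by (simp add: zero_less_measure_iff)
    then obtain n where "(1 / 2) ^ n < measure digits {x}"
      using real_arch_pow_inv[of "measure digits {x}" "1 / 2"] by auto
    with le[of x n] show False
      by simp
  qed
qed

lemma haar_singleton:
  fixes v :: "'f::{finite,field} digits3"
  shows "{v} \<in> sets haar" "measure haar {v} = 0"
proof -
  obtain x y z where v: "v = (x, y, z)"
    by (cases v)
  have eq: "{v} = {x} \<times> ({y} \<times> {z})"
    by (simp add: v)
  have yz: "{y} \<times> {z} \<in> sets (digits \<Otimes>\<^sub>M digits)"
    by (intro pair_measureI digits_singleton_sets)
  show "{v} \<in> sets haar"
    unfolding eq haar_def by (intro pair_measureI yz digits_singleton_sets)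
  have "emeasure haar {v} = emeasure digits {x} * emeasure (digits \<Otimes>\<^sub>M digits) ({y} \<times> {z})"
    unfolding eq haar_def
    by (rule sigma_finite_measure.emeasure_pair_measure_Times[OF
          prob_space_imp_sigma_finite[OF digits2.prob_space_axioms] digits_singleton_sets yz])
  also have "emeasure digits {x} = 0"
    by (simp add: digits.emeasure_eq_measure measure_digits_singleton)
  finally show "measure haar {v} = 0"
    by (simp only: mult_zero_left measure_def enn2real_0)
qed

lemma model_singleton:
  fixes y :: "bool \<times> 'f::{finite,field} digits3"
  shows "{y} \<in> null_sets model"
proof -
  obtain s v where y: "y = (s, v)"
    by (cases y)
  interpret YM: prob_space "model :: (bool \<times> 'f digits3) measure"
    by (rule prob_space_model)
  interpret HM: prob_space "haar :: 'f digits3 measure"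
    by (rule prob_space_haar)
  have y_sets: "{y} \<in> sets model"
    using model_sets_Times[OF haar_singleton(1)[of v], of "{s}"] by (simp add: y)
  have "measure proj_measure {v'. (t, v') \<in> {y}} = 0" for t
  proof -
    have "measure haar (primitive \<inter> {v'. (t, v') \<in> {y}}) \<le> measure haar {v}"
      by (rule HM.finite_measure_mono) (auto simp: y haar_singleton)
    then have "measure haar (primitive \<inter> {v'. (t, v') \<in> {y}}) = 0"
      by (simp add: haar_singleton(2) measure_le_0_iff)
    then show ?thesis
      by (simp only: measure_proj_measure[OF model_section[OF y_sets]] div_0)
  qed
  then have "measure model {y} = 0"
    unfolding measure_model[OF y_sets] by simp
  then show ?thesis
    using y_sets by (simp add: null_sets_def YM.emeasure_eq_measure)
qed

text \<open>A digit that is a natural number is coded by the bits of its graph, and recovered as the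
  least index whose bit is set.\<close>

lemma bit_codedI:
  fixes D :: "nat \<Rightarrow> 'a \<Rightarrow> nat"
  assumes D: "\<And>m i. Measurable.pred M (\<lambda>x. D m x = i)"
    and R: "\<And>f :: real \<Rightarrow> nat \<Rightarrow> nat. (\<And>m. (\<lambda>r. f r m) \<in> borel \<rightarrow>\<^sub>M count_space UNIV) \<Longrightarrow> (\<lambda>r. R (f r)) \<in> borel \<rightarrow>\<^sub>M M"
    and inv: "\<And>x. x \<in> space M \<Longrightarrow> R (\<lambda>m. D m x) = x"
  shows "bit_coded M (\<lambda>k x. D (fst (prod_decode k)) x = snd (prod_decode k))
    (\<lambda>\<beta>. R (\<lambda>m. LEAST i. \<beta> (prod_encode (m, i))))"
  unfolding bit_coded_def
proof (intro conjI allI ballI)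
  show "(\<lambda>r. R (\<lambda>m. LEAST i. bit_of_real r (prod_encode (m, i)))) \<in> borel \<rightarrow>\<^sub>M M"
    by (intro R measurable_Least bit_of_real_measurable)
  have "(LEAST i. D m x = i) = D m x" for m x
    by (intro Least_equality) auto
  then show "R (\<lambda>m. LEAST i. D (fst (prod_decode (prod_encode (m, i)))) x = snd (prod_decode (prod_encode (m, i)))) = x"
    if "x \<in> space M" for x
    using inv[OF that] by simp
qed (rule D)

lemma model_bit_coded:
  obtains b dec where "bit_coded (model :: (bool \<times> 'f::{finite,field} digits3) measure) b dec"
proof -
  let ?t = "to_nat_on (UNIV :: 'f vec3 set)" and ?c = "from_nat_into (UNIV :: 'f vec3 set)"
  define D where "D m y = (case m of 0 \<Rightarrow> of_bool (fst y)
    | Suc n \<Rightarrow> ?t (fst (snd y) n, fst (snd (snd y)) n, snd (snd (snd y)) n))" for m and y :: "bool \<times> 'f digits3"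
  define R where "R f = (f 0 = (1::nat), (\<lambda>n. fst (?c (f (Suc n)))), (\<lambda>n. fst (snd (?c (f (Suc n))))),
    (\<lambda>n. snd (snd (?c (f (Suc n))))))" for f
  show ?thesis
  proof (rule that[OF bit_codedI[where M=model and D=D and R=R]])
    fix m i
    show "Measurable.pred model (\<lambda>y. D m y = i)"
    proof (cases m)
      case 0
      have "{y. D m y = i} = {s. of_bool s = i} \<times> UNIV"
        by (auto simp: D_def 0)
      then show ?thesis
        using model_sets_Times[OF sets.top, of "{s. of_bool s = i}"] by (simp add: pred_def)
    next
      case (Suc n)
      have "{y. D m y = i} = UNIV \<times> {v. ?t (fst v n, fst (snd v) n, snd (snd v) n) = i}"
        by (auto simp: D_def Suc)
      then show ?thesis
        using model_sets_Times[OF haar_digit_sets[of "\<lambda>d. ?t d = i" n], of UNIV] by (simp add: pred_def)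
    qed
  next
    fix f :: "real \<Rightarrow> nat \<Rightarrow> nat"
    assume f: "\<And>m. (\<lambda>r. f r m) \<in> borel \<rightarrow>\<^sub>M count_space UNIV"
    have g: "(\<lambda>r. g (f r m)) \<in> borel \<rightarrow>\<^sub>M (digit :: 'b measure)" for g :: "nat \<Rightarrow> 'b::finite" and m
      by (rule measurable_compose[OF f]) simp
    have s: "sets model = sets ((digit :: bool measure) \<Otimes>\<^sub>M (digits \<Otimes>\<^sub>M ((digits :: (nat \<Rightarrow> 'f) measure) \<Otimes>\<^sub>M digits)))"
      unfolding model_def by (intro sets_pair_measure_cong) (simp_all add: haar_def)
    show "(\<lambda>r. R (f r)) \<in> borel \<rightarrow>\<^sub>M model"
      unfolding R_def measurable_cong_sets[OF refl s]
      by (intro measurable_Pair measurable_digits g)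
  next
    fix y :: "bool \<times> 'f digits3"
    have "countable (UNIV :: 'f vec3 set)"
      by (simp add: countable_finite)
    then have "?c (?t d) = d" for d
      by simp
    then show "R (\<lambda>m. D m y) = y"
      by (cases y) (simp add: R_def D_def)
  qed
qed

lemma G101_fst_decode:
  assumes "g \<in> carrier G101"
  shows "fst (decode101 g) \<in> EL3"
    "h \<in> carrier G101 \<Longrightarrow> fst (decode101 (g \<otimes>\<^bsub>G101\<^esub> h)) = fst (decode101 g) \<circ> fst (decode101 h)"
  using assms by (auto simp: carrier_G101 code101_mult EL3_comp)

section \<open>The action on the given space and its completion\<close>

locale model_copy =
  fixes N :: "'x measure" and p :: "'x \<Rightarrow> bool \<times> gf101 digits3" and q :: "bool \<times> gf101 digits3 \<Rightarrow> 'x"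
  assumes N: "prob_space N" and space_N: "space N = UNIV"
    and p: "p \<in> N \<rightarrow>\<^sub>M model" and q: "q \<in> model \<rightarrow>\<^sub>M N"
    and distr_p: "distr N model p = model" and distr_q: "distr model N q = N"
    and qp: "AE x in N. q (p x) = x" and pq: "AE y in model. p (q y) = y"
begin

text \<open>The integer part acts trivially. The action laws hold only almost everywhere, because
  \<open>p\<close> and \<open>q\<close> are inverse to each other only up to null sets.\<close>

definition act :: "nat \<Rightarrow> 'x \<Rightarrow> 'x" where
  "act g x = q (model_act (fst (decode101 g)) (p x))"

lemma vimage_p: "E \<in> sets model \<Longrightarrow> p -` E \<in> sets N" "E \<in> sets model \<Longrightarrow> emeasure N (p -` E) = emeasure model E"
proof -
  assume E: "E \<in> sets model"
  show "p -` E \<in> sets N"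
    using measurable_sets[OF p E] by (simp add: space_N)
  show "emeasure N (p -` E) = emeasure model E"
    using emeasure_distr[OF p E] by (simp add: distr_p space_N)
qed

lemma vimage_q: "S \<in> sets N \<Longrightarrow> q -` S \<in> sets model" "S \<in> sets N \<Longrightarrow> emeasure model (q -` S) = emeasure N S"
proof -
  assume S: "S \<in> sets N"
  show "q -` S \<in> sets model"
    using measurable_sets[OF q S] by simp
  show "emeasure model (q -` S) = emeasure N S"
    using emeasure_distr[OF q S] by (simp add: distr_q)
qed

lemma AE_p: "AE y in model. P y \<Longrightarrow> AE x in N. P (p x)"
  by (rule AE_distrD[OF p]) (simp only: distr_p)

lemma emeasure_model_act_null:
  assumes "l \<in> EL3" "E \<in> null_sets (model :: (bool \<times> gf101 digits3) measure)"
  shows "{y. model_act l y \<in> E} \<in> null_sets model"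
proof -
  interpret YM: prob_space "model :: (bool \<times> gf101 digits3) measure"
    by (rule prob_space_model)
  show ?thesis
    using assms model_vimage[of l E] model_act_null[of l E]
    by (auto simp: null_sets_def YM.emeasure_eq_measure)
qed

lemma AE_model_act:
  assumes "l \<in> EL3" and P: "AE y in model. P (y :: bool \<times> gf101 digits3)"
  shows "AE y in model. P (model_act l y)"
proof -
  obtain Z where Z: "Z \<in> null_sets model" "{y \<in> space model. \<not> P y} \<subseteq> Z"
    using P by (rule AE_E) (auto simp: null_sets_def)
  show ?thesis
    by (rule AE_I'[OF emeasure_model_act_null[OF assms(1) Z(1)]]) (use Z(2) in auto)
qed

lemma act_vimage:
  assumes "g \<in> carrier G101" and S: "S \<in> sets N"
  shows "act g -` S \<in> sets N"
    "emeasure N (act g -` S) = emeasure model {y. model_act (fst (decode101 g)) y \<in> q -` S}"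
proof -
  let ?E = "{y. model_act (fst (decode101 g)) y \<in> q -` S}"
  have E: "?E \<in> sets model"
    by (rule model_vimage[OF G101_fst_decode(1)[OF assms(1)] vimage_q(1)[OF S]])
  have "act g -` S = p -` ?E"
    by (auto simp: act_def)
  then show "act g -` S \<in> sets N" "emeasure N (act g -` S) = emeasure model ?E"
    using vimage_p[OF E] by simp_all
qed

lemma act_null:
  assumes g: "g \<in> carrier G101" and S: "S \<in> null_sets N"
  shows "act g -` S \<in> null_sets N"
proof -
  have "q -` S \<in> null_sets model"
    using S vimage_q[of S] by (auto simp: null_sets_def)
  from emeasure_model_act_null[OF G101_fst_decode(1)[OF g] this]
  show ?thesis
    using S act_vimage[OF g, of S] by (auto simp: null_sets_def)
qed

text \<open>Measurability for the completion needs preimages of null sets to be null, so it rests on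
  \<open>act_null\<close>.\<close>

lemma act_measurable:
  assumes g: "g \<in> carrier G101"
  shows "act g \<in> completion N \<rightarrow>\<^sub>M completion N"
proof -
  have m: "act g \<in> N \<rightarrow>\<^sub>M N"
    using act_vimage(1)[OF g] by (intro measurableI) (simp_all add: space_N)
  show ?thesis
  proof (rule completion.measurable_completion2[OF measurable_completion[OF m]])
    show "null_sets N \<subseteq> null_sets (distr (completion N) N (act g))"
    proof
      fix S assume S: "S \<in> null_sets N"
      have "emeasure (distr (completion N) N (act g)) S = emeasure (completion N) (act g -` S)"
        using emeasure_distr[OF measurable_completion[OF m] null_setsD2[OF S]] by (simp add: space_N)
      also have "\<dots> = 0"
        by (rule null_setsD1[OF null_sets_completionI[OF act_null[OF g S]]])
      finally show "S \<in> null_sets (distr (completion N) N (act g))"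
        using null_setsD2[OF S] by (simp add: null_sets_def)
    qed
  qed
qed

lemma act_mult:
  assumes g: "g \<in> carrier G101" and h: "h \<in> carrier G101"
  shows "AE x in N. act (g \<otimes>\<^bsub>G101\<^esub> h) x = act g (act h x)"
proof -
  have "AE x in N. p (q (model_act (fst (decode101 h)) (p x))) = model_act (fst (decode101 h)) (p x)"
    by (rule AE_p[OF AE_model_act[OF G101_fst_decode(1)[OF h] pq]])
  then show ?thesis
    by eventually_elim
      (simp only: act_def G101_fst_decode(2)[OF g h] model_act_comp[OF G101_fst_decode(1)[OF g] G101_fst_decode(1)[OF h]])
qed

lemma act_one: "AE x in N. act \<one>\<^bsub>G101\<^esub> x = x"
  using qp by eventually_elim (simp add: act_def one_G101 EL3.id model_act_id)

lemma nonsingular_act: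
  assumes g: "g \<in> carrier G101"
  shows "nonsingular_aut (completion N) (act g)"
proof -
  interpret G: group G101 by (rule group_G101)
  let ?h = "inv\<^bsub>G101\<^esub> g"
  have h: "?h \<in> carrier G101"
    using g by simp
  have inv: "AE x in completion N. act ?h (act g x) = x" "AE x in completion N. act g (act ?h x) = x"
    using act_mult[OF h g] act_mult[OF g h] act_one g by (auto simp: AE_completion_iff)
  have null: "act g' -` A \<in> null_sets (completion N)" if g': "g' \<in> carrier G101" and A: "A \<in> null_sets (completion N)" for g' A
  proof -
    obtain B where B: "B \<in> null_sets N" "A \<subseteq> B"
      using A null_sets_completion_iff2[of A N] by auto
    show ?thesis
      using act_null[OF g' B(1)] B(2) by (intro completion.complete2[of "act g' -` A" "act g' -` B"] null_sets_completionI) auto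
  qed
  show ?thesis
    unfolding nonsingular_aut_def
  proof (intro conjI ballI exI iffI)
    show "ae_inverse (completion N) (act g) (act ?h)"
      unfolding ae_inverse_def using inv act_measurable[OF h] by simp
    fix A assume A: "A \<in> sets (completion N)"
    \<comment> \<open>Pulling the null preimage back along the inverse recovers \<open>A\<close> up
      to a null set.\<close>
    show "emeasure (completion N) A = 0" if z: "emeasure (completion N) (act g -` A \<inter> space (completion N)) = 0"
    proof -
      have "act g -` A \<in> sets (completion N)"
        using measurable_sets[OF act_measurable[OF g] A] by (simp add: space_N)
      then have "act g -` A \<in> null_sets (completion N)"
        using z by (simp add: null_sets_def space_N)
      from null[OF h this] have "AE x in completion N. x \<notin> act ?h -` act g -` A"
        by (rule AE_not_in)
      with inv(2) have "AE x in completion N. x \<notin> A"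
        by eventually_elim auto
      then show ?thesis
        using A by (subst (asm) AE_iff_null) (auto simp: space_N null_sets_def)
    qed
    show "emeasure (completion N) (act g -` A \<inter> space (completion N)) = 0" if "emeasure (completion N) A = 0"
      using null[OF g, of A] A that by (simp add: null_sets_def space_N)
  qed (rule act_measurable[OF g])
qed

lemma act_stationary:
  assumes A: "A \<in> sets (completion N)"
  shows "(\<integral>\<^sup>+g. emeasure (distr (completion N) (completion N) (act g)) A \<partial>mu101) = emeasure (completion N) A"
proof -
  interpret YM: prob_space "model :: (bool \<times> gf101 digits3) measure"
    by (rule prob_space_model)
  \<comment> \<open>A set of \<open>sets N\<close> that agrees with \<open>A\<close> almost
    everywhere, so that the computation can be made in the model.\<close>
  let ?S = "main_part N A" and ?K = "SL3 :: (gf101 vec3 \<Rightarrow> gf101 vec3) set"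
  have S: "?S \<in> sets N"
    by (rule main_part_sets[OF A])
  let ?E = "q -` ?S"
  have E: "?E \<in> sets model"
    by (rule vimage_q(1)[OF S])
  let ?e = "\<lambda>g. emeasure model {y. model_act (fst (decode101 g)) y \<in> ?E}"
  have 1: "emeasure (distr (completion N) (completion N) (act g)) A = ?e g" if g: "g \<in> carrier G101" for g
  proof -
    have "AE x in completion N. x \<in> ?S \<longleftrightarrow> x \<in> A"
      using AE_in_main_part[OF A] by (rule AE_completion)
    then have "AE x in completion N. act g x \<in> ?S \<longleftrightarrow> act g x \<in> A"
      by (rule AE_nonsingular_aut[OF nonsingular_act[OF g]])
    moreover have "act g -` A \<in> sets (completion N)"
      using measurable_sets[OF act_measurable[OF g] A] by (simp add: space_N)
    moreover have S': "act g -` ?S \<in> sets (completion N)"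
      by (rule sets_completionI_sets[OF act_vimage(1)[OF g S]])
    ultimately have "emeasure (completion N) (act g -` A) = emeasure (completion N) (act g -` ?S)"
      by (intro emeasure_eq_AE) auto
    also have "\<dots> = ?e g"
      using act_vimage[OF g S] by simp
    finally show ?thesis
      using emeasure_distr[OF act_measurable[OF g] A] by (simp add: space_N)
  qed
  have card: "card ?K > 0"
    using finite_SL3 SL3_nonempty by (auto simp: card_gt_0_iff)
  have "set_pmf mu101 \<subseteq> carrier G101"
    using generating_mu101 by (simp add: generating_def)
  then have "(\<integral>\<^sup>+g. emeasure (distr (completion N) (completion N) (act g)) A \<partial>mu101) = (\<integral>\<^sup>+g. ?e g \<partial>mu101)"
    using 1 by (intro nn_integral_cong_AE) (auto simp: AE_measure_pmf_iff)
  also have "\<dots> = (\<integral>\<^sup>+k. \<integral>\<^sup>+l. \<integral>\<^sup>+n. ?e (code101 (digitwise k \<circ> conjugate1 l, n))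
      \<partial>pmf_of_set {- 1, 0, 1} \<partial>pmf_of_set ?K \<partial>pmf_of_set ?K)"
    unfolding mu101_def nn_integral_map_pmf nn_integral_pair_pmf' prod.case ..
  also have "\<dots> = (\<Sum>k\<in>?K. (\<Sum>l\<in>?K. \<integral>\<^sup>+n. ?e (code101 (digitwise k \<circ> conjugate1 l, n))
      \<partial>pmf_of_set {- 1, 0, 1}) / card ?K) / card ?K"
    by (simp only: nn_integral_pmf_of_set[OF SL3_nonempty finite_SL3])
  \<comment> \<open>The integrand does not depend on the integer coordinate, so the average over it
    is trivial.\<close>
  also have "\<dots> = (\<Sum>k\<in>?K. (\<Sum>l\<in>?K. ennreal (measure model {y. model_act (digitwise k \<circ> conjugate1 l) y \<in> ?E})) / card ?K) / card ?K"
  proof (intro arg_cong[where f="\<lambda>x. x / _"] sum.cong refl)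
    fix k l assume "k \<in> ?K" "l \<in> ?K"
    then have "digitwise k \<circ> conjugate1 l \<in> EL3"
      by (intro EL3_comp EL3_digitwise EL3_conjugate1)
    then show "(\<integral>\<^sup>+n. ?e (code101 (digitwise k \<circ> conjugate1 l, n)) \<partial>pmf_of_set {- 1, 0, 1})
        = ennreal (measure model {y. model_act (digitwise k \<circ> conjugate1 l) y \<in> ?E})"
      by (simp only: decode_code101 fst_conv YM.emeasure_eq_measure nn_integral_const
          measure_pmf.emeasure_space_1 mult_1_right)
  qed
  also have "\<dots> = ennreal ((\<Sum>k\<in>?K. \<Sum>l\<in>?K. measure model {y. model_act (digitwise k \<circ> conjugate1 l) y \<in> ?E}) / card ?K / card ?K)"
    using card by (simp only: sum_ennreal measure_nonneg sum_nonneg divide_nonneg_nonneg of_nat_0_le_iff sum_divide_distrib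
        ennreal_of_nat_eq_real_of_nat divide_ennreal of_nat_0_less_iff)
  also have "\<dots> = ennreal (measure model ?E)"
    unfolding model_stationary[OF E] by (simp add: power2_eq_square SL3_nonempty finite_SL3)
  also have "\<dots> = emeasure (completion N) A"
    using A vimage_q(2)[OF S] by (simp add: YM.emeasure_eq_measure)
  finally show ?thesis .
qed

lemma act_A_mu: "act \<in> A_mu G101 mu101 (completion N)"
  unfolding A_mu_def nonsingular_action_def
  using nonsingular_act act_stationary act_mult by (auto intro: AE_completion)

lemma not_ergodic_dense_G101: "\<not> ergodic_dense G101 mu101 (completion N)"
proof -
  interpret N: prob_space N by (rule N)
  interpret YM: prob_space "model :: (bool \<times> gf101 digits3) measure"
    by (rule prob_space_model)
  interpret PM: prob_space "proj_measure :: gf101 digits3 measure"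
    by (rule prob_space_proj_measure)
  obtain l :: "gf101 vec3 \<Rightarrow> gf101 vec3" and E where l: "l \<in> SL3" and E: "E \<in> sets model"
      and ne: "measure model {y. model_act (conjugate1 l) y \<in> E} \<noteq> measure model E"
    by (rule model_not_preserved)
  have EL: "conjugate1 l \<in> EL3"
    by (rule EL3_conjugate1[OF l])
  let ?g = "code101 (conjugate1 l, 0)" and ?T = "{True} \<times> UNIV :: (bool \<times> gf101 digits3) set"
  have T: "?T \<in> sets model"
    using model_sets_Times[OF sets.top] by simp
  have pT: "p -` ?T \<in> sets N" and pE: "p -` E \<in> sets N"
    by (rule vimage_p(1)[OF T], rule vimage_p(1)[OF E])
  show ?thesis
  \<comment> \<open>\<open>A\<close> is the trivial half, of measure 1/2, and \<open>E\<close> is a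
    set whose measure is changed by an element of the conjugated copy.\<close>
  proof (rule not_ergodic_dense[where k="\<lambda>i c. code101 (elmat i c, 0)" and I="{..<5}" and pr=linear_part
        and a=act and A="p -` ?T" and E="p -` E" and g="?g"])
    show "group G101" "countable (carrier G101)" "finite (set_pmf mu101)" "generating G101 mu101"
      by (simp_all add: group_G101 finite_mu101 generating_mu101)
    show "prob_space (completion N)"
      by (rule prob_spaceI) (simp add: N.emeasure_space_1)
    show "space (completion N) = UNIV"
      by (simp add: space_N)
    show "complete_measure (completion N)"
      by (rule completion.complete_measure_axioms)
    fix g h assume gh: "g \<in> carrier G101" "h \<in> carrier G101"
    show "linear_part (g \<otimes>\<^bsub>G101\<^esub> h) = linear_part g \<otimes>\<^bsub>G101\<^esub> linear_part h"
      using gh by (auto simp: carrier_G101 code101_mult EL3_comp)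
    show "h \<otimes>\<^bsub>G101\<^esub> (inv\<^bsub>G101\<^esub> linear_part g \<otimes>\<^bsub>G101\<^esub> g) = inv\<^bsub>G101\<^esub> linear_part g \<otimes>\<^bsub>G101\<^esub> g \<otimes>\<^bsub>G101\<^esub> h"
      by (rule linear_part_central[OF gh])
  next
    fix g assume g: "g \<in> carrier G101"
    show "linear_part g \<in> carrier G101" "linear_part (linear_part g) = linear_part g"
      using g unfolding carrier_G101[of g] by (elim bexE exE; simp)+
    show "AE x in completion N. x \<in> p -` ?T \<longrightarrow> act g x = x"
    proof (rule AE_completion)
      show "AE x in N. x \<in> p -` ?T \<longrightarrow> act g x = x"
        using qp by eventually_elim (auto simp: act_def)
    qed
  next
    fix i j :: nat assume "i \<in> {..<5}" "j \<in> {..<5}" "i \<noteq> j"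
    then show "(\<forall>c d. code101 (elmat i c, 0) \<otimes>\<^bsub>G101\<^esub> code101 (elmat j d, 0)
        = code101 (elmat j d, 0) \<otimes>\<^bsub>G101\<^esub> code101 (elmat i c, 0))
      \<or> (\<exists>z. group.heis G101 (\<lambda>c. code101 (elmat i c, 0)) (\<lambda>c. code101 (elmat j c, 0)) z)
      \<or> (\<exists>z. group.heis G101 (\<lambda>c. code101 (elmat j c, 0)) (\<lambda>c. code101 (elmat i c, 0)) z)"
      using elem_relations_G101[of i j] by simp
  next
    show "linear_part ` carrier G101 \<subseteq> semigroup_generated G101 (\<Union>i\<in>{..<5}. range (\<lambda>c. code101 (elmat i c, 0)))"
      (is "_ \<subseteq> semigroup_generated G101 ?U")
    proof (rule image_subsetI)
      fix g assume "g \<in> carrier G101"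
      then obtain l n where l: "l \<in> EL3" "g = code101 (l, n)"
        unfolding carrier_G101 by blast
      have "code101 (elmat i c, 0) \<in> semigroup_generated G101 ?U" if "i < 5" for i c
        using that by (intro semigroup_generated.gen UN_I[of i] rangeI) simp
      then have "code101 (l, 0) \<in> semigroup_generated G101 ?U"
        using l(1) by (rule elem_code_in_semigroup)
      then show "linear_part g \<in> semigroup_generated G101 ?U"
        by (simp only: l linear_part_code)
    qed
  next
    have "measure model ?T = 1 / 2"
      unfolding measure_model[OF T] using PM.prob_space by simp
    then show "0 < emeasure (completion N) (p -` ?T)"
      using pT vimage_p(2)[OF T] by (simp add: YM.emeasure_eq_measure)
  next
    have "emeasure (completion N) (act (linear_part ?g) -` p -` E)
        = emeasure model {y. model_act (conjugate1 l) y \<in> q -` p -` E}"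
      using act_vimage[OF code101_in_carrier[OF EL] pE, of 0] EL by simp
    also have "\<dots> = emeasure model {y. model_act (conjugate1 l) y \<in> E}"
    proof (rule emeasure_eq_AE)
      have "AE y in model. p (q y) \<in> E \<longleftrightarrow> y \<in> E"
        using pq by eventually_elim simp
      from AE_model_act[OF EL this]
      show "AE y in model. y \<in> {y. model_act (conjugate1 l) y \<in> q -` p -` E} \<longleftrightarrow> y \<in> {y. model_act (conjugate1 l) y \<in> E}"
        by simp
    qed (rule model_vimage[OF EL vimage_q(1)[OF pE]], rule model_vimage[OF EL E])
    finally show "emeasure (completion N) (act (linear_part ?g) -` p -` E) \<noteq> emeasure (completion N) (p -` E)"
      using ne vimage_p[OF E] by (simp add: YM.emeasure_eq_measure)
  next
    show "act \<in> A_mu G101 mu101 (completion N)"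
      by (rule act_A_mu)
    show "p -` ?T \<in> sets (completion N)" "p -` E \<in> sets (completion N)"
      by (rule sets_completionI_sets[OF pT], rule sets_completionI_sets[OF pE])
    show "?g \<in> carrier G101"
      by (rule code101_in_carrier[OF EL])
    show "finite {..<5::nat}" "{..<5::nat} \<noteq> {}" "card {..<5::nat} \<le> 5" "100 \<le> CARD(gf101)"
      by (simp_all add: card_gf101 lessThan_empty_iff)
    show "group.one_param G101 (\<lambda>c. code101 (elmat i c, 0))" if "i \<in> {..<5}" for i
      using that by (intro elem_one_param_G101) simp
  qed
qed

end

text \<open>A standard nonatomic Lebesgue space is taken as the completion of a Borel probability
  measure on a Polish space. The witnesses \<open>G101\<close> and \<open>mu101\<close> are the same
  for every \<open>N\<close>.\<close>

theorem theorem1p5: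
  fixes N :: "'x::polish_space measure"
  assumes "sets N = sets borel" and "prob_space N" and "atomless (completion N)"
  shows "\<exists>(G :: nat monoid) (\<mu> :: nat pmf).
           group G \<and> countable (carrier G) \<and> \<not> kazhdan_T G \<and> generating G \<mu>
           \<and> \<not> ergodic_dense G \<mu> (completion N)"
proof -
  have sp: "space N = UNIV"
    using sets_eq_imp_space_eq[OF assms(1)] by simp
  \<comment> \<open>A point has no subset of intermediate measure, so in an atomless space it has no
    mass.\<close>
  have null: "{x} \<in> null_sets N" for x
  proof (rule ccontr)
    have x: "{x} \<in> sets N"
      by (simp add: assms(1))
    assume "{x} \<notin> null_sets N"
    then have "0 < emeasure (completion N) {x}"
      using x by (simp add: null_sets_def zero_less_iff_neq_zero)
    then obtain B where "B \<subseteq> {x}" "0 < emeasure (completion N) B" "emeasure (completion N) B < emeasure (completion N) {x}"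
      using assms(3) sets_completionI_sets[OF x] unfolding atomless_def by blast
    then show False
      by (auto simp: subset_singleton_iff)
  qed
  obtain b dec where b: "bit_coded N b dec"
    by (rule polish_bit_coded[OF assms(1)])
  obtain b' dec' where b': "bit_coded (model :: (bool \<times> gf101 digits3) measure) b' dec'"
    by (rule model_bit_coded)
  obtain p q where "p \<in> N \<rightarrow>\<^sub>M (model :: (bool \<times> gf101 digits3) measure)" "q \<in> model \<rightarrow>\<^sub>M N"
      "distr N model p = model" "distr model N q = N" "AE x in N. q (p x) = x" "AE y in model. p (q y) = y"
    by (rule isomorphic_mod_null[OF assms(2) b null prob_space_model b' model_singleton])
  then have "model_copy N p q"
    using assms(2) sp by (simp add: model_copy_def)
  then show ?thesis
    using model_copy.not_ergodic_dense_G101 group_G101 not_kazhdan_T_G101 generating_mu101 by blast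
qed

end
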